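(* Let $X$ be a paracompact topological space. Let $\mathfrak A_\bullet$ and $\mathfrak A_\bullet'$ be flabby cosheaves on $X$ with values in $\mathsf{C}(\mathsf{Ab})$, together with a natural transformation $\eta:\mathfrak A_\bullet\to\mathfrak A_\bullet'$. Let $A$ and $A'$ be precosheaves on $X$ with values in $\mathsf{Ab}$ together with natural transformations $\zeta:A\to A'$, $\xi:\mathfrak A_0\to A$ and $\xi':\mathfrak A_0'\to A'$ such that $\xi'\eta=\zeta\xi$. Suppose that $\xi:\mathfrak A_\bullet\to A$ and $\xi':\mathfrak A_\bullet'\to A'$ are augmentations. Assume further that $\eta:\mathfrak A_0(U)\to\mathfrak A_0'(U)$ is surjective and $\zeta:A(U)\to A'(U)$ is injective for each open set $U\subset X$. Let $m\ge 0$. Then the following hold. (1) If the precosheaves $\tilde H_p(\mathfrak A_\bullet)$ are locally trivial on $X$ for $0\le p\le m$, then $\eta_\ast:H_m(\mathfrak A_\bullet(U))\to H_m(\mathfrak A_\bullet'(U))$ is injective for every open $U\subset X$. Here $\tilde H_p(\mathfrak A_\bullet)$ is the $p$-th homology of the augmented complex $\xi:\mathfrak A_\bullet\to A$. (2) If the precosheaves $\tilde H_p(\mathfrak A_\bullet)$ for $0\le p\le m-1$ and $H_q(\mathfrak A_\bullet')$ for $1\le q\le m$ are locally trivial on $X$, then $\eta_\ast:H_m(\mathfrak A_\bullet(U))\to H_m(\mathfrak A_\bullet'(U))$ is surjective for every open $U\subset X$.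
   Context: $\mathsf{Ab}$ is the category of abelian groups; $\mathsf{C}(\mathsf{Ab})$ is the category of chain complexes of abelian groups indexed by nonnegative integers. A topological space is paracompact if every open covering admits a locally finite open refinement. $\mathsf O(X)$ is the poset category of open subsets of $X$ under inclusion. A *precosheaf* on $X$ with values in $\mathsf C\in\{\mathsf{Ab},\mathsf C(\mathsf{Ab})\}$ is a covariant functor $\mathfrak A:\mathsf O(X)\to\mathsf C$; only precosheaves with $\mathfrak A(\emptyset)=0$ are considered. For $U\subset V$ write $i_{V,U}:\mathfrak A(U)\to\mathfrak A(V)$ for the induced morphism. $\mathfrak A$ is *flabby* if $i_{V,U}$ is injective for all open $U\subset V$. A precosheaf $\mathfrak A$ is a *cosheaf* if for every family $\{U_\alpha\}_{\alpha\in I}$ of open sets with union $U$, the sequence $$\bigoplus_{\alpha,\beta\in I}\mathfrak A(U_\alpha\cap U_\beta)\xrightarrow{\Phi}\bigoplus_{\alpha\in I}\mathfrak A(U_\alpha)\xrightarrow{\varepsilon}\mathfrak A(U)\to0$$ is exact, where $\Phi=\sum_{\alpha,\beta}(i_{U_\alpha,U_\alpha\cap U_\beta}-i_{U_\beta,U_\alpha\cap U_\beta})$ and $\varepsilon=\sum_\alpha i_{U,U_\alpha}$. For a complex $(C_\bullet,\partial)$ and an abelian group $B$, a homomorphism $\xi:C_0\to B$ is an *augmentation*, written $\xi:C_\bullet\to B$, if $\xi\circ\partial_1=0$; for precosheaves, this is required over every open set. The reduced homology is $\tilde H_p(C_\bullet)=H_p(C_\bullet)$ for $p\ge1$ and $\tilde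 H_0(C_\bullet)=\ker\xi/\operatorname{im}\partial_1$. The assignments $U\mapsto \tilde H_p(\mathfrak A_\bullet(U))$ and $U\mapsto H_q(\mathfrak A'_\bullet(U))$ are precosheaves on $X$. A precosheaf $\mathfrak H$ of abelian groups on $X$ is *locally trivial* if for any $x\in X$ and open $U\ni x$ there is an open $V$ with $x\in V\subset U$ such that the map $\mathfrak H(V)\to\mathfrak H(U)$ is zero. *)

theory Defs
  imports "HOL-Analysis.Analysis" "HOL-Algebra.Free_Abelian_Groups"
begin

text \<open>
  Abelian groups are \<^locale>\<open>comm_group\<close> records and are therefore written multiplicatively:
  the zero element is \<open>\<one>\<close>, and ``the zero map'' is the map with constant value \<open>\<one>\<close>.
\<close>

definition paracompact_space :: "'a topology \<Rightarrow> bool" where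
  "paracompact_space X \<longleftrightarrow>
     (\<forall>\<U>. (\<forall>U\<in>\<U>. openin X U) \<and> \<Union>\<U> = topspace X \<longrightarrow>
        (\<exists>\<V>. (\<forall>V\<in>\<V>. openin X V) \<and> \<Union>\<V> = topspace X \<and>
             (\<forall>V\<in>\<V>. \<exists>U\<in>\<U>. V \<subseteq> U) \<and> locally_finite_in X \<V>))"


subsection \<open>Chain complexes and homology\<close>

text \<open>\<open>bd C p\<close> is the boundary operator from degree \<open>p\<close> to degree \<open>p - 1\<close> for \<open>p \<ge> 1\<close>;
  \<open>bd C 0\<close> is irrelevant.\<close>

record 'g cplx =
  grp :: "nat \<Rightarrow> 'g monoid"
  bd :: "nat \<Rightarrow> 'g \<Rightarrow> 'g"

definition chain_cplx :: "'g cplx \<Rightarrow> bool" where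
  "chain_cplx C \<longleftrightarrow>
     (\<forall>p. comm_group (grp C p)) \<and>
     (\<forall>p. bd C (Suc p) \<in> hom (grp C (Suc p)) (grp C p)) \<and>
     (\<forall>p. \<forall>x \<in> carrier (grp C (Suc (Suc p))).
        bd C (Suc p) (bd C (Suc (Suc p)) x) = \<one>\<^bsub>grp C p\<^esub>)"

definition chain_map_betw :: "'g cplx \<Rightarrow> 'h cplx \<Rightarrow> (nat \<Rightarrow> 'g \<Rightarrow> 'h) \<Rightarrow> bool" where
  "chain_map_betw C D f \<longleftrightarrow>
     (\<forall>p. f p \<in> hom (grp C p) (grp D p)) \<and>
     (\<forall>p. \<forall>x \<in> carrier (grp C (Suc p)). f p (bd C (Suc p) x) = bd D (Suc p) (f (Suc p) x))"

definition augmentation_of :: "'g cplx \<Rightarrow> 'b monoid \<Rightarrow> ('g \<Rightarrow> 'b) \<Rightarrow> bool" where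
  "augmentation_of C B \<xi> \<longleftrightarrow>
     \<xi> \<in> hom (grp C 0) B \<and> (\<forall>x \<in> carrier (grp C 1). \<xi> (bd C 1 x) = \<one>\<^bsub>B\<^esub>)"

definition cycles :: "'g cplx \<Rightarrow> nat \<Rightarrow> 'g set" where
  "cycles C p =
     (if p = 0 then carrier (grp C 0) else kernel (grp C p) (grp C (p - 1)) (bd C p))"

definition reduced_cycles :: "'g cplx \<Rightarrow> 'b monoid \<Rightarrow> ('g \<Rightarrow> 'b) \<Rightarrow> nat \<Rightarrow> 'g set" where
  "reduced_cycles C B \<xi> p = (if p = 0 then kernel (grp C 0) B \<xi> else cycles C p)"

definition boundaries :: "'g cplx \<Rightarrow> nat \<Rightarrow> 'g set" where
  "boundaries C p = bd C (Suc p) ` carrier (grp C (Suc p))"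

definition homology :: "'g cplx \<Rightarrow> nat \<Rightarrow> 'g set monoid" where
  "homology C p = subgroup_generated (grp C p) (cycles C p) Mod boundaries C p"

definition reduced_homology ::
    "'g cplx \<Rightarrow> 'b monoid \<Rightarrow> ('g \<Rightarrow> 'b) \<Rightarrow> nat \<Rightarrow> 'g set monoid" where
  "reduced_homology C B \<xi> p =
     subgroup_generated (grp C p) (reduced_cycles C B \<xi> p) Mod boundaries C p"

text \<open>The map induced in homology (or reduced homology) by a chain map \<open>f\<close> into \<open>D\<close>. A homology
  class is a coset \<open>c\<close> of the boundaries, and \<open>f p ` c\<close> in general only lies inside a coset of
  the boundaries of \<open>D\<close>; the set product yields this coset, see \<open>homology_map_coset\<close> below.\<close>

definition homology_map :: "'h cplx \<Rightarrow> (nat \<Rightarrow> 'g \<Rightarrow> 'h) \<Rightarrow> nat \<Rightarrow> 'g set \<Rightarrow> 'h set" where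
  "homology_map D f p c = boundaries D p <#>\<^bsub>grp D p\<^esub> (f p ` c)"

lemma homology_map_coset:
  assumes C: "chain_cplx C" and D: "chain_cplx D" and f: "chain_map_betw C D f"
    and z: "z \<in> carrier (grp C p)"
  shows "homology_map D f p (boundaries C p #>\<^bsub>grp C p\<^esub> z)
         = boundaries D p #>\<^bsub>grp D p\<^esub> f p z"
proof -
  interpret C: comm_group "grp C p" using C by (simp add: chain_cplx_def)
  interpret C1: comm_group "grp C (Suc p)" using C by (simp add: chain_cplx_def)
  interpret D: comm_group "grp D p" using D by (simp add: chain_cplx_def)
  interpret D1: comm_group "grp D (Suc p)" using D by (simp add: chain_cplx_def)
  have dC: "bd C (Suc p) \<in> hom (grp C (Suc p)) (grp C p)"
    and dD: "bd D (Suc p) \<in> hom (grp D (Suc p)) (grp D p)"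
    using C D by (simp_all add: chain_cplx_def)
  have fh: "f q \<in> hom (grp C q) (grp D q)"
    and fc: "x \<in> carrier (grp C (Suc q)) \<Longrightarrow> f q (bd C (Suc q) x) = bd D (Suc q) (f (Suc q) x)"
    for q x using f by (auto simp: chain_map_betw_def)
  have fz: "f p z \<in> carrier (grp D p)"
    using fh z by (rule hom_in_carrier)
  have f_shift: "f p (bd C (Suc p) x \<otimes>\<^bsub>grp C p\<^esub> z)
      = bd D (Suc p) (f (Suc p) x) \<otimes>\<^bsub>grp D p\<^esub> f p z"
    if "x \<in> carrier (grp C (Suc p))" for x
    using hom_mult[OF fh hom_in_carrier[OF dC that] z] fc[OF that] by simp
  show ?thesis
  proof (intro equalityI subsetI)
    fix w assume "w \<in> homology_map D f p (boundaries C p #>\<^bsub>grp C p\<^esub> z)"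
    then obtain y x where y: "y \<in> carrier (grp D (Suc p))" and x: "x \<in> carrier (grp C (Suc p))"
      and w: "w = bd D (Suc p) y \<otimes>\<^bsub>grp D p\<^esub> f p (bd C (Suc p) x \<otimes>\<^bsub>grp C p\<^esub> z)"
      by (auto simp: homology_map_def set_mult_def r_coset_def boundaries_def)
    have fx: "f (Suc p) x \<in> carrier (grp D (Suc p))"
      using fh x by (rule hom_in_carrier)
    have "w = bd D (Suc p) (y \<otimes>\<^bsub>grp D (Suc p)\<^esub> f (Suc p) x) \<otimes>\<^bsub>grp D p\<^esub> f p z"
      using w f_shift[OF x] hom_mult[OF dD y fx] fz hom_in_carrier[OF dD y] hom_in_carrier[OF dD fx]
      by (simp add: D.m_assoc)
    moreover have "y \<otimes>\<^bsub>grp D (Suc p)\<^esub> f (Suc p) x \<in> carrier (grp D (Suc p))"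
      using y fx by simp
    ultimately show "w \<in> boundaries D p #>\<^bsub>grp D p\<^esub> f p z"
      by (auto simp: r_coset_def boundaries_def)
  next
    fix w assume "w \<in> boundaries D p #>\<^bsub>grp D p\<^esub> f p z"
    then obtain y where y: "y \<in> carrier (grp D (Suc p))"
      and w: "w = bd D (Suc p) y \<otimes>\<^bsub>grp D p\<^esub> f p z"
      by (auto simp: r_coset_def boundaries_def)
    have "bd C (Suc p) \<one>\<^bsub>grp C (Suc p)\<^esub> = \<one>\<^bsub>grp C p\<^esub>"
      using hom_one[OF dC] C1.is_group C.is_group by blast
    then have "\<one>\<^bsub>grp C p\<^esub> \<in> boundaries C p"
      unfolding boundaries_def by (metis C1.one_closed imageI)
    then have "z \<in> boundaries C p #>\<^bsub>grp C p\<^esub> z"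
      unfolding r_coset_def using z by force
    then show "w \<in> homology_map D f p (boundaries C p #>\<^bsub>grp C p\<^esub> z)"
      using y w unfolding homology_map_def set_mult_def boundaries_def by blast
  qed
qed


subsection \<open>Precosheaves of abelian groups\<close>

text \<open>\<open>ext A V U\<close> is the morphism from \<open>sec A U\<close> to \<open>sec A V\<close> for open sets \<open>U \<subseteq> V\<close>.\<close>

record ('a, 'g) precosh =
  sec :: "'a set \<Rightarrow> 'g monoid"
  ext :: "'a set \<Rightarrow> 'a set \<Rightarrow> 'g \<Rightarrow> 'g"

definition precosheaf :: "'a topology \<Rightarrow> ('a, 'g) precosh \<Rightarrow> bool" where
  "precosheaf X A \<longleftrightarrow>
     (\<forall>U. openin X U \<longrightarrow> comm_group (sec A U)) \<and>
     (\<forall>U V. openin X U \<and> openin X V \<and> U \<subseteq> V \<longrightarrow> ext A V U \<in> hom (sec A U) (sec A V)) \<and>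
     (\<forall>U. openin X U \<longrightarrow> (\<forall>x \<in> carrier (sec A U). ext A U U x = x)) \<and>
     (\<forall>U V W. openin X U \<and> openin X V \<and> openin X W \<and> U \<subseteq> V \<and> V \<subseteq> W \<longrightarrow>
        (\<forall>x \<in> carrier (sec A U). ext A W V (ext A V U x) = ext A W U x)) \<and>
     trivial_group (sec A {})"

definition nat_transf ::
    "'a topology \<Rightarrow> ('a, 'g) precosh \<Rightarrow> ('a, 'h) precosh \<Rightarrow> ('a set \<Rightarrow> 'g \<Rightarrow> 'h) \<Rightarrow> bool" where
  "nat_transf X A B \<phi> \<longleftrightarrow>
     (\<forall>U. openin X U \<longrightarrow> \<phi> U \<in> hom (sec A U) (sec B U)) \<and>
     (\<forall>U V. openin X U \<and> openin X V \<and> U \<subseteq> V \<longrightarrow>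
        (\<forall>x \<in> carrier (sec A U). \<phi> V (ext A V U x) = ext B V U (\<phi> U x)))"

definition flabby :: "'a topology \<Rightarrow> ('a, 'g) precosh \<Rightarrow> bool" where
  "flabby X A \<longleftrightarrow>
     (\<forall>U V. openin X U \<and> openin X V \<and> U \<subseteq> V \<longrightarrow> inj_on (ext A V U) (carrier (sec A U)))"

definition locally_trivial :: "'a topology \<Rightarrow> ('a, 'g) precosh \<Rightarrow> bool" where
  "locally_trivial X H \<longleftrightarrow>
     (\<forall>x U. openin X U \<and> x \<in> U \<longrightarrow>
        (\<exists>V. openin X V \<and> x \<in> V \<and> V \<subseteq> U \<and>
             (\<forall>h \<in> carrier (sec H V). ext H U V h = \<one>\<^bsub>sec H U\<^esub>)))"


subsection \<open>Cosheaves\<close>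

definition dsum :: "('a, 'g) precosh \<Rightarrow> 'i set \<Rightarrow> ('i \<Rightarrow> 'a set) \<Rightarrow> ('i \<Rightarrow> 'g) monoid" where
  "dsum A I U = sum_group I (\<lambda>\<alpha>. sec A (U \<alpha>))"

definition dsum_incl ::
    "('a, 'g) precosh \<Rightarrow> 'i set \<Rightarrow> ('i \<Rightarrow> 'a set) \<Rightarrow> 'i \<Rightarrow> 'g \<Rightarrow> 'i \<Rightarrow> 'g" where
  "dsum_incl A I U \<alpha> g = (\<lambda>\<beta>\<in>I. if \<beta> = \<alpha> then g else \<one>\<^bsub>sec A (U \<beta>)\<^esub>)"

definition cosheaf_eps ::
    "('a, 'g) precosh \<Rightarrow> 'i set \<Rightarrow> ('i \<Rightarrow> 'a set) \<Rightarrow> ('i \<Rightarrow> 'g) \<Rightarrow> 'g" where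
  "cosheaf_eps A I U x =
     gfinprod (sec A (\<Union>\<alpha>\<in>I. U \<alpha>)) (\<lambda>\<alpha>. ext A (\<Union>\<alpha>\<in>I. U \<alpha>) (U \<alpha>) (x \<alpha>)) I"

definition cosheaf_Phi ::
    "('a, 'g) precosh \<Rightarrow> 'i set \<Rightarrow> ('i \<Rightarrow> 'a set) \<Rightarrow> ('i \<times> 'i \<Rightarrow> 'g) \<Rightarrow> 'i \<Rightarrow> 'g" where
  "cosheaf_Phi A I U y =
     gfinprod (dsum A I U)
       (\<lambda>(\<alpha>, \<beta>).
          dsum_incl A I U \<alpha> (ext A (U \<alpha>) (U \<alpha> \<inter> U \<beta>) (y (\<alpha>, \<beta>)))
          \<otimes>\<^bsub>dsum A I U\<^esub>
          inv\<^bsub>dsum A I U\<^esub> dsum_incl A I U \<beta> (ext A (U \<beta>) (U \<alpha> \<inter> U \<beta>) (y (\<alpha>, \<beta>))))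
       (I \<times> I)"

definition cosheaf_exact :: "('a, 'g) precosh \<Rightarrow> 'i set \<Rightarrow> ('i \<Rightarrow> 'a set) \<Rightarrow> bool" where
  "cosheaf_exact A I U \<longleftrightarrow>
     cosheaf_Phi A I U ` carrier (dsum A (I \<times> I) (\<lambda>(\<alpha>, \<beta>). U \<alpha> \<inter> U \<beta>))
       = kernel (dsum A I U) (sec A (\<Union>\<alpha>\<in>I. U \<alpha>)) (cosheaf_eps A I U) \<and>
     cosheaf_eps A I U ` carrier (dsum A I U) = carrier (sec A (\<Union>\<alpha>\<in>I. U \<alpha>))"

text \<open>Index sets are taken among the sets of subsets of the space. This is no restriction: every
  family of open sets has, up to repetition of members, such an index set, and repetitions affect
  neither exactness condition, since \<open>\<Phi>\<close> identifies the summands of equal members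
  (\<open>U \<alpha> \<inter> U \<beta> = U \<alpha> = U \<beta>\<close>).\<close>

definition cosheaf :: "'a topology \<Rightarrow> ('a, 'g) precosh \<Rightarrow> bool" where
  "cosheaf X A \<longleftrightarrow> precosheaf X A \<and>
     (\<forall>(I :: 'a set set) (U :: 'a set \<Rightarrow> 'a set).
        (\<forall>\<alpha>\<in>I. openin X (U \<alpha>)) \<longrightarrow> cosheaf_exact A I U)"


subsection \<open>Precosheaves of chain complexes\<close>

record ('a, 'g) cprecosh =
  csec :: "'a set \<Rightarrow> 'g cplx"
  cext :: "'a set \<Rightarrow> 'a set \<Rightarrow> nat \<Rightarrow> 'g \<Rightarrow> 'g"

definition cdeg :: "('a, 'g) cprecosh \<Rightarrow> nat \<Rightarrow> ('a, 'g) precosh" where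
  "cdeg A p = \<lparr>sec = \<lambda>U. grp (csec A U) p, ext = \<lambda>V U. cext A V U p\<rparr>"

text \<open>Identities, composition and the zero object in the category of chain complexes are
  degreewise, whence the last condition; likewise for injectivity, direct sums and exactness in
  the definitions following it.\<close>

definition cprecosheaf :: "'a topology \<Rightarrow> ('a, 'g) cprecosh \<Rightarrow> bool" where
  "cprecosheaf X A \<longleftrightarrow>
     (\<forall>U. openin X U \<longrightarrow> chain_cplx (csec A U)) \<and>
     (\<forall>U V. openin X U \<and> openin X V \<and> U \<subseteq> V \<longrightarrow>
        chain_map_betw (csec A U) (csec A V) (cext A V U)) \<and>
     (\<forall>p. precosheaf X (cdeg A p))"

definition cnat_transf ::
    "'a topology \<Rightarrow> ('a, 'g) cprecosh \<Rightarrow> ('a, 'h) cprecosh \<Rightarrow> ('a set \<Rightarrow> nat \<Rightarrow> 'g \<Rightarrow> 'h) \<Rightarrow> bool" where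
  "cnat_transf X A B \<eta> \<longleftrightarrow>
     (\<forall>U. openin X U \<longrightarrow> chain_map_betw (csec A U) (csec B U) (\<eta> U)) \<and>
     (\<forall>p. nat_transf X (cdeg A p) (cdeg B p) (\<lambda>U. \<eta> U p))"

definition ccosheaf :: "'a topology \<Rightarrow> ('a, 'g) cprecosh \<Rightarrow> bool" where
  "ccosheaf X A \<longleftrightarrow> cprecosheaf X A \<and> (\<forall>p. cosheaf X (cdeg A p))"

definition cflabby :: "'a topology \<Rightarrow> ('a, 'g) cprecosh \<Rightarrow> bool" where
  "cflabby X A \<longleftrightarrow> (\<forall>p. flabby X (cdeg A p))"

definition caugmentation ::
    "'a topology \<Rightarrow> ('a, 'g) cprecosh \<Rightarrow> ('a, 'b) precosh \<Rightarrow> ('a set \<Rightarrow> 'g \<Rightarrow> 'b) \<Rightarrow> bool" where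
  "caugmentation X A B \<xi> \<longleftrightarrow>
     (\<forall>U. openin X U \<longrightarrow> augmentation_of (csec A U) (sec B U) (\<xi> U))"

definition homology_precosh :: "('a, 'g) cprecosh \<Rightarrow> nat \<Rightarrow> ('a, 'g set) precosh" where
  "homology_precosh A p =
     \<lparr>sec = \<lambda>U. homology (csec A U) p,
      ext = \<lambda>V U. homology_map (csec A V) (cext A V U) p\<rparr>"

definition reduced_homology_precosh ::
    "('a, 'g) cprecosh \<Rightarrow> ('a, 'b) precosh \<Rightarrow> ('a set \<Rightarrow> 'g \<Rightarrow> 'b) \<Rightarrow> nat \<Rightarrow> ('a, 'g set) precosh" where
  "reduced_homology_precosh A B \<xi> p =
     \<lparr>sec = \<lambda>U. reduced_homology (csec A U) (sec B U) (\<xi> U) p,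
      ext = \<lambda>V U. homology_map (csec A V) (cext A V U) p\<rparr>"

end

theory Submission
  imports Defs "HOL-Library.Function_Algebras"
begin

text \<open>
  Both parts follow from one comparison principle. Let \<open>C\<close> be a complex of flabby cosheaves, \<open>F\<close> a
  complex of precosheaves whose homology is locally trivial in degrees at most \<open>n\<close>, and
  \<open>f : C \<rightarrow> F\<close> a chain map. Then \<open>f\<close> sends every \<open>n\<close>-cycle of \<open>C\<close> to a boundary. Let \<open>D\<close> be the
  mapping cone of \<open>\<eta>\<close>, shifted by one and with its lowest term replaced by the kernel of
  \<open>\<AA>'\<^sub>1 \<oplus> \<AA>\<^sub>0 \<rightarrow> \<AA>'\<^sub>0\<close>; this is a flabby cosheaf because \<open>\<eta>\<close> is onto in degree \<open>0\<close>. Injectivity is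
  the principle for the projection of \<open>D\<close> to \<open>ker \<xi> \<leftarrow> \<AA>\<^sub>1 \<leftarrow> \<AA>\<^sub>2 \<leftarrow> \<dots>\<close>, and surjectivity is
  the principle for the identity of \<open>D\<close>.

  The principle is proved by induction on \<open>n\<close>. A cycle is a finite sum of chains on members of a
  family of small open sets; the Cech resolution of that family turns the boundaries of the
  summands into an \<open>(n-1)\<close>-cycle of a complex of flabby cosheaves on another space, whose points are
  pairs of a point and a finite set of members containing it. The corresponding \<open>F\<close>-complex on that
  space is again locally acyclic, because the chains of a full simplex in positive dimensions have
  homology only in the lowest degree.
  A null-homology there corrects the images of the summands to cycles, each of which bounds by
  smallness.
\<close>

text \<open>Local triviality costs a shrinking of the open set in every degree, and the shrinkings
  wanted on the various overlaps of a cover need not come from one common refinement. Passing to the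
  nerve avoids choosing a refinement: a set that is small for the open set attached to a tuple
  yields a small set of the nerve, so the lower-degree problem has again the same shape.

  Two families \<open>C\<close> and \<open>F\<close> occur because the kernel of
  \<open>\<xi>\<close> is only a precosheaf. Sums over unions and intersections, that is
  Mayer-Vietoris, are used for \<open>C\<close>; \<open>F\<close> only supplies bounding chains.

  Flabbiness embeds all sections into the sections over the whole space. Extension maps then become
  inclusions, and the cosheaf axiom becomes a statement about subgroups: unions go to sums,
  intersections to intersections, and every element lives over finitely many members of a cover.

  Each passage to a nerve changes what an open set and a coefficient are. An induction over a fixed
  type therefore needs a type that can absorb this change.\<close>

section \<open>Subgroups of additive groups and finite sums\<close>

definition subgrp :: "'v::ab_group_add set \<Rightarrow> bool" where
  "subgrp G \<longleftrightarrow> 0 \<in> G \<and> (\<forall>x\<in>G. \<forall>y\<in>G. x - y \<in> G)"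

lemma subgrp_0: "subgrp G \<Longrightarrow> 0 \<in> G"
  by (simp add: subgrp_def)

lemma subgrp_diff: "subgrp G \<Longrightarrow> x \<in> G \<Longrightarrow> y \<in> G \<Longrightarrow> x - y \<in> G"
  by (simp add: subgrp_def)

lemma subgrp_minus: "subgrp G \<Longrightarrow> x \<in> G \<Longrightarrow> - x \<in> G"
  using subgrp_diff[of G 0 x] subgrp_0[of G] by simp

lemma subgrp_add: "subgrp G \<Longrightarrow> x \<in> G \<Longrightarrow> y \<in> G \<Longrightarrow> x + y \<in> G"
  using subgrp_diff[of G x "- y"] subgrp_minus[of G y] by simp

lemma subgrp_sum: "subgrp G \<Longrightarrow> (\<And>i. i \<in> I \<Longrightarrow> g i \<in> G) \<Longrightarrow> (\<Sum>i\<in>I. g i) \<in> G"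
  by (induction I rule: infinite_finite_induct) (auto simp: subgrp_0 subgrp_add)

lemma subgrp_singleton_0: "subgrp {0}"
  by (simp add: subgrp_def)

text \<open>Closure under addition alone is enough, as the generating sets below are unions of
  subgroups and so contain their negatives.\<close>

inductive_set sums_of :: "'v::ab_group_add set \<Rightarrow> 'v set" for S where
  sums_of_0: "0 \<in> sums_of S"
| sums_of_Cons: "x \<in> S \<Longrightarrow> y \<in> sums_of S \<Longrightarrow> x + y \<in> sums_of S"

lemma sums_of_base: "x \<in> S \<Longrightarrow> x \<in> sums_of S"
  using sums_of_Cons[OF _ sums_of_0, of x S] by simp

lemma sums_of_add: "x \<in> sums_of S \<Longrightarrow> y \<in> sums_of S \<Longrightarrow> x + y \<in> sums_of S"
  by (induction rule: sums_of.induct) (auto simp: add.assoc intro: sums_of_Cons)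

lemma sums_of_sum: "(\<And>i. i \<in> I \<Longrightarrow> g i \<in> sums_of S) \<Longrightarrow> (\<Sum>i\<in>I. g i) \<in> sums_of S"
  by (induction I rule: infinite_finite_induct) (auto simp: sums_of_0 sums_of_add)

lemma sums_of_image:
  assumes "Modules.additive f" and "\<And>x. x \<in> S \<Longrightarrow> f x \<in> S'" and "x \<in> sums_of S"
  shows "f x \<in> sums_of S'"
  using assms(3)
  by induction (auto simp: additive.zero[OF assms(1)] additive.add[OF assms(1)]
      intro: sums_of.intros assms(2))

text \<open>Numbering the members that occur yields a finite family indexed below \<open>r\<close>,
  so that tuples of members are lists of numbers whatever the type of the members.\<close>

lemma sums_of_imp_indexed:
  assumes "x \<in> sums_of (\<Union>T\<in>\<T>. G T)"
  shows "\<exists>(r::nat) V z. (\<forall>i<r. V i \<in> \<T> \<and> z i \<in> G (V i)) \<and> x = (\<Sum>i<r. z i)"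
  using assms
  proof induction
    case sums_of_0
    then show ?case by (intro exI[of _ 0]) auto
  next
    case (sums_of_Cons x y)
    then obtain r :: nat and V z T where *: "\<forall>i<r. V i \<in> \<T> \<and> z i \<in> G (V i)" "y = (\<Sum>i<r. z i)"
      "T \<in> \<T>" "x \<in> G T" by blast
    then show ?case
      by (intro exI[of _ "Suc r"] exI[of _ "V(r := T)"] exI[of _ "z(r := x)"])
        (auto simp: less_Suc_eq add.commute)
  qed


subsection \<open>Ordered Cech chains\<close>

text \<open>A chain \<open>c\<close> assigns a coefficient to each tuple of indices below \<open>r\<close>. The recursion
  is the one satisfied by the alternating sum of the faces, separated into the face that omits
  the head of the tuple and those that keep it; in this form the signs of the faces need not be tracked.\<close>

fun face_sum :: "nat \<Rightarrow> (nat list \<Rightarrow> 'v::ab_group_add) \<Rightarrow> nat list \<Rightarrow> 'v" where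
  "face_sum r c [] = (\<Sum>i<r. c [i])"
| "face_sum r c (j # t) = (\<Sum>i<r. c (i # j # t)) - face_sum r (\<lambda>s. c (j # s)) t"

text \<open>Only tuples with one entry more than \<open>t\<close>, containing the entries of
  \<open>t\<close>, contribute. These side conditions later place every term in the correct
  intersection.\<close>

lemma face_sum_in_subgrp:
  assumes "subgrp G"
    and "\<And>s. length s = Suc (length t) \<Longrightarrow> set t \<subseteq> set s \<Longrightarrow> set s \<subseteq> set t \<union> {..<r} \<Longrightarrow> c s \<in> G"
  shows "face_sum r c t \<in> G"
  using assms(2)
proof (induction t arbitrary: c)
  case Nil
  then show ?case by (auto intro!: subgrp_sum[OF assms(1)])
next
  case (Cons j t)
  have "face_sum r (\<lambda>s. c (j # s)) t \<in> G"
    by (rule Cons.IH, rule Cons.prems) auto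
  moreover have "(\<Sum>i<r. c (i # j # t)) \<in> G"
    by (rule subgrp_sum[OF assms(1)], rule Cons.prems) auto
  ultimately show ?case by (auto intro: subgrp_diff[OF assms(1)])
qed

lemma face_sum_hom: "Modules.additive g \<Longrightarrow> face_sum r (\<lambda>s. g (c s)) t = g (face_sum r c t)"
  by (induction t arbitrary: c) (simp_all add: additive.sum additive.diff)

lemma face_sum_add: "face_sum r (\<lambda>s. a s + b s) t = face_sum r a t + face_sum r b t"
  by (induction t arbitrary: a b) (simp_all add: sum.distrib)

lemma face_sum_minus: "face_sum r (\<lambda>s. - a s) t = - face_sum r a t"
  by (rule face_sum_hom) (simp add: Modules.additive_def)

lemma face_sum_diff: "face_sum r (\<lambda>s. a s - b s) t = face_sum r a t - face_sum r b t"
  using face_sum_add[of r a "\<lambda>s. - b s" t] by (simp add: face_sum_minus)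

lemma face_sum_0 [simp]: "face_sum r (\<lambda>s. 0) t = 0"
  by (induction t) simp_all

lemma face_sum_sum: "face_sum r (\<lambda>s. \<Sum>i<k. c i s) t = (\<Sum>i<(k::nat). face_sum r (c i) t)"
  by (induction k) (simp_all add: face_sum_add)

text \<open>The support statement for the subgroup \<open>{0}\<close>, applied to the difference of
  the two chains.\<close>

lemma face_sum_cong:
  assumes "\<And>s. length s = Suc (length t) \<Longrightarrow> set t \<subseteq> set s \<Longrightarrow> set s \<subseteq> set t \<union> {..<r} \<Longrightarrow> a s = b s"
  shows "face_sum r a t = face_sum r b t"
proof -
  have "face_sum r (\<lambda>s. a s - b s) t \<in> {0}"
    by (rule face_sum_in_subgrp[OF subgrp_singleton_0]) (use assms in auto)
  then show ?thesis by (simp add: face_sum_diff)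
qed

text \<open>Two insertions in front of the head cancel by exchanging the indices. One insertion in
  front and one behind cancel by the minus sign of the recursion. Two insertions behind the head are
  the induction hypothesis.\<close>

lemma face_sum_face_sum: "face_sum r (face_sum r c) t = 0"
proof (induction t arbitrary: c)
  case Nil
  show ?case
    by (simp add: sum_subtractf) (rule sum.swap)
next
  case (Cons j t)
  have "face_sum r (\<lambda>s. face_sum r c (j # s)) t
      = (\<Sum>i<r. face_sum r (\<lambda>s. c (i # j # s)) t) - face_sum r (face_sum r (\<lambda>s. c (j # s))) t"
    by (simp add: face_sum_diff face_sum_sum)
  also have "\<dots> = (\<Sum>i<r. face_sum r (\<lambda>s. c (i # j # s)) t)"
    by (simp add: Cons.IH)
  finally have 1: "face_sum r (\<lambda>s. face_sum r c (j # s)) t = (\<Sum>i<r. face_sum r (\<lambda>s. c (i # j # s)) t)" .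
  have "(\<Sum>i<r. face_sum r c (i # j # t)) = (\<Sum>i<r. (\<Sum>k<r. c (k # i # j # t))) - 
     (\<Sum>i<r. (\<Sum>k<r. c (i # k # j # t)) - face_sum r (\<lambda>s. c (i # j # s)) t)"
    by (simp add: sum_subtractf)
  also have "(\<Sum>i<r. (\<Sum>k<r. c (k # i # j # t))) = (\<Sum>i<r. (\<Sum>k<r. c (i # k # j # t)))"
    by (rule sum.swap)
  finally show ?case using 1 by (simp add: sum_subtractf)
qed

text \<open>The vertex \<open>a\<close> is prepended to every simplex of a chain, written in terms
  of coefficients.\<close>

definition cone_at :: "nat \<Rightarrow> (nat list \<Rightarrow> 'v::zero) \<Rightarrow> nat list \<Rightarrow> 'v" where
  "cone_at a c s = (case s of [] \<Rightarrow> 0 | j # t \<Rightarrow> if j = a then c t else 0)"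

lemma cone_at_simps [simp]: "cone_at a c [] = 0" "cone_at a c (j # t) = (if j = a then c t else 0)"
  by (simp_all add: cone_at_def)

text \<open>The usual contracting homotopy. It is available because tuples may have repeated
  entries, so \<open>a\<close> can be prepended to any of them.\<close>

lemma face_sum_cone_at: "a < r \<Longrightarrow> face_sum r (cone_at a c) t = c t - cone_at a (face_sum r c) t"
  by (cases t) auto

definition sgn_pow :: "nat \<Rightarrow> 'v::ab_group_add \<Rightarrow> 'v" where
  "sgn_pow k x = (if even k then x else - x)"

text \<open>The empty tuple carries the augmentation term. The sign by length cancels the mixed
  terms of the square, and it also makes \<open>cone_at\<close> a contraction for the total
  boundary.\<close>

definition tot_bd ::
    "nat \<Rightarrow> ('v \<Rightarrow> 'v) \<Rightarrow> (nat list \<Rightarrow> 'v::ab_group_add) \<Rightarrow> nat list \<Rightarrow> 'v" where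
  "tot_bd r d c s = face_sum r c s + sgn_pow (length s) (d (c s))"

lemma sgn_pow_simps: "sgn_pow k (x + y) = sgn_pow k x + sgn_pow k y"
  "sgn_pow (Suc k) x = - sgn_pow k x" "sgn_pow k 0 = 0"
  "sgn_pow k (sgn_pow k x) = x" "sgn_pow k (x - y) = sgn_pow k x - sgn_pow k y"
  "sgn_pow k (- x) = - sgn_pow k x"
  by (simp_all add: sgn_pow_def)

lemma additive_sgn_pow: "Modules.additive (sgn_pow k)"
  by (simp add: Modules.additive_def sgn_pow_simps)

lemma sgn_pow_hom: "Modules.additive f \<Longrightarrow> f (sgn_pow k x) = sgn_pow k (f x)"
  by (simp add: sgn_pow_def additive.minus)

lemma sgn_pow_in_subgrp: "subgrp G \<Longrightarrow> x \<in> G \<Longrightarrow> sgn_pow k x \<in> G"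
  by (simp add: sgn_pow_def subgrp_minus)

lemma tot_bd_add: "Modules.additive d \<Longrightarrow> tot_bd r d (\<lambda>s. a s + b s) t = tot_bd r d a t + tot_bd r d b t"
  by (simp add: tot_bd_def face_sum_add additive.add sgn_pow_simps)

lemma tot_bd_diff: "Modules.additive d \<Longrightarrow> tot_bd r d (\<lambda>s. a s - b s) t = tot_bd r d a t - tot_bd r d b t"
  by (simp add: tot_bd_def face_sum_diff additive.diff sgn_pow_simps)

text \<open>The Cech part commutes with every additive map, so only the inner boundaries can
  obstruct \<open>f\<close> from being a chain map.\<close>

lemma tot_bd_hom:
  assumes "Modules.additive f"
  shows "tot_bd r e (\<lambda>s. f (c s)) s - f (tot_bd r d c s) = sgn_pow (length s) (e (f (c s)) - f (d (c s)))"
  using assms by (simp add: tot_bd_def face_sum_hom additive.add sgn_pow_hom sgn_pow_simps)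

lemma tot_bd_cone_at:
  "Modules.additive d \<Longrightarrow> a < r \<Longrightarrow> tot_bd r d (cone_at a c) t = c t - cone_at a (tot_bd r d c) t"
  by (cases t) (auto simp: tot_bd_def face_sum_cone_at additive.zero sgn_pow_simps)

text \<open>The right-hand side is not \<open>0\<close>, as inner boundaries will square to zero
  only modulo the value at \<open>bot\<close>.\<close>

lemma tot_bd_tot_bd:
  assumes d: "Modules.additive d"
  shows "tot_bd r d (tot_bd r d c) s = d (d (c s))"
proof -
  have "face_sum r (\<lambda>t. sgn_pow (length t) (d (c t))) s = face_sum r (\<lambda>t. sgn_pow (Suc (length s)) (d (c t))) s"
    by (rule face_sum_cong) simp
  also have "\<dots> = sgn_pow (Suc (length s)) (d (face_sum r c s))"
    by (subst face_sum_hom[OF additive_sgn_pow]) (simp add: face_sum_hom[OF d])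
  finally have 1: "face_sum r (\<lambda>t. sgn_pow (length t) (d (c t))) s = - sgn_pow (length s) (d (face_sum r c s))"
    by (simp add: sgn_pow_simps)
  have "face_sum r (tot_bd r d c) s = face_sum r (face_sum r c) s + face_sum r (\<lambda>t. sgn_pow (length t) (d (c t))) s"
    unfolding face_sum_add[symmetric] by (rule face_sum_cong) (simp add: tot_bd_def)
  then show ?thesis
    by (simp add: tot_bd_def face_sum_face_sum 1 additive.add[OF d] sgn_pow_hom[OF d] sgn_pow_simps)
qed

subsection \<open>Graded families of subgroups indexed by a lattice\<close>

text \<open>The value at \<open>bot\<close> plays the role of zero: all identities are required only modulo it.\<close>

locale subgrp_family =
  fixes Op :: "'l::{distrib_lattice,bounded_lattice_bot} set"
    and F :: "int \<Rightarrow> 'l \<Rightarrow> 'v::ab_group_add set" and d :: "'v \<Rightarrow> 'v"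
  assumes bot_Op: "bot \<in> Op"
    and sup_Op: "U \<in> Op \<Longrightarrow> V \<in> Op \<Longrightarrow> sup U V \<in> Op"
    and inf_Op: "U \<in> Op \<Longrightarrow> V \<in> Op \<Longrightarrow> inf U V \<in> Op"
    and subgrp: "V \<in> Op \<Longrightarrow> subgrp (F p V)"
    and mono: "U \<in> Op \<Longrightarrow> V \<in> Op \<Longrightarrow> U \<le> V \<Longrightarrow> F p U \<subseteq> F p V"
    and neg: "V \<in> Op \<Longrightarrow> p < 0 \<Longrightarrow> F p V = {0}"
    and additive: "Modules.additive d"
    and bd: "V \<in> Op \<Longrightarrow> x \<in> F p V \<Longrightarrow> d x \<in> F (p - 1) V"
    and bd_bd: "V \<in> Op \<Longrightarrow> x \<in> F p V \<Longrightarrow> d (d x) \<in> F (p - 2) bot"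
begin

lemma bot_subset: "V \<in> Op \<Longrightarrow> x \<in> F p bot \<Longrightarrow> x \<in> F p V"
  using mono[OF bot_Op, of V p] by auto

end

text \<open>The two conditions together say that \<open>C p (inf U V) \<rightarrow> C p U \<oplus> C
  p V \<rightarrow> C p (sup U V)\<close> is short exact, which is all that Mayer-Vietoris
  uses.\<close>

locale flabby_family = subgrp_family Op C d
  for Op :: "'l::{distrib_lattice,bounded_lattice_bot} set"
    and C :: "int \<Rightarrow> 'l \<Rightarrow> 'v::ab_group_add set" and d +
  assumes sup: "U \<in> Op \<Longrightarrow> V \<in> Op \<Longrightarrow> x \<in> C p (sup U V) \<Longrightarrow> \<exists>y\<in>C p U. \<exists>z\<in>C p V. x = y + z"
    and inf: "U \<in> Op \<Longrightarrow> V \<in> Op \<Longrightarrow> x \<in> C p U \<Longrightarrow> x \<in> C p V \<Longrightarrow> x \<in> C p (inf U V)"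


subsection \<open>Exactness of the Cech total complex\<close>

text \<open>The starting value \<open>W\<close> is attached to the empty tuple, so the augmentation
  term of the resolution needs no case of its own.\<close>

fun cap :: "(nat \<Rightarrow> 'l::lattice) \<Rightarrow> 'l \<Rightarrow> nat list \<Rightarrow> 'l" where
  "cap V W [] = W"
| "cap V W (i # s) = inf (V i) (cap V W s)"

lemma le_cap_iff: "x \<le> cap V W s \<longleftrightarrow> x \<le> W \<and> (\<forall>i\<in>set s. x \<le> V i)"
  by (induction s) auto

lemma cap_antimono: "set s \<subseteq> set t \<Longrightarrow> cap V W t \<le> cap V W s"
  using le_cap_iff[of "cap V W t" V W t] le_cap_iff[of "cap V W t" V W s] by auto

lemma cap_mono: "U \<le> W \<Longrightarrow> cap V U s \<le> cap V W s"
  by (induction s) (auto intro: le_infI2)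

lemma cap_bot [simp]: "cap V (bot::'l::{lattice,order_bot}) s = bot"
  by (induction s) (auto simp: inf_absorb2)

lemma cap_sup: "cap V (sup U W) s = sup (cap V U s) (cap V (W::'l::distrib_lattice) s)"
  by (induction s) (auto simp: inf_sup_distrib1)

lemma cap_inf: "cap V (inf U W) s = inf (cap V U s) (cap V W s)"
  by (induction s) (auto simp: inf_left_commute inf_assoc inf_commute)

primrec cover :: "(nat \<Rightarrow> 'l::bounded_lattice_bot) \<Rightarrow> nat \<Rightarrow> 'l" where
  "cover V 0 = bot"
| "cover V (Suc k) = sup (cover V k) (V k)"

lemma le_cover: "i < k \<Longrightarrow> V i \<le> cover V k"
  by (induction k) (auto simp: less_Suc_eq intro: le_supI1)

lemma cover_le: "(\<And>i. i < k \<Longrightarrow> V i \<le> W) \<Longrightarrow> cover V k \<le> W"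
  by (induction k) auto

locale cech = flabby_family Op C d
  for Op :: "'l::{distrib_lattice,bounded_lattice_bot} set"
    and C :: "int \<Rightarrow> 'l \<Rightarrow> 'v::ab_group_add set" and d +
  fixes r :: nat and V :: "nat \<Rightarrow> 'l"
  assumes V_Op: "i < r \<Longrightarrow> V i \<in> Op"
begin

lemma cap_Op: "W \<in> Op \<Longrightarrow> set s \<subseteq> {..<r} \<Longrightarrow> cap V W s \<in> Op"
  by (induction s) (auto intro: inf_Op V_Op)

text \<open>Total degree \<open>n\<close>: the empty tuple holds chains of degree \<open>n\<close>,
  a single index chains of degree \<open>n - 1\<close>, and so on.\<close>

definition chains :: "int \<Rightarrow> 'l \<Rightarrow> (nat list \<Rightarrow> 'v) set" where
  "chains n W = {c. \<forall>s. if set s \<subseteq> {..<r} then c s \<in> C (n - int (length s)) (cap V W s) else c s = 0}"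

lemma chainsI:
  "(\<And>s. set s \<subseteq> {..<r} \<Longrightarrow> c s \<in> C (n - int (length s)) (cap V W s)) \<Longrightarrow>
   (\<And>s. \<not> set s \<subseteq> {..<r} \<Longrightarrow> c s = 0) \<Longrightarrow> c \<in> chains n W"
  by (auto simp: chains_def)

lemma chainsD: "c \<in> chains n W \<Longrightarrow> set s \<subseteq> {..<r} \<Longrightarrow> c s \<in> C (n - int (length s)) (cap V W s)"
  unfolding chains_def by (auto split: if_splits dest: spec[of _ s])

lemma chainsD0: "c \<in> chains n W \<Longrightarrow> \<not> set s \<subseteq> {..<r} \<Longrightarrow> c s = 0"
  by (auto simp: chains_def split: if_splits)

lemma chains_subgrp: "W \<in> Op \<Longrightarrow> a \<in> chains n W \<Longrightarrow> b \<in> chains n W \<Longrightarrow> (\<lambda>s. a s - b s) \<in> chains n W"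
  by (rule chainsI) (blast intro: subgrp_diff[OF subgrp[OF cap_Op]] dest: chainsD | simp add: chainsD0)+

lemma chains_add: "W \<in> Op \<Longrightarrow> a \<in> chains n W \<Longrightarrow> b \<in> chains n W \<Longrightarrow> (\<lambda>s. a s + b s) \<in> chains n W"
  by (rule chainsI) (blast intro: subgrp_add[OF subgrp[OF cap_Op]] dest: chainsD | simp add: chainsD0)+

lemma chains_mono:
  assumes "U \<in> Op" "W \<in> Op" "U \<le> W" "a \<in> chains n U"
  shows "a \<in> chains n W"
proof (rule chainsI)
  show "a s \<in> C (n - int (length s)) (cap V W s)" if s: "set s \<subseteq> {..<r}" for s
    using mono[OF cap_Op[OF assms(1) s] cap_Op[OF assms(2) s] cap_mono[OF assms(3)]] chainsD[OF assms(4) s]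
    by blast
qed (use assms(4) chainsD0 in blast)

lemma chains_sup:
  assumes "U \<in> Op" "W \<in> Op" "c \<in> chains n (sup U W)"
  obtains a b where "a \<in> chains n U" "b \<in> chains n W" "c = (\<lambda>s. a s + b s)"
proof -
  have "\<exists>y z. if set s \<subseteq> {..<r} then y \<in> C (n - int (length s)) (cap V U s) \<and>
      z \<in> C (n - int (length s)) (cap V W s) \<and> c s = y + z else y = 0 \<and> z = 0" for s
    using sup[OF cap_Op[OF assms(1), of s] cap_Op[OF assms(2), of s]] chainsD[OF assms(3), of s]
    unfolding cap_sup by (cases "set s \<subseteq> {..<r}") (simp_all, blast)
  then obtain a b where ab: "\<And>s. if set s \<subseteq> {..<r} then a s \<in> C (n - int (length s)) (cap V U s) \<and>
      b s \<in> C (n - int (length s)) (cap V W s) \<and> c s = a s + b s else a s = 0 \<and> b s = 0"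
    by metis
  show thesis
  proof (rule that)
    show "a \<in> chains n U" "b \<in> chains n W"
      unfolding chains_def mem_Collect_eq using ab by metis+
    show "c = (\<lambda>s. a s + b s)"
    proof
      show "c s = a s + b s" for s
        using ab[of s] chainsD0[OF assms(3), of s] by (auto split: if_splits)
    qed
  qed
qed

lemma chains_inf:
  "U \<in> Op \<Longrightarrow> W \<in> Op \<Longrightarrow> c \<in> chains n U \<Longrightarrow> c \<in> chains n W \<Longrightarrow> c \<in> chains n (inf U W)"
  by (rule chainsI) (auto simp: cap_inf intro!: inf cap_Op dest: chainsD chainsD0)

lemma tot_bd_chains:
  assumes W: "W \<in> Op" and c: "c \<in> chains n W"
  shows "tot_bd r d c \<in> chains (n - 1) W"
proof (rule chainsI)
  fix s assume s: "set s \<subseteq> {..<r}"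
  have "face_sum r c s \<in> C (n - 1 - int (length s)) (cap V W s)"
  proof (rule face_sum_in_subgrp[OF subgrp[OF cap_Op[OF W s]]])
    fix t assume t: "length t = Suc (length s)" "set s \<subseteq> set t" "set t \<subseteq> set s \<union> {..<r}"
    then have t': "set t \<subseteq> {..<r}" using s by auto
    show "c t \<in> C (n - 1 - int (length s)) (cap V W s)"
      using chainsD[OF c t'] mono[OF cap_Op[OF W t'] cap_Op[OF W s] cap_antimono[OF t(2)]] t(1)
      by (auto simp: algebra_simps)
  qed
  moreover have "sgn_pow (length s) (d (c s)) \<in> C (n - 1 - int (length s)) (cap V W s)"
    using bd[OF cap_Op[OF W s] chainsD[OF c s]]
    by (auto intro!: sgn_pow_in_subgrp subgrp[OF cap_Op[OF W s]] simp: algebra_simps)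
  ultimately show "tot_bd r d c s \<in> C (n - 1 - int (length s)) (cap V W s)"
    unfolding tot_bd_def by (intro subgrp_add[OF subgrp[OF cap_Op[OF W s]]])
next
  fix s assume s: "\<not> set s \<subseteq> {..<r}"
  have "face_sum r c s \<in> {0}"
    by (rule face_sum_in_subgrp[OF subgrp_singleton_0]) (use s c chainsD0 in auto)
  then show "tot_bd r d c s = 0"
    using chainsD0[OF c s] by (simp add: tot_bd_def additive.zero[OF additive] sgn_pow_simps)
qed

text \<open>All degrees are taken together, because Mayer-Vietoris uses exactness over the
  intersection one degree lower.\<close>

definition exact_on :: "'l \<Rightarrow> bool" where
  "exact_on W \<longleftrightarrow> (\<forall>n. \<forall>c\<in>chains n W. tot_bd r d c \<in> chains (n - 1) bot \<longrightarrow>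
     (\<exists>b\<in>chains (n + 1) W. (\<lambda>s. c s - tot_bd r d b s) \<in> chains n bot))"

text \<open>As \<open>W \<le> V a\<close>, prepending \<open>a\<close> does not shrink the
  intersection, and the cone with apex \<open>a\<close> is a contraction.\<close>

lemma exact_on_small:
  assumes W: "W \<in> Op" and a: "a < r" and le: "W \<le> V a"
  shows "exact_on W"
  unfolding exact_on_def
proof (intro allI ballI impI)
  fix n c assume c: "c \<in> chains n W" and cyc: "tot_bd r d c \<in> chains (n - 1) bot"
  have eq: "cap V W (a # s) = cap V W s" for s
    using le le_cap_iff[of "cap V W s" V W s] by (auto intro: inf_absorb2)
  show "\<exists>b\<in>chains (n + 1) W. (\<lambda>s. c s - tot_bd r d b s) \<in> chains n bot"
  proof (rule bexI)
    show "cone_at a c \<in> chains (n + 1) W"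
    proof (rule chainsI)
      show "cone_at a c s \<in> C (n + 1 - int (length s)) (cap V W s)" if s: "set s \<subseteq> {..<r}" for s
        using chainsD[OF c, of "tl s"] s subgrp_0[OF subgrp[OF cap_Op[OF W s]]] eq[of "tl s"]
        by (cases s) auto
      show "cone_at a c s = 0" if s: "\<not> set s \<subseteq> {..<r}" for s
        using chainsD0[OF c, of "tl s"] s a by (cases s) auto
    qed
    have "cone_at a (tot_bd r d c) \<in> chains n bot"
    proof (rule chainsI)
      show "cone_at a (tot_bd r d c) s \<in> C (n - int (length s)) (cap V bot s)" if s: "set s \<subseteq> {..<r}" for s
        using chainsD[OF cyc, of "tl s"] s subgrp_0[OF subgrp[OF bot_Op]]
        by (cases s) (auto simp: algebra_simps)
      show "cone_at a (tot_bd r d c) s = 0" if s: "\<not> set s \<subseteq> {..<r}" for s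
        using chainsD0[OF cyc, of "tl s"] s a by (cases s) auto
    qed
    then show "(\<lambda>s. c s - tot_bd r d (cone_at a c) s) \<in> chains n bot"
      using tot_bd_cone_at[OF additive a] by simp
  qed
qed

lemma exact_on_bot: "exact_on bot"
proof -
  have "(\<lambda>s. 0) \<in> chains n bot" for n
    by (rule chainsI) (auto intro: subgrp_0[OF subgrp[OF bot_Op]])
  moreover have "tot_bd r d (\<lambda>s. 0) s = 0" for s
    by (simp add: tot_bd_def additive.zero[OF additive] sgn_pow_simps)
  ultimately show ?thesis
    unfolding exact_on_def by (intro allI ballI impI bexI[of _ "\<lambda>s. 0"]) auto
qed

text \<open>Mayer-Vietoris on chains: write the cycle as \<open>c1 + c2\<close>. The boundary of
  \<open>c1\<close> lies over both sets, hence over their infimum, where it is bounded by some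
  \<open>b\<close>. Then \<open>c1 - b\<close> and \<open>c2 + b\<close> are cycles over
  \<open>U\<close> and \<open>W\<close>.\<close>

lemma exact_on_sup:
  assumes U: "U \<in> Op" and W: "W \<in> Op" and exU: "exact_on U" and exW: "exact_on W"
    and exI: "exact_on (inf U W)"
  shows "exact_on (sup U W)"
  unfolding exact_on_def
proof (intro allI ballI impI)
  fix n c assume c: "c \<in> chains n (sup U W)" and cyc: "tot_bd r d c \<in> chains (n - 1) bot"
  let ?D = "tot_bd r d"
  have D_add: "?D (\<lambda>s. a s + b s) = (\<lambda>s. ?D a s + ?D b s)"
    and D_diff: "?D (\<lambda>s. a s - b s) = (\<lambda>s. ?D a s - ?D b s)" for a b
    by (simp_all add: fun_eq_iff tot_bd_add[OF additive] tot_bd_diff[OF additive])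
  obtain c1 c2 where c1: "c1 \<in> chains n U" and c2: "c2 \<in> chains n W" and cc: "c = (\<lambda>s. c1 s + c2 s)"
    using chains_sup[OF U W c] .
  have I: "inf U W \<in> Op" using U W by (rule inf_Op)
  \<comment> \<open>This difference is \<open>?D c1\<close>; as \<open>?D c\<close> lies over
    \<open>bot\<close>, it shows that \<open>?D c1\<close> lies over \<open>W\<close> too.\<close>
  have "(\<lambda>s. ?D c s - ?D c2 s) \<in> chains (n - 1) W"
    using chains_mono[OF bot_Op W _ cyc] tot_bd_chains[OF W c2] by (intro chains_subgrp[OF W]) auto
  then have "?D c1 \<in> chains (n - 1) W" by (simp add: cc D_add)
  with tot_bd_chains[OF U c1] have Dc1: "?D c1 \<in> chains (n - 1) (inf U W)"
    by (intro chains_inf[OF U W])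
  have "?D (?D c1) \<in> chains (n - 1 - 1) bot"
  proof (rule chainsI)
    show "?D (?D c1) s \<in> C (n - 1 - 1 - int (length s)) (cap V bot s)" if s: "set s \<subseteq> {..<r}" for s
      using bd_bd[OF cap_Op[OF U s] chainsD[OF c1 s]] by (simp add: tot_bd_tot_bd[OF additive] algebra_simps)
    show "?D (?D c1) s = 0" if s: "\<not> set s \<subseteq> {..<r}" for s
      by (simp add: tot_bd_tot_bd[OF additive] chainsD0[OF c1 s] additive.zero[OF additive])
  qed
  then obtain b where b: "b \<in> chains n (inf U W)" and Db: "(\<lambda>s. ?D c1 s - ?D b s) \<in> chains (n - 1) bot"
    using exI Dc1 unfolding exact_on_def by fastforce
  have bU: "b \<in> chains n U" and bW: "b \<in> chains n W"
    using b chains_mono[OF I U] chains_mono[OF I W] by auto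
  have "(\<lambda>s. c1 s - b s) \<in> chains n U" "?D (\<lambda>s. c1 s - b s) \<in> chains (n - 1) bot"
    using chains_subgrp[OF U c1 bU] Db by (simp_all add: D_diff)
  then obtain b1 where b1: "b1 \<in> chains (n + 1) U" "(\<lambda>s. c1 s - b s - ?D b1 s) \<in> chains n bot"
    using exU unfolding exact_on_def by fastforce
  have "(\<lambda>s. ?D c s - (?D c1 s - ?D b s)) \<in> chains (n - 1) bot"
    by (rule chains_subgrp[OF bot_Op cyc Db])
  then have "(\<lambda>s. c2 s + b s) \<in> chains n W" "?D (\<lambda>s. c2 s + b s) \<in> chains (n - 1) bot"
    using chains_add[OF W c2 bW] by (simp_all add: cc D_add algebra_simps)
  then obtain b2 where b2: "b2 \<in> chains (n + 1) W" "(\<lambda>s. c2 s + b s - ?D b2 s) \<in> chains n bot"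
    using exW unfolding exact_on_def by fastforce
  have UW: "sup U W \<in> Op" using U W by (rule sup_Op)
  show "\<exists>b\<in>chains (n + 1) (sup U W). (\<lambda>s. c s - ?D b s) \<in> chains n bot"
  proof (rule bexI)
    show "(\<lambda>s. b1 s + b2 s) \<in> chains (n + 1) (sup U W)"
      using chains_mono[OF U UW _ b1(1)] chains_mono[OF W UW _ b2(1)] by (intro chains_add[OF UW]) auto
    have "(\<lambda>s. (c1 s - b s - ?D b1 s) + (c2 s + b s - ?D b2 s)) \<in> chains n bot"
      by (rule chains_add[OF bot_Op b1(2) b2(2)])
    then show "(\<lambda>s. c s - ?D (\<lambda>s. b1 s + b2 s) s) \<in> chains n bot"
      by (simp add: cc D_add algebra_simps)
  qed
qed

lemma cover_Op: "k \<le> r \<Longrightarrow> cover V k \<in> Op"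
  by (induction k) (auto intro!: bot_Op sup_Op V_Op)

text \<open>Adjoining \<open>V k\<close> requires exactness over \<open>V k\<close> and over its
  infimum with the earlier cover. Both lie below \<open>V k\<close>, so the cone with apex
  \<open>k\<close> handles them.\<close>

lemma exact_on_cover: "k \<le> r \<Longrightarrow> exact_on (cover V k)"
proof (induction k)
  case 0
  show ?case by (simp add: exact_on_bot)
next
  case (Suc k)
  then have "cover V k \<in> Op" "V k \<in> Op" "k < r" using cover_Op V_Op by auto
  then show ?case
    unfolding cover.simps using Suc
    by (intro exact_on_sup exact_on_small[of "V k" k] exact_on_small[of "inf (cover V k) (V k)" k]
        inf_Op) auto
qed

end

subsection \<open>The nerve of a cover as a new system\<close>

text \<open>Chains on tuples of length at least two again form a family over a lattice. Opens and
  coefficients of the new system are functions on lists whose first entry is the tuple; consuming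
  one entry of the list per step keeps the types unchanged, which the induction below needs.\<close>

definition slice :: "('i list \<Rightarrow> 'x) \<Rightarrow> 'i \<Rightarrow> 'i list \<Rightarrow> 'x" where
  "slice c s = (\<lambda>q. c (s # q))"

definition glue :: "'x \<Rightarrow> ('i \<Rightarrow> 'i list \<Rightarrow> 'x) \<Rightarrow> 'i list \<Rightarrow> 'x" where
  "glue x g l = (case l of [] \<Rightarrow> x | s # q \<Rightarrow> g s q)"

lemma slice_glue [simp]: "slice (glue x g) = g"
  by (simp add: slice_def glue_def fun_eq_iff)

lemma glue_Nil [simp]: "glue x g [] = x"
  by (simp add: glue_def)

lemma eq_iff_slice: "c = c' \<longleftrightarrow> c [] = c' [] \<and> (\<forall>s. slice c s = slice c' s)"
  unfolding slice_def fun_eq_iff by (metis list.exhaust)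

lemma le_slice: "P \<le> Q \<Longrightarrow> slice P s \<le> slice Q s" for P :: "'i list \<Rightarrow> 'x::order"
  by (simp add: slice_def le_fun_def)

lemma le_iff_slice: "P \<le> Q \<longleftrightarrow> P [] \<le> Q [] \<and> (\<forall>s. slice P s \<le> slice Q s)"
  for P :: "'i list \<Rightarrow> 'x::order"
  unfolding slice_def le_fun_def by (metis list.exhaust)

lemma slice_simps [simp]:
  "slice 0 s = (0::'i list \<Rightarrow> 'v::ab_group_add)"
  "slice (a + b) s = slice a s + slice (b::'i list \<Rightarrow> 'v) s"
  "slice (a - b) s = slice a s - slice (b::'i list \<Rightarrow> 'v) s"
  "slice bot s = (bot::'i list \<Rightarrow> 'l::bounded_lattice_bot)"
  "slice (sup P Q) s = sup (slice P s) (slice (Q::'i list \<Rightarrow> 'l) s)"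
  "slice (inf P Q) s = inf (slice P s) (slice (Q::'i list \<Rightarrow> 'l) s)"
  by (simp_all add: slice_def fun_eq_iff)

text \<open>The empty tuple and the single indices are left out, as the induction step treats them
  directly. Repetitions are allowed: \<open>[i, i]\<close> is valid.\<close>

definition valid :: "nat \<Rightarrow> nat list \<Rightarrow> bool" where
  "valid r s \<longleftrightarrow> 2 \<le> length s \<and> set s \<subseteq> {..<r}"

text \<open>Comparing sets of entries instead of faces makes \<open>slice P s\<close> depend only on
  \<open>set s\<close> for valid \<open>s\<close>. Prepending an entry that already occurs then
  leaves the open set unchanged, as the cone construction requires.\<close>

definition nerve_op :: "nat \<Rightarrow> (nat list list \<Rightarrow> 'x::order) set \<Rightarrow> (nat list list \<Rightarrow> 'x) set" where
  "nerve_op r Op = {P. (\<forall>s. slice P s \<in> Op) \<and>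
     (\<forall>s t. valid r s \<longrightarrow> valid r t \<longrightarrow> set t \<subseteq> set s \<longrightarrow> slice P s \<le> slice P t)}"

text \<open>The shift by 2 gives the coefficients on pairs degree \<open>p\<close>. No relation is
  imposed between coefficients on different tuples. The entry at \<open>[]\<close> belongs to no
  tuple and is set to \<open>0\<close>.\<close>

definition nerve_fam :: "nat \<Rightarrow> (int \<Rightarrow> (nat list list \<Rightarrow> 'x) \<Rightarrow> (nat list list \<Rightarrow> 'v) set) \<Rightarrow>
    int \<Rightarrow> (nat list list \<Rightarrow> 'x) \<Rightarrow> (nat list list \<Rightarrow> 'v::ab_group_add) set" where
  "nerve_fam r F p P = {c. c [] = 0 \<and> (\<forall>s. if valid r s
     then slice c s \<in> F (p + 2 - int (length s)) (slice P s) else slice c s = 0)}"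

text \<open>The total boundary never lengthens tuples, so chains on tuples of length at most one
  form a subcomplex; this is the boundary of the quotient.\<close>

definition nerve_bd :: "nat \<Rightarrow> ((nat list list \<Rightarrow> 'v::ab_group_add) \<Rightarrow> nat list list \<Rightarrow> 'v) \<Rightarrow>
    (nat list list \<Rightarrow> 'v) \<Rightarrow> nat list list \<Rightarrow> 'v" where
  "nerve_bd r d c = glue 0 (\<lambda>s. if valid r s then tot_bd r d (slice c) s else 0)"

definition nerve_map :: "((nat list list \<Rightarrow> 'v) \<Rightarrow> nat list list \<Rightarrow> 'w::zero) \<Rightarrow>
    (nat list list \<Rightarrow> 'v) \<Rightarrow> nat list list \<Rightarrow> 'w" where
  "nerve_map f c = glue 0 (\<lambda>s. f (slice c s))"

lemma nerve_opD: "P \<in> nerve_op r Op \<Longrightarrow> slice P s \<in> Op"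
  by (simp add: nerve_op_def)

lemma nerve_op_le:
  "P \<in> nerve_op r Op \<Longrightarrow> valid r s \<Longrightarrow> valid r t \<Longrightarrow> set t \<subseteq> set s \<Longrightarrow> slice P s \<le> slice P t"
  by (simp add: nerve_op_def)

lemma nerve_famI:
  "c [] = 0 \<Longrightarrow>
   (\<And>s. valid r s \<Longrightarrow> slice c s \<in> F (p + 2 - int (length s)) (slice P s)) \<Longrightarrow>
   (\<And>s. \<not> valid r s \<Longrightarrow> slice c s = 0) \<Longrightarrow> c \<in> nerve_fam r F p P"
  by (simp add: nerve_fam_def)

lemma nerve_famD:
  assumes "c \<in> nerve_fam r F p P"
  shows "c [] = 0" "valid r s \<Longrightarrow> slice c s \<in> F (p + 2 - int (length s)) (slice P s)"
    "\<not> valid r s \<Longrightarrow> slice c s = 0"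
proof -
  have "if valid r s then slice c s \<in> F (p + 2 - int (length s)) (slice P s) else slice c s = 0"
    using assms unfolding nerve_fam_def by blast
  then show "valid r s \<Longrightarrow> slice c s \<in> F (p + 2 - int (length s)) (slice P s)"
    "\<not> valid r s \<Longrightarrow> slice c s = 0" by simp_all
  show "c [] = 0" using assms unfolding nerve_fam_def by blast
qed

lemma slice_nerve_bd:
  "slice (nerve_bd r d c) s = (if valid r s then tot_bd r d (slice c) s else 0)"
  by (simp add: nerve_bd_def)

lemma slice_nerve_map: "slice (nerve_map f c) s = f (slice c s)"
  by (simp add: nerve_map_def)

lemma nerve_bd_Nil [simp]: "nerve_bd r d c [] = 0" and nerve_map_Nil [simp]: "nerve_map f c [] = 0"
  by (simp_all add: nerve_bd_def nerve_map_def)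

lemma additive_nerve_bd:
  fixes d :: "(nat list list \<Rightarrow> 'a::ab_group_add) \<Rightarrow> nat list list \<Rightarrow> 'a"
  assumes "Modules.additive d"
  shows "Modules.additive (nerve_bd r d)"
proof
  fix a b :: "nat list list \<Rightarrow> 'a"
  have "slice (a + b) = (\<lambda>s. slice a s + slice b s)" by (rule ext) simp
  then show "nerve_bd r d (a + b) = nerve_bd r d a + nerve_bd r d b"
    by (subst eq_iff_slice) (auto simp: slice_nerve_bd tot_bd_add[OF assms])
qed

lemma additive_nerve_map:
  fixes f :: "(nat list list \<Rightarrow> 'v::ab_group_add) \<Rightarrow> nat list list \<Rightarrow> 'w::ab_group_add"
  assumes "Modules.additive f"
  shows "Modules.additive (nerve_map f)"
proof
  show "nerve_map f (a + b) = nerve_map f a + nerve_map f b" for a b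
    by (subst eq_iff_slice) (simp add: slice_nerve_map additive.add[OF assms] fun_eq_iff)
qed

lemma valid_Suc:
  "valid r s \<Longrightarrow> length t = Suc (length s) \<Longrightarrow> set t \<subseteq> set s \<union> {..<r} \<Longrightarrow> valid r t"
  by (auto simp: valid_def)

lemma tot_bd_cong_valid:
  assumes "valid r s" "\<And>t. valid r t \<Longrightarrow> a t = b t"
  shows "tot_bd r d a s = tot_bd r d b s"
proof -
  have "face_sum r a s = face_sum r b s"
    by (rule face_sum_cong) (use assms valid_Suc in blast)
  then show ?thesis using assms by (simp add: tot_bd_def)
qed

text \<open>The truncation inside is invisible: at a valid tuple the boundary reads only that tuple
  and longer ones, which are valid again.\<close>

lemma nerve_bd_nerve_bd:
  assumes "Modules.additive d"
  shows "slice (nerve_bd r d (nerve_bd r d c)) s = (if valid r s then d (d (slice c s)) else 0)"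
proof (cases "valid r s")
  case True
  then have "slice (nerve_bd r d (nerve_bd r d c)) s = tot_bd r d (slice (nerve_bd r d c)) s"
    by (simp add: slice_nerve_bd)
  also have "\<dots> = tot_bd r d (tot_bd r d (slice c)) s"
    by (rule tot_bd_cong_valid[OF True]) (simp add: slice_nerve_bd)
  finally show ?thesis using True by (simp add: tot_bd_tot_bd[OF assms])
qed (simp add: slice_nerve_bd)

lemma subgrp_family_nerve:
  assumes "subgrp_family Op F d"
  shows "subgrp_family (nerve_op r Op) (nerve_fam r F) (nerve_bd r d)"
proof -
  interpret subgrp_family Op F d by fact
  show ?thesis
  proof (rule subgrp_family.intro)
    show "bot \<in> nerve_op r Op" by (simp add: nerve_op_def bot_Op)
    show "sup P Q \<in> nerve_op r Op" "inf P Q \<in> nerve_op r Op"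
      if "P \<in> nerve_op r Op" "Q \<in> nerve_op r Op" for P Q
      using that by (auto simp: nerve_op_def intro!: sup_Op inf_Op intro: le_supI1 le_supI2 le_infI1 le_infI2)
  next
    fix P p assume P: "P \<in> nerve_op r Op"
    note sub = subgrp[OF nerve_opD[OF P]]
    show "subgrp (nerve_fam r F p P)"
      unfolding subgrp_def
      by (auto intro!: nerve_famI subgrp_0[OF sub] subgrp_diff[OF sub] simp: nerve_famD)
  next
    fix P Q p assume PQ: "P \<in> nerve_op r Op" "Q \<in> nerve_op r Op" "P \<le> Q"
    show "nerve_fam r F p P \<subseteq> nerve_fam r F p Q"
    proof
      fix c assume c: "c \<in> nerve_fam r F p P"
      show "c \<in> nerve_fam r F p Q"
        using mono[OF nerve_opD[OF PQ(1)] nerve_opD[OF PQ(2)] le_slice[OF PQ(3)]]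
        by (intro nerve_famI) (blast intro: nerve_famD[OF c])+
    qed
  next
    fix P and p :: int assume P: "P \<in> nerve_op r Op" and p: "p < 0"
    have "c = 0" if c: "c \<in> nerve_fam r F p P" for c
    proof -
      have "slice c s = 0" for s
      proof (cases "valid r s")
        case True
        then have "F (p + 2 - int (length s)) (slice P s) = {0}"
          using p by (intro neg nerve_opD[OF P]) (simp add: valid_def)
        then show ?thesis using nerve_famD(2)[OF c True] by simp
      qed (simp add: nerve_famD[OF c])
      then show ?thesis by (subst eq_iff_slice) (simp add: nerve_famD[OF c])
    qed
    moreover have "0 \<in> nerve_fam r F p P"
      by (rule nerve_famI) (simp_all add: subgrp_0 subgrp nerve_opD[OF P])
    ultimately show "nerve_fam r F p P = {0}" by blast
  next
    show "Modules.additive (nerve_bd r d)" by (rule additive_nerve_bd[OF additive])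
  next
    fix P c p assume P: "P \<in> nerve_op r Op" and c: "c \<in> nerve_fam r F p P"
    show "nerve_bd r d c \<in> nerve_fam r F (p - 1) P"
    proof (rule nerve_famI)
      fix s assume s: "valid r s"
      note sub = subgrp[OF nerve_opD[OF P]]
      have "face_sum r (slice c) s \<in> F (p - 1 + 2 - int (length s)) (slice P s)"
      proof (rule face_sum_in_subgrp[OF sub])
        fix t assume t: "length t = Suc (length s)" "set s \<subseteq> set t" "set t \<subseteq> set s \<union> {..<r}"
        then have vt: "valid r t" using valid_Suc s by blast
        show "slice c t \<in> F (p - 1 + 2 - int (length s)) (slice P s)"
          using nerve_famD(2)[OF c vt] mono[OF nerve_opD[OF P] nerve_opD[OF P] nerve_op_le[OF P vt s t(2)]] t(1)
          by (auto simp: algebra_simps)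
      qed
      moreover have "sgn_pow (length s) (d (slice c s)) \<in> F (p - 1 + 2 - int (length s)) (slice P s)"
        using bd[OF nerve_opD[OF P] nerve_famD(2)[OF c s]]
        by (auto intro!: sgn_pow_in_subgrp sub simp: algebra_simps)
      ultimately show "slice (nerve_bd r d c) s \<in> F (p - 1 + 2 - int (length s)) (slice P s)"
        using s by (simp add: slice_nerve_bd tot_bd_def subgrp_add[OF sub])
    qed (simp_all add: slice_nerve_bd)
    show "nerve_bd r d (nerve_bd r d c) \<in> nerve_fam r F (p - 2) bot"
    proof (rule nerve_famI)
      show "slice (nerve_bd r d (nerve_bd r d c)) s \<in> F (p - 2 + 2 - int (length s)) (slice bot s)"
        if "valid r s" for s
        using bd_bd[OF nerve_opD[OF P] nerve_famD(2)[OF c that]] that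
        by (simp add: nerve_bd_nerve_bd[OF additive] algebra_simps)
    qed (simp_all add: slice_nerve_bd)
  qed
qed

text \<open>Since coefficients on different tuples are independent, sums and intersections can be
  treated one tuple at a time.\<close>

lemma flabby_family_nerve:
  assumes "flabby_family Op C d"
  shows "flabby_family (nerve_op r Op) (nerve_fam r C) (nerve_bd r d)"
proof -
  interpret flabby_family Op C d by fact
  interpret N: subgrp_family "nerve_op r Op" "nerve_fam r C" "nerve_bd r d"
    by (rule subgrp_family_nerve[OF subgrp_family_axioms])
  show ?thesis
  proof
    fix P Q c p assume P: "P \<in> nerve_op r Op" and Q: "Q \<in> nerve_op r Op"
    {
      assume c: "c \<in> nerve_fam r C p (sup P Q)"
      have "\<exists>y z. if valid r s then y \<in> C (p + 2 - int (length s)) (slice P s) \<and>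
        z \<in> C (p + 2 - int (length s)) (slice Q s) \<and> slice c s = y + z else y = 0 \<and> z = 0" for s
        using sup[OF nerve_opD[OF P] nerve_opD[OF Q]] nerve_famD(2)[OF c, of s]
        by (cases "valid r s") (simp_all, blast)
      then obtain y z where yz: "\<And>s. if valid r s then y s \<in> C (p + 2 - int (length s)) (slice P s) \<and>
        z s \<in> C (p + 2 - int (length s)) (slice Q s) \<and> slice c s = y s + z s else y s = 0 \<and> z s = 0"
        by metis
      show "\<exists>y\<in>nerve_fam r C p P. \<exists>z\<in>nerve_fam r C p Q. c = y + z"
      proof (intro bexI)
        show "c = glue 0 y + glue 0 z"
        proof (subst eq_iff_slice, intro conjI allI)
          show "slice c s = slice (glue 0 y + glue 0 z) s" for s
            using yz[of s] nerve_famD(3)[OF c, of s] by (cases "valid r s") simp_all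
        qed (simp add: nerve_famD(1)[OF c])
        show "glue 0 y \<in> nerve_fam r C p P" "glue 0 z \<in> nerve_fam r C p Q"
          using yz by (auto intro!: nerve_famI)
      qed
    }
    show "c \<in> nerve_fam r C p (inf P Q)" if "c \<in> nerve_fam r C p P" "c \<in> nerve_fam r C p Q"
      using that by (auto intro!: nerve_famI inf nerve_opD[OF P] nerve_opD[OF Q] simp: nerve_famD)
  qed
qed

section \<open>Small open sets and their behaviour on the nerve\<close>

text \<open>Cycles over \<open>T\<close> need to bound only over the larger \<open>V\<close>, which
  is the form in which local triviality is given.\<close>

definition small ::
    "'l::{order,bot} set \<Rightarrow> (int \<Rightarrow> 'l \<Rightarrow> 'w::ab_group_add set) \<Rightarrow> ('w \<Rightarrow> 'w) \<Rightarrow> int \<Rightarrow> 'l \<Rightarrow> 'l \<Rightarrow> bool" where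
  "small Op F e N T V \<longleftrightarrow> T \<in> Op \<and> T \<le> V \<and>
     (\<forall>q\<le>N. \<forall>g\<in>F q T. e g \<in> F (q - 1) bot \<longrightarrow> (\<exists>u\<in>F (q + 1) V. g - e u \<in> F q bot))"

text \<open>Local acyclicity phrased without points, by chains in place of neighbourhoods, so that
  it makes sense over a lattice and can be inherited by the nerve.\<close>

definition decomposable ::
    "'l::{order,bot} set \<Rightarrow> (int \<Rightarrow> 'l \<Rightarrow> 'v::ab_group_add set) \<Rightarrow>
     (int \<Rightarrow> 'l \<Rightarrow> 'w::ab_group_add set) \<Rightarrow> ('w \<Rightarrow> 'w) \<Rightarrow> int \<Rightarrow> bool" where
  "decomposable Op C F e N \<longleftrightarrow>
     (\<forall>V\<in>Op. \<forall>p. \<forall>c\<in>C p V. c \<in> sums_of (\<Union>T\<in>{T. small Op F e N T V}. C p T))"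

text \<open>For valid \<open>s\<close> this is the least open set of the nerve with value
  \<open>T\<close> at \<open>s\<close>: monotonicity forces \<open>T\<close> on every valid tuple
  with entries in \<open>set s\<close>.\<close>

definition star :: "nat \<Rightarrow> nat list \<Rightarrow> (nat list list \<Rightarrow> 'x::bot) \<Rightarrow> nat list list \<Rightarrow> 'x" where
  "star r s T = glue bot (\<lambda>t. if valid r t \<and> set t \<subseteq> set s then T else bot)"

lemma slice_star: "slice (star r s T) t = (if valid r t \<and> set t \<subseteq> set s then T else bot)"
  by (simp add: star_def)

text \<open>Over the star the coefficients are constant on a full simplex, and the cone with apex
  \<open>a\<close> would contract everything had the single indices been kept. Truncation leaves a
  defect at the pairs \<open>[a, i]\<close>; it is a cycle over \<open>T\<close>, and smallness of
  \<open>T\<close> bounds it.\<close>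

lemma small_star:
  assumes fam: "subgrp_family Op F e" and P: "P \<in> nerve_op r Op" and s: "valid r s"
    and T: "small Op F e N T (slice P s)"
  shows "small (nerve_op r Op) (nerve_fam r F) (nerve_bd r e) (N - 1) (star r s T) P"
proof -
  interpret subgrp_family Op F e by fact
  have TOp: "T \<in> Op" and TP: "T \<le> slice P s"
    and die: "\<And>q g. q \<le> N \<Longrightarrow> g \<in> F q T \<Longrightarrow> e g \<in> F (q - 1) bot \<Longrightarrow>
      \<exists>u\<in>F (q + 1) (slice P s). g - e u \<in> F q bot"
    using T by (auto simp: small_def)
  note P_Op = nerve_opD[OF P]
  \<comment> \<open>Any entry of \<open>s\<close> could be the apex: prepending it to a tuple with
    entries in \<open>set s\<close> stays within \<open>set s\<close>.\<close>
  define a where "a = hd s"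
  have a: "a \<in> set s" "a < r" using s by (cases s; auto simp: valid_def a_def)+
  have star_Op: "star r s T \<in> nerve_op r Op"
    using TOp bot_Op by (auto simp: nerve_op_def slice_star)
  have star_le: "star r s T \<le> P"
  proof (subst le_iff_slice, intro conjI allI)
    show "slice (star r s T) t \<le> slice P t" for t
      using TP nerve_op_le[OF P s, of t] by (auto simp: slice_star intro: order_trans)
  qed (simp add: star_def)
  have cone_le: "slice (star r s T) t \<le> slice P (a # t)" if "valid r (a # t)" for t
    using TP nerve_op_le[OF P s that] a by (auto simp: slice_star intro: order_trans)
  have "\<exists>v\<in>nerve_fam r F (q + 1) P. g - nerve_bd r e v \<in> nerve_fam r F q bot"
    if q: "q \<le> N - 1" and g: "g \<in> nerve_fam r F q (star r s T)"
      and cyc: "nerve_bd r e g \<in> nerve_fam r F (q - 1) bot" for q g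
  proof -
    \<comment> \<open>\<open>?\<gamma> i\<close> is the component at \<open>[i]\<close> of the total
      boundary of \<open>g\<close>, the part which the truncation discards.\<close>
    let ?g = "slice g" and ?\<gamma> = "\<lambda>i. face_sum r (slice g) [i]"
    have cyc': "tot_bd r e ?g t \<in> F (q + 1 - int (length t)) bot" if "valid r t" for t
      using nerve_famD(2)[OF cyc that] that by (simp add: slice_nerve_bd algebra_simps)
    have val2: "valid r t" if "length t = Suc (length [i])" "set t \<subseteq> set [i] \<union> {..<r}" "i < r" for i t
      using that by (auto simp: valid_def)
    have \<gamma>: "?\<gamma> i \<in> F q (if i \<in> set s then T else bot)" if i: "i < r" for i
    proof (rule face_sum_in_subgrp)
      show "subgrp (F q (if i \<in> set s then T else bot))" using TOp bot_Op by (simp add: subgrp)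
      fix t assume t: "length t = Suc (length [i])" "set [i] \<subseteq> set t" "set t \<subseteq> set [i] \<union> {..<r}"
      have "?g t \<in> F q (slice (star r s T) t)"
        using nerve_famD(2)[OF g val2[OF t(1,3) i]] t(1) by simp
      then show "?g t \<in> F q (if i \<in> set s then T else bot)"
        using t(2) bot_subset[OF TOp] by (auto simp: slice_star split: if_splits)
    qed
    have e\<gamma>: "e (?\<gamma> i) \<in> F (q - 1) bot" if i: "i < r" for i
    proof -
      have "e (?\<gamma> i) = face_sum r (\<lambda>t. e (?g t)) [i]"
        by (rule face_sum_hom[OF additive, symmetric])
      also have "\<dots> = face_sum r (\<lambda>t. tot_bd r e ?g t - face_sum r ?g t) [i]"
        by (rule face_sum_cong) (simp add: tot_bd_def sgn_pow_def)
      also have "\<dots> = face_sum r (tot_bd r e ?g) [i] - face_sum r (face_sum r ?g) [i]"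
        by (rule face_sum_diff)
      also have "\<dots> = face_sum r (tot_bd r e ?g) [i]"
        by (simp only: face_sum_face_sum diff_zero)
      also have "\<dots> \<in> F (q - 1) bot"
      proof (rule face_sum_in_subgrp[OF subgrp[OF bot_Op]])
        fix t assume t: "length t = Suc (length [i])" "set [i] \<subseteq> set t" "set t \<subseteq> set [i] \<union> {..<r}"
        show "tot_bd r e ?g t \<in> F (q - 1) bot"
          using cyc'[OF val2[OF t(1,3) i]] t(1) by simp
      qed
      finally show ?thesis .
    qed
    \<comment> \<open>For \<open>i\<close> outside \<open>s\<close> the defect
      \<open>?\<gamma> i\<close> already lies over \<open>bot\<close>, so \<open>0\<close> serves as
      bounding chain.\<close>
    have "\<exists>u. if i \<in> set s then u \<in> F (q + 1) (slice P s) \<and> ?\<gamma> i - e u \<in> F q bot else u = 0" for i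
    proof (cases "i \<in> set s")
      case True
      then have "i < r" using s by (auto simp: valid_def)
      then show ?thesis using die[of q "?\<gamma> i"] \<gamma>[of i] e\<gamma>[of i] q True by auto
    qed simp
    then obtain u where u: "\<And>i. if i \<in> set s then u i \<in> F (q + 1) (slice P s) \<and> ?\<gamma> i - e (u i) \<in> F q bot else u i = 0"
      by metis
    have u': "?\<gamma> i - e (u i) \<in> F q bot" if "i < r" for i
      using u[of i] \<gamma>[OF that] by (auto simp: additive.zero[OF additive] split: if_splits)
    \<comment> \<open>The bounding chains are placed at the pairs \<open>[a, i]\<close>, exactly
      where the cone identity fails; \<open>t ! 1\<close> recovers \<open>i\<close>.\<close>
    define w where "w t = (if \<exists>i<r. t = [a, i] then u (t ! 1) else 0)" for t
    define v where "v t = cone_at a ?g t + w t" for t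
    have w_long: "w t = 0" if "length t \<noteq> 2" for t using that by (auto simp: w_def)
    show ?thesis
    proof (rule bexI)
      show "glue 0 v \<in> nerve_fam r F (q + 1) P"
      proof (rule nerve_famI)
        fix t assume t: "valid r t"
        have "cone_at a ?g t \<in> F (q + 1 + 2 - int (length t)) (slice P t)"
        proof (cases t)
          case (Cons j t')
          have "?g t' \<in> F (q + 2 - int (length t')) (slice P (a # t'))" if "j = a"
          proof (cases "valid r t'")
            case True
            then show ?thesis
              using nerve_famD(2)[OF g True] mono[OF nerve_opD[OF star_Op] P_Op cone_le] t Cons that by blast
          qed (simp add: nerve_famD(3)[OF g] subgrp_0[OF subgrp[OF P_Op]])
          then show ?thesis using Cons subgrp_0[OF subgrp[OF P_Op]] by (auto simp: algebra_simps)
        qed (use t in \<open>simp add: valid_def\<close>)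
        moreover have "w t \<in> F (q + 1 + 2 - int (length t)) (slice P t)"
        proof (cases "\<exists>i<r. t = [a, i]")
          case True
          then obtain i where i: "i < r" "t = [a, i]" by blast
          have "u i \<in> F (q + 1) (slice P t)"
          proof (cases "i \<in> set s")
            case True
            then have "set t \<subseteq> set s" using i a by simp
            then show ?thesis using u[of i] True mono[OF P_Op P_Op nerve_op_le[OF P s t]] by auto
          next
            case False
            then show ?thesis using u[of i] by (simp add: subgrp_0[OF subgrp[OF P_Op]])
          qed
          then show ?thesis using i by (simp add: w_def add.commute)
        next
          case False
          then have "w t = 0" by (auto simp: w_def)
          then show ?thesis by (simp add: subgrp_0[OF subgrp[OF P_Op]])
        qed
        ultimately show "slice (glue 0 v) t \<in> F (q + 1 + 2 - int (length t)) (slice P t)"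
          by (simp add: v_def subgrp_add[OF subgrp[OF P_Op]])
      next
        fix t assume t: "\<not> valid r t"
        have "cone_at a ?g t = 0"
        proof (cases t)
          case (Cons j t')
          then have "j = a \<Longrightarrow> \<not> valid r t'" using t a by (auto simp: valid_def)
          then show ?thesis using Cons nerve_famD(3)[OF g] by simp
        qed simp
        moreover have "w t = 0" using t a by (auto simp: w_def valid_def)
        ultimately show "slice (glue 0 v) t = 0" by (simp add: v_def)
      qed simp
      show "g - nerve_bd r e (glue 0 v) \<in> nerve_fam r F q bot"
      proof (rule nerve_famI)
        fix t assume t: "valid r t"
        \<comment> \<open>\<open>w\<close> is supported on pairs, while its Cech boundary at a valid
          tuple reads tuples of length at least three.\<close>
        have "face_sum r w t \<in> {0}"
          by (rule face_sum_in_subgrp[OF subgrp_singleton_0]) (use t w_long in \<open>auto simp: valid_def\<close>)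
        then have "tot_bd r e v t = ?g t - cone_at a (tot_bd r e ?g) t + sgn_pow (length t) (e (w t))"
          unfolding v_def by (simp add: tot_bd_add[OF additive] tot_bd_cone_at[OF additive a(2)])
            (simp add: tot_bd_def)
        then have eq: "slice (g - nerve_bd r e (glue 0 v)) t = cone_at a (tot_bd r e ?g) t - sgn_pow (length t) (e (w t))"
          using t by (simp add: slice_nerve_bd)
        show "slice (g - nerve_bd r e (glue 0 v)) t \<in> F (q + 2 - int (length t)) (slice bot t)"
        proof (cases "\<exists>t'. t = a # t'")
          case True
          then obtain t' where t': "t = a # t'" ..
          show ?thesis
          proof (cases "valid r t'")
            case True
            then have "w t = 0" using t' by (intro w_long) (auto simp: valid_def)
            then show ?thesis unfolding eq using t' cyc'[OF True]
              by (simp add: additive.zero[OF additive] sgn_pow_simps algebra_simps)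
          next
            case False
            \<comment> \<open>A valid tuple has an invalid tail only if it is a pair. This is the
              defect repaired by \<open>w\<close>; on pairs the sign is \<open>+\<close>.\<close>
            then have "length t' = 1" using t t' by (auto simp: valid_def)
            then obtain i where i: "t' = [i]" by (auto simp: length_Suc_conv)
            then have "i < r" using t t' by (auto simp: valid_def)
            moreover have "tot_bd r e ?g [i] = ?\<gamma> i"
              using nerve_famD(3)[OF g, of "[i]"]
              by (simp add: tot_bd_def valid_def additive.zero[OF additive] sgn_pow_simps)
            ultimately show ?thesis unfolding eq using t' i u'[of i]
              by (simp add: w_def sgn_pow_def)
          qed
        next
          case False
          then have "w t = 0" by (auto simp: w_def)
          moreover have "cone_at a (tot_bd r e ?g) t = 0" using False by (cases t) auto
          ultimately show ?thesis unfolding eq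
            by (simp add: additive.zero[OF additive] sgn_pow_simps subgrp_0[OF subgrp[OF bot_Op]])
        qed
      qed (use nerve_famD[OF g] in \<open>simp_all add: slice_nerve_bd\<close>)
    qed
  qed
  then show ?thesis using star_Op star_le unfolding small_def by blast
qed

definition single :: "nat list \<Rightarrow> (nat list list \<Rightarrow> 'v::zero) \<Rightarrow> nat list list \<Rightarrow> 'v" where
  "single s x = glue 0 (\<lambda>t. if t = s then x else 0)"

lemma slice_single: "slice (single s x) t = (if t = s then x else 0)"
  by (simp add: single_def)

lemma additive_single: "Modules.additive (single s :: _ \<Rightarrow> _ \<Rightarrow> 'v::ab_group_add)"
proof
  show "single s (x + y) = single s x + (single s y :: _ \<Rightarrow> 'v)" for x y
    by (subst eq_iff_slice) (simp add: slice_single single_def)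
qed

lemma slice_sum: "slice (\<Sum>i\<in>I. g i) t = (\<Sum>i\<in>I. slice (g i :: 'i list \<Rightarrow> 'v::ab_group_add) t)"
  by (rule additive.sum[of "\<lambda>c. slice c t"]) (simp add: Modules.additive_def)

lemma sum_fun_apply: "(\<Sum>i\<in>I. g i) x = (\<Sum>i\<in>I. g i x :: 'v::ab_group_add)"
  by (induction I rule: infinite_finite_induct) simp_all

text \<open>A chain is the sum of its components on single tuples. Negative degrees vanish, so the
  degree bounds the length of the tuples that occur. Each component is decomposed in the original
  family and its pieces are carried by stars.\<close>

lemma decomposable_nerve:
  assumes C: "subgrp_family Op C d" and F: "subgrp_family Op F e" and dec: "decomposable Op C F e N"
  shows "decomposable (nerve_op r Op) (nerve_fam r C) (nerve_fam r F) (nerve_bd r e) (N - 1)"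
  unfolding decomposable_def
proof (intro ballI allI)
  interpret C: subgrp_family Op C d by fact
  fix P p c assume P: "P \<in> nerve_op r Op" and c: "c \<in> nerve_fam r C p P"
  let ?S = "\<Union>T\<in>{T. small (nerve_op r Op) (nerve_fam r F) (nerve_bd r e) (N - 1) T P}. nerve_fam r C p T"
  define I where "I = {s. set s \<subseteq> {..<r} \<and> length s \<le> nat (p + 2)} \<inter> {s. valid r s}"
  have "finite I" unfolding I_def by (simp add: finite_lists_length_le)
  have "single s (slice c s) \<in> sums_of ?S" if s: "valid r s" for s
  proof -
    have "slice c s \<in> sums_of (\<Union>T\<in>{T. small Op F e N T (slice P s)}. C (p + 2 - int (length s)) T)"
      using dec nerve_famD(2)[OF c s] nerve_opD[OF P] by (auto simp: decomposable_def)
    then show ?thesis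
    proof (rule sums_of_image[OF additive_single, rotated])
      fix x assume "x \<in> (\<Union>T\<in>{T. small Op F e N T (slice P s)}. C (p + 2 - int (length s)) T)"
      then obtain T where T: "small Op F e N T (slice P s)" and x: "x \<in> C (p + 2 - int (length s)) T"
        by blast
      have TOp: "T \<in> Op" using T by (simp add: small_def)
      have "single s x \<in> nerve_fam r C p (star r s T)"
        by (rule nerve_famI)
          (use s x subgrp_0[OF C.subgrp] TOp C.bot_Op in \<open>auto simp: slice_single single_def[of s x] slice_star\<close>)
      then show "single s x \<in> ?S" using small_star[OF F P s T] by blast
    qed
  qed
  then have "(\<Sum>s\<in>I. single s (slice c s)) \<in> sums_of ?S"
    by (intro sums_of_sum) (simp add: I_def)
  moreover have "c = (\<Sum>s\<in>I. single s (slice c s))"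
  proof (subst eq_iff_slice, intro conjI allI)
    show "c [] = (\<Sum>s\<in>I. single s (slice c s)) []"
      by (simp add: nerve_famD(1)[OF c] sum_fun_apply single_def)
    show "slice c t = slice (\<Sum>s\<in>I. single s (slice c s)) t" for t
    proof -
      have "slice c t = 0" if "t \<notin> I"
      proof (cases "valid r t")
        case True
        then have "C (p + 2 - int (length t)) (slice P t) = {0}"
          using that by (intro C.neg nerve_opD[OF P]) (auto simp: I_def valid_def)
        then show ?thesis using nerve_famD(2)[OF c True] by simp
      qed (simp add: nerve_famD(3)[OF c])
      then show ?thesis using \<open>finite I\<close>
        by (auto simp: slice_sum slice_single)
    qed
  qed
  ultimately show "c \<in> sums_of ?S" by simp
qed

section \<open>The comparison principle by induction on the degree\<close>

definition comparison_system where
  "comparison_system Op C d F e f N \<longleftrightarrow>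
     flabby_family Op C d \<and> subgrp_family Op F e \<and> Modules.additive f \<and>
     (\<forall>V\<in>Op. \<forall>p. \<forall>c\<in>C p V. f c \<in> F p V \<and> f (d c) - e (f c) \<in> F (p - 1) bot) \<and>
     decomposable Op C F e N"

text \<open>A null-homology \<open>b\<close> of \<open>z\<close> in the augmented total complex
  carries all the data: the \<open>b [i]\<close> form a decomposition of \<open>z\<close> up to a
  boundary, and the components on longer tuples record how the boundaries of the
  \<open>b [i]\<close> cancel. The latter form the cycle on the nerve to which \<open>IH\<close>
  applies.\<close>

lemma cycles_bound_step:
  fixes Op :: "(nat list list \<Rightarrow> 'x::{distrib_lattice,bounded_lattice}) set"
    and C :: "int \<Rightarrow> (nat list list \<Rightarrow> 'x) \<Rightarrow> (nat list list \<Rightarrow> 'v::ab_group_add) set"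
    and F :: "int \<Rightarrow> (nat list list \<Rightarrow> 'x) \<Rightarrow> (nat list list \<Rightarrow> 'w::ab_group_add) set"
  assumes sys: "comparison_system Op C d F e f n"
    and V: "V \<in> Op" and z: "z \<in> C n V" and dz: "d z \<in> C (n - 1) bot"
    and IH: "\<And>(Op :: (nat list list \<Rightarrow> 'x) set) (C :: _ \<Rightarrow> _ \<Rightarrow> (nat list list \<Rightarrow> 'v) set) d
      (F :: _ \<Rightarrow> _ \<Rightarrow> (nat list list \<Rightarrow> 'w) set) e f V z.
      comparison_system Op C d F e f (n - 1) \<Longrightarrow> V \<in> Op \<Longrightarrow> z \<in> C (n - 1) V \<Longrightarrow>
      d z \<in> C (n - 2) bot \<Longrightarrow> \<exists>u\<in>F n V. f z - e u \<in> F (n - 1) bot"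
  shows "\<exists>u\<in>F (n + 1) V. f z - e u \<in> F n bot"
proof -
  have C: "flabby_family Op C d" and F: "subgrp_family Op F e" and f_add: "Modules.additive f"
    and dec: "decomposable Op C F e n"
    and f_in: "\<And>V p c. V \<in> Op \<Longrightarrow> c \<in> C p V \<Longrightarrow> f c \<in> F p V"
    and f_bd: "\<And>V p c. V \<in> Op \<Longrightarrow> c \<in> C p V \<Longrightarrow> f (d c) - e (f c) \<in> F (p - 1) bot"
    using sys by (auto simp: comparison_system_def)
  interpret F: subgrp_family Op F e by fact
  have "z \<in> sums_of (\<Union>T\<in>{T. small Op F e n T V}. C n T)"
    using dec V z by (auto simp: decomposable_def)
  from sums_of_imp_indexed[OF this] obtain r :: nat and T z'
    where *: "\<forall>i<r. T i \<in> {T. small Op F e n T V} \<and> z' i \<in> C n (T i)" and z_eq: "z = (\<Sum>i<r. z' i)"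
    by blast
  then have T: "small Op F e n (T i) V" and z': "z' i \<in> C n (T i)" if "i < r" for i
    using that by auto
  interpret C: flabby_family Op C d by fact
  interpret C: cech Op C d r T
    by unfold_locales (use T in \<open>auto simp: small_def\<close>)
  define W where "W = cover T r"
  have W: "W \<in> Op" and WV: "W \<le> V"
    using C.cover_Op[of r] cover_le[of r T V] T by (auto simp: W_def small_def)
  \<comment> \<open>The summands \<open>z' i\<close> place \<open>z\<close> over \<open>W\<close>;
    the decomposition used from here on is the one read off from \<open>b\<close>.\<close>
  have zW: "z \<in> C n W"
    unfolding z_eq
  proof (rule subgrp_sum[OF C.subgrp[OF W]])
    show "z' i \<in> C n W" if "i \<in> {..<r}" for i
      using z'[of i] C.mono[OF C.V_Op W] le_cover[of i r T] that by (auto simp: W_def)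
  qed
  \<comment> \<open>\<open>z\<close> is put in the augmentation slot.\<close>
  define c where "c s = (if s = [] then z else 0)" for s :: "nat list"
  have c: "c \<in> C.chains n W"
    by (rule C.chainsI) (use zW W in \<open>auto simp: c_def intro!: subgrp_0 C.subgrp C.cap_Op\<close>)
  have face_c: "face_sum r c s = 0" for s
  proof -
    have "face_sum r c s \<in> {0}"
      by (rule face_sum_in_subgrp[OF subgrp_singleton_0]) (auto simp: c_def)
    then show ?thesis by simp
  qed
  have tot_c: "tot_bd r d c s = (if s = [] then d z else 0)" for s
    using additive.zero[OF C.additive] by (simp add: tot_bd_def face_c c_def sgn_pow_def)
  have "tot_bd r d c \<in> C.chains (n - 1) bot"
    by (rule C.chainsI) (use dz in \<open>auto simp: tot_c intro: subgrp_0 C.subgrp C.bot_Op\<close>)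
  \<comment> \<open>Modulo \<open>bot\<close> this reads: at \<open>[]\<close>, \<open>z\<close> is
    the sum of all \<open>b [i]\<close> plus \<open>d (b [])\<close>; at longer tuples the total
    boundary of \<open>b\<close> vanishes.\<close>
  then obtain b where b: "b \<in> C.chains (n + 1) W" and cb: "(\<lambda>s. c s - tot_bd r d b s) \<in> C.chains n bot"
    using C.exact_on_cover[of r] c unfolding C.exact_on_def W_def by auto
  have tot_b: "tot_bd r d b s \<in> C (n - int (length s)) bot" if "set s \<subseteq> {..<r}" "s \<noteq> []" for s
    using C.chainsD[OF cb that(1)] that(2) subgrp_minus[OF C.subgrp[OF C.bot_Op], of "- tot_bd r d b s"]
    by (auto simp: c_def)

  define Top where "Top = glue bot (\<lambda>s. if valid r s then cap T W s else bot)"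
  \<comment> \<open>\<open>b\<close> has total degree \<open>n + 1\<close>, so by the shift in
    \<open>nerve_fam\<close> its restriction to valid tuples has degree
    \<open>n - 1\<close>.\<close>
  define w where "w = glue 0 (\<lambda>s. if valid r s then b s else 0)"
  have slice_Top: "slice Top s = (if valid r s then cap T W s else bot)" for s
    by (simp add: Top_def)
  have slice_w: "slice w s = (if valid r s then b s else 0)" for s
    by (simp add: w_def)
  have Top: "Top \<in> nerve_op r Op"
    using C.cap_Op[OF W] C.bot_Op cap_antimono[of _ _ T W] by (auto simp: nerve_op_def slice_Top valid_def)
    have w_in: "w \<in> nerve_fam r C (n - 1) Top"
    proof (rule nerve_famI)
      show "slice w s \<in> C (n - 1 + 2 - int (length s)) (slice Top s)" if "valid r s" for s
        using C.chainsD[OF b, of s] that by (simp add: slice_w slice_Top valid_def algebra_simps)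
    qed (simp_all add: slice_w w_def)
    have dw: "nerve_bd r d w \<in> nerve_fam r C (n - 2) bot"
    proof (rule nerve_famI)
      fix s assume s: "valid r s"
      have "tot_bd r d (slice w) s = tot_bd r d b s"
        by (rule tot_bd_cong_valid[OF s]) (simp add: slice_w)
      moreover have "tot_bd r d b s \<in> C (n - int (length s)) bot"
        using tot_b[of s] s by (force simp: valid_def)
      ultimately show "slice (nerve_bd r d w) s \<in> C (n - 2 + 2 - int (length s)) (slice bot s)"
        using s by (simp add: slice_nerve_bd)
    qed (simp_all add: slice_nerve_bd)
  have sys': "comparison_system (nerve_op r Op) (nerve_fam r C) (nerve_bd r d) (nerve_fam r F)
      (nerve_bd r e) (nerve_map f) (n - 1)"
    unfolding comparison_system_def
  proof (intro conjI ballI allI flabby_family_nerve[OF C] subgrp_family_nerve[OF F]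
      additive_nerve_map[OF f_add] decomposable_nerve[OF C.subgrp_family_axioms F dec])
    fix P p c assume P: "P \<in> nerve_op r Op" and c: "c \<in> nerve_fam r C p P"
    show "nerve_map f c \<in> nerve_fam r F p P"
    proof (rule nerve_famI)
      show "slice (nerve_map f c) s = 0" if "\<not> valid r s" for s
        by (simp only: slice_nerve_map nerve_famD(3)[OF c that] additive.zero[OF f_add])
    qed (simp_all add: slice_nerve_map f_in[OF nerve_opD[OF P] nerve_famD(2)[OF c]])
    show "nerve_map f (nerve_bd r d c) - nerve_bd r e (nerve_map f c) \<in> nerve_fam r F (p - 1) bot"
    proof (rule nerve_famI)
      fix s assume s: "valid r s"
      have "slice (nerve_map f c) = (\<lambda>s. f (slice c s))" by (simp add: fun_eq_iff slice_nerve_map)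
      then have "slice (nerve_map f (nerve_bd r d c) - nerve_bd r e (nerve_map f c)) s
          = - (tot_bd r e (\<lambda>s. f (slice c s)) s - f (tot_bd r d (slice c) s))"
        using s by (simp add: slice_nerve_map slice_nerve_bd)
      also have "\<dots> = sgn_pow (length s) (f (d (slice c s)) - e (f (slice c s)))"
        by (subst tot_bd_hom[OF f_add]) (simp add: sgn_pow_simps)
      also have "\<dots> \<in> F (p - 1 + 2 - int (length s)) bot"
        using f_bd[OF nerve_opD[OF P] nerve_famD(2)[OF c s]]
        by (intro sgn_pow_in_subgrp[OF F.subgrp[OF F.bot_Op]]) (simp add: algebra_simps)
      finally show "slice (nerve_map f (nerve_bd r d c) - nerve_bd r e (nerve_map f c)) s
          \<in> F (p - 1 + 2 - int (length s)) (slice bot s)" by simp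
    next
      fix s assume s: "\<not> valid r s"
      have "slice (nerve_map f (nerve_bd r d c)) s = 0"
        by (simp only: slice_nerve_map slice_nerve_bd s if_False additive.zero[OF f_add])
      then show "slice (nerve_map f (nerve_bd r d c) - nerve_bd r e (nerve_map f c)) s = 0"
        using s by (simp add: slice_nerve_bd)
    qed simp
  qed
  obtain u' where u': "u' \<in> nerve_fam r F n Top"
    and fu': "nerve_map f w - nerve_bd r e u' \<in> nerve_fam r F (n - 1) bot"
    using IH[OF sys' Top w_in dw] by blast
  let ?u = "slice u'"
  have fu: "f (b s) - tot_bd r e ?u s \<in> F (n + 1 - int (length s)) bot" if s: "valid r s" for s
    using nerve_famD(2)[OF fu' s] s by (simp add: slice_nerve_map slice_nerve_bd slice_w algebra_simps)
  \<comment> \<open>The null-homology on the nerve supplies the correction: \<open>f (b [i])\<close>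
    and \<open>face_sum r ?u [i]\<close> have the same boundary modulo \<open>bot\<close>, so their
    difference is a cycle over \<open>T i\<close>.\<close>
  define q where "q i = f (b [i]) - face_sum r ?u [i]" for i
  have val2: "valid r t" if "length t = Suc (length [i])" "set t \<subseteq> set [i] \<union> {..<r}" "i < r" for i t
    using that by (auto simp: valid_def)
  note F_bot = F.subgrp[OF F.bot_Op]
  have "\<exists>p\<in>F (n + 1) V. q i - e p \<in> F n bot" if i: "i < r" for i
  proof -
    have Ti: "T i \<in> Op" using i by (rule C.V_Op)
    have bi: "b [i] \<in> C n (inf (T i) W)" using C.chainsD[OF b, of "[i]"] i by simp
    have iOp: "inf (T i) W \<in> Op" using Ti W by (rule F.inf_Op)
    have "f (b [i]) \<in> F n (T i)"
      using f_in[OF iOp bi] F.mono[OF iOp Ti] by auto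
    moreover have "face_sum r ?u [i] \<in> F n (T i)"
    proof (rule face_sum_in_subgrp[OF F.subgrp[OF Ti]])
      fix t assume t: "length t = Suc (length [i])" "set [i] \<subseteq> set t" "set t \<subseteq> set [i] \<union> {..<r}"
      have vt: "valid r t" by (rule val2[OF t(1,3) i])
      then have "?u t \<in> F n (cap T W t)" using nerve_famD(2)[OF u' vt] t(1) by (simp add: slice_Top)
      moreover have "cap T W t \<le> T i" using le_cap_iff[of "cap T W t" T W t] t(2) by auto
      ultimately show "?u t \<in> F n (T i)"
        using F.mono[OF C.cap_Op[OF W] Ti] vt by (auto simp: valid_def)
    qed
    ultimately have qF: "q i \<in> F n (T i)" unfolding q_def by (rule subgrp_diff[OF F.subgrp[OF Ti]])
    have 1: "e (f (b [i])) - f (d (b [i])) \<in> F (n - 1) bot"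
      using subgrp_minus[OF F_bot f_bd[OF iOp bi]] by simp
    have "tot_bd r d b [i] \<in> C (n - 1) bot" using tot_b[of "[i]"] i by simp
    then have "f (tot_bd r d b [i]) \<in> F (n - 1) bot" by (rule f_in[OF F.bot_Op])
    then have 2: "f (face_sum r b [i]) - f (d (b [i])) \<in> F (n - 1) bot"
      by (simp add: tot_bd_def sgn_pow_def additive.diff[OF f_add, symmetric] del: face_sum.simps)
    \<comment> \<open>At pairs the sign in \<open>tot_bd\<close> is \<open>+\<close>, so modulo
      \<open>bot\<close> the difference of \<open>f (b t)\<close> and \<open>e (?u t)\<close> is the
      Cech part of the boundary of \<open>?u\<close>, whose own Cech boundary vanishes.\<close>
    have "face_sum r (\<lambda>t. f (b t)) [i] - face_sum r (\<lambda>t. e (?u t)) [i]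
        = face_sum r (\<lambda>t. (f (b t) - tot_bd r e ?u t) + face_sum r ?u t) [i]"
      unfolding face_sum_diff[symmetric] by (rule face_sum_cong) (simp add: tot_bd_def sgn_pow_def)
    also have "\<dots> = face_sum r (\<lambda>t. f (b t) - tot_bd r e ?u t) [i]"
      by (simp only: face_sum_add face_sum_face_sum add_0_right)
    also have "\<dots> \<in> F (n - 1) bot"
    proof (rule face_sum_in_subgrp[OF F_bot])
      fix t assume t: "length t = Suc (length [i])" "set [i] \<subseteq> set t" "set t \<subseteq> set [i] \<union> {..<r}"
      show "f (b t) - tot_bd r e ?u t \<in> F (n - 1) bot"
        using fu[OF val2[OF t(1,3) i]] t(1) by simp
    qed
    finally have 3: "f (face_sum r b [i]) - e (face_sum r ?u [i]) \<in> F (n - 1) bot"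
      by (simp only: face_sum_hom[OF f_add] face_sum_hom[OF F.additive])
    have "e (q i) = (e (f (b [i])) - f (d (b [i]))) - (f (face_sum r b [i]) - f (d (b [i])))
        + (f (face_sum r b [i]) - e (face_sum r ?u [i]))"
      by (simp add: q_def additive.diff[OF F.additive] del: face_sum.simps)
    then have "e (q i) \<in> F (n - 1) bot"
      using subgrp_add[OF F_bot subgrp_diff[OF F_bot 1 2] 3] by simp
    then show ?thesis using T[OF i] qF unfolding small_def by auto
  qed
  then obtain p where p: "\<And>i. i < r \<Longrightarrow> p i \<in> F (n + 1) V" "\<And>i. i < r \<Longrightarrow> q i - e (p i) \<in> F n bot"
    by metis
  have bW: "b [] \<in> C (n + 1) W" using C.chainsD[OF b, of "[]"] by simp
  have "f (z - ((\<Sum>i<r. b [i]) + d (b []))) \<in> F n bot"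
    using C.chainsD[OF cb, of "[]"] f_in[OF F.bot_Op] by (simp add: c_def tot_bd_def sgn_pow_def)
  then have 1: "f z - (\<Sum>i<r. f (b [i])) - f (d (b [])) \<in> F n bot"
    by (simp add: additive.diff[OF f_add] additive.add[OF f_add] additive.sum[OF f_add] algebra_simps)
  have 2: "f (d (b [])) - e (f (b [])) \<in> F n bot"
    using f_bd[OF W bW] by simp
  have "(\<Sum>i<r. q i - e (p i)) \<in> F n bot"
    by (rule subgrp_sum[OF F_bot]) (use p in simp)
  \<comment> \<open>The corrections cancel in total, so the sum of the \<open>q i\<close> equals the
    sum of the \<open>f (b [i])\<close>.\<close>
  moreover have "(\<Sum>i<r. face_sum r ?u [i]) = 0"
    using face_sum_face_sum[of r ?u "[]"] by (simp only: face_sum.simps(1)[of r "face_sum r ?u"])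
  ultimately have 3: "(\<Sum>i<r. f (b [i])) - (\<Sum>i<r. e (p i)) \<in> F n bot"
    by (simp add: q_def sum_subtractf del: face_sum.simps)
  show "\<exists>u\<in>F (n + 1) V. f z - e u \<in> F n bot"
  proof (rule bexI)
    have "(f z - (\<Sum>i<r. f (b [i])) - f (d (b []))) + (f (d (b [])) - e (f (b [])))
        + ((\<Sum>i<r. f (b [i])) - (\<Sum>i<r. e (p i))) \<in> F n bot"
      by (intro subgrp_add[OF F_bot] 1 2 3)
    then show "f z - e ((\<Sum>i<r. p i) + f (b [])) \<in> F n bot"
      by (simp add: additive.add[OF F.additive] additive.sum[OF F.additive] algebra_simps)
    have "f (b []) \<in> F (n + 1) V"
      using f_in[OF W bW] F.mono[OF W V WV] by blast
    then have "(\<Sum>i<r. p i) + f (b []) \<in> F (n + 1) V"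
      by (intro subgrp_add[OF F.subgrp[OF V]] subgrp_sum[OF F.subgrp[OF V]]) (use p in auto)
    then show "(\<Sum>i<r. p i) + f (b []) \<in> F (n + 1) V"
      by (simp add: add.commute)
  qed
qed

text \<open>Writing the degree as \<open>int k - 1\<close> starts the induction in degree
  \<open>-1\<close>, where \<open>0\<close> is the only chain. The families are quantified inside
  the induction, as the nerve replaces all of them while their types stay the same.\<close>

lemma cycles_bound_lists:
  fixes Op :: "(nat list list \<Rightarrow> 'x::{distrib_lattice,bounded_lattice}) set"
    and C :: "int \<Rightarrow> (nat list list \<Rightarrow> 'x) \<Rightarrow> (nat list list \<Rightarrow> 'v::ab_group_add) set"
    and F :: "int \<Rightarrow> (nat list list \<Rightarrow> 'x) \<Rightarrow> (nat list list \<Rightarrow> 'w::ab_group_add) set"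
  assumes "comparison_system Op C d F e f (int k - 1)"
    and "V \<in> Op" "z \<in> C (int k - 1) V" "d z \<in> C (int k - 2) bot"
  shows "\<exists>u\<in>F (int k) V. f z - e u \<in> F (int k - 1) bot"
proof -
  have "\<forall>(Op :: (nat list list \<Rightarrow> 'x) set) (C :: _ \<Rightarrow> _ \<Rightarrow> (nat list list \<Rightarrow> 'v) set) d
      (F :: _ \<Rightarrow> _ \<Rightarrow> (nat list list \<Rightarrow> 'w) set) e f.
      comparison_system Op C d F e f (int k - 1) \<longrightarrow>
      (\<forall>V z. V \<in> Op \<longrightarrow> z \<in> C (int k - 1) V \<longrightarrow> d z \<in> C (int k - 2) bot \<longrightarrow>
        (\<exists>u\<in>F (int k) V. f z - e u \<in> F (int k - 1) bot))"
  proof (induct k)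
    case 0
    show ?case
    proof (intro allI impI)
      fix Op :: "(nat list list \<Rightarrow> 'x) set" and C :: "_ \<Rightarrow> _ \<Rightarrow> (nat list list \<Rightarrow> 'v) set" and d
        and F :: "_ \<Rightarrow> _ \<Rightarrow> (nat list list \<Rightarrow> 'w) set" and e f V z
      assume sys: "comparison_system Op C d F e f (int 0 - 1)" and V: "V \<in> Op" and z: "z \<in> C (int 0 - 1) V"
      interpret C: flabby_family Op C d using sys by (simp add: comparison_system_def)
      interpret F: subgrp_family Op F e using sys by (simp add: comparison_system_def)
      have f: "Modules.additive f" using sys by (simp add: comparison_system_def)
      have "z = 0" using C.neg[of V "-1"] V z by simp
      then show "\<exists>u\<in>F (int 0) V. f z - e u \<in> F (int 0 - 1) bot"
        by (intro bexI[of _ 0])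
          (simp_all add: additive.zero[OF F.additive] additive.zero[OF f] subgrp_0 F.subgrp F.bot_Op V)
    qed
  next
    case (Suc k)
    show ?case
    proof (intro allI impI)
      fix Op :: "(nat list list \<Rightarrow> 'x) set" and C :: "_ \<Rightarrow> _ \<Rightarrow> (nat list list \<Rightarrow> 'v) set" and d
        and F :: "_ \<Rightarrow> _ \<Rightarrow> (nat list list \<Rightarrow> 'w) set" and e f V z
      assume "comparison_system Op C d F e f (int (Suc k) - 1)" "V \<in> Op" "z \<in> C (int (Suc k) - 1) V"
        "d z \<in> C (int (Suc k) - 2) bot"
      then show "\<exists>u\<in>F (int (Suc k)) V. f z - e u \<in> F (int (Suc k) - 1) bot"
        using cycles_bound_step[of Op C d F e f "int k" V z] Suc[rule_format] by (simp add: add.commute)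
    qed
  qed
  then show ?thesis using assms by blast
qed

section \<open>Transfer to arbitrary lattices and groups\<close>

text \<open>A copy of \<open>'x\<close> among functions on lists, concentrated at the empty list. It
  moves a given system into the types that the nerve construction reproduces.\<close>

definition emb :: "'x \<Rightarrow> 'x \<Rightarrow> 'i list \<Rightarrow> 'x" where
  "emb x0 x l = (if l = [] then x else x0)"

lemma emb_simps [simp]: "emb x0 x [] = x" "l \<noteq> [] \<Longrightarrow> emb x0 x l = x0"
  by (simp_all add: emb_def)

definition emb_fam ::
    "(int \<Rightarrow> 'x \<Rightarrow> 'v set) \<Rightarrow> int \<Rightarrow> ('i list \<Rightarrow> 'x) \<Rightarrow> ('i list \<Rightarrow> 'v::ab_group_add) set" where
  "emb_fam F p P = emb 0 ` F p (P [])"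

lemma emb_0: "emb 0 0 = (0 :: 'i list \<Rightarrow> 'v::ab_group_add)"
  by (simp add: emb_def fun_eq_iff)

lemma emb_add: "emb 0 (x + y) = (emb 0 x + emb 0 y :: 'i list \<Rightarrow> 'v::ab_group_add)"
  by (simp add: emb_def fun_eq_iff)

lemma emb_diff: "emb 0 (x - y) = (emb 0 x - emb 0 y :: 'i list \<Rightarrow> 'v::ab_group_add)"
  by (simp add: emb_def fun_eq_iff)

lemma additive_emb: "Modules.additive (emb 0 :: 'v::ab_group_add \<Rightarrow> 'i list \<Rightarrow> 'v)"
  by unfold_locales (rule emb_add)

lemma emb_inj: "emb x0 x = emb x0 y \<longleftrightarrow> x = y"
  by (metis emb_simps(1))

lemma emb_in_emb_fam [simp]: "emb 0 x \<in> emb_fam F p P \<longleftrightarrow> x \<in> F p (P [])"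
  by (auto simp: emb_fam_def emb_inj)

lemma emb_famE:
  assumes "v \<in> emb_fam F p P"
  obtains x where "v = emb 0 x" "x \<in> F p (P [])"
  using assms by (auto simp: emb_fam_def)

definition pointwise :: "('v \<Rightarrow> 'w) \<Rightarrow> ('i list \<Rightarrow> 'v) \<Rightarrow> 'i list \<Rightarrow> 'w" where
  "pointwise f v = (\<lambda>l. f (v l))"

lemma pointwise_emb:
  "Modules.additive f \<Longrightarrow> pointwise f (emb 0 x) = emb 0 (f x)"
  by (auto simp: pointwise_def emb_def additive.zero)

lemma additive_pointwise:
  assumes "Modules.additive f"
  shows "Modules.additive (pointwise f)"
  by unfold_locales (simp add: pointwise_def fun_eq_iff additive.add[OF assms])



lemma subgrp_family_emb:
  fixes Op :: "'x::{distrib_lattice,bounded_lattice} set"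
  assumes "subgrp_family Op F d"
  shows "subgrp_family (emb bot ` Op) (emb_fam F) (pointwise d :: ('i list \<Rightarrow> 'v::ab_group_add) \<Rightarrow> _)"
proof -
  interpret subgrp_family Op F d by fact
  show ?thesis
  proof (rule subgrp_family.intro)
    have "(bot :: 'i list \<Rightarrow> 'x) = emb bot bot" by (simp add: emb_def fun_eq_iff)
    then show "(bot :: 'i list \<Rightarrow> 'x) \<in> emb bot ` Op" using bot_Op by blast
    have "sup (emb bot U) (emb bot V) = (emb bot (sup U V) :: 'i list \<Rightarrow> 'x)"
      "inf (emb bot U) (emb bot V) = (emb bot (inf U V) :: 'i list \<Rightarrow> 'x)" for U V
      by (simp_all add: emb_def fun_eq_iff)
    then show "sup P Q \<in> emb bot ` Op" "inf P Q \<in> emb bot ` Op"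
      if "P \<in> emb bot ` Op" "Q \<in> emb bot ` Op" for P Q :: "'i list \<Rightarrow> 'x"
      using that sup_Op inf_Op by auto
    show "Modules.additive (pointwise d)" by (rule additive_pointwise[OF additive])
  next
    fix P :: "'i list \<Rightarrow> 'x" and p assume "P \<in> emb bot ` Op"
    then have P: "P [] \<in> Op" by auto
    have "x - y \<in> emb_fam F p P" if "x \<in> emb_fam F p P" "y \<in> emb_fam F p P" for x y
      using that by (elim emb_famE) (simp add: emb_diff[symmetric] subgrp_diff[OF subgrp[OF P]])
    moreover have "(0 :: 'i list \<Rightarrow> 'v) \<in> emb_fam F p P"
      unfolding emb_0[symmetric] emb_in_emb_fam by (rule subgrp_0[OF subgrp[OF P]])
    ultimately show "subgrp (emb_fam F p P :: ('i list \<Rightarrow> 'v) set)"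
      unfolding subgrp_def by blast
    show "emb_fam F p P = {0 :: 'i list \<Rightarrow> 'v}" if "p < 0"
      by (simp add: emb_fam_def neg[OF P that] emb_0)
    fix x assume "x \<in> emb_fam F p P"
    then obtain y where y: "x = emb 0 y" "y \<in> F p (P [])" by (rule emb_famE)
    show "pointwise d x \<in> emb_fam F (p - 1) P"
      by (simp add: y(1) pointwise_emb[OF additive] bd[OF P y(2)])
    show "pointwise d (pointwise d x) \<in> emb_fam F (p - 2) bot"
      by (simp add: y(1) pointwise_emb[OF additive] bd_bd[OF P y(2)])
  next
    fix P Q :: "'i list \<Rightarrow> 'x" and p assume PQ: "P \<in> emb bot ` Op" "Q \<in> emb bot ` Op" "P \<le> Q"
    then have "F p (P []) \<subseteq> F p (Q [])" by (intro mono) (auto simp: le_fun_def)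
    then show "emb_fam F p P \<subseteq> (emb_fam F p Q :: ('i list \<Rightarrow> 'v) set)"
      by (auto simp: emb_fam_def)
  qed
qed

lemma flabby_family_emb:
  fixes Op :: "'x::{distrib_lattice,bounded_lattice} set"
  assumes "flabby_family Op C d"
  shows "flabby_family (emb bot ` Op) (emb_fam C) (pointwise d :: ('i list \<Rightarrow> 'v::ab_group_add) \<Rightarrow> _)"
proof -
  interpret flabby_family Op C d by fact
  interpret E: subgrp_family "emb bot ` Op" "emb_fam C" "pointwise d :: ('i list \<Rightarrow> 'v) \<Rightarrow> _"
    by (rule subgrp_family_emb[OF subgrp_family_axioms])
  show ?thesis
  proof
    fix P Q :: "'i list \<Rightarrow> 'x" and x p assume "P \<in> emb bot ` Op" "Q \<in> emb bot ` Op"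
    then have PQ: "P [] \<in> Op" "Q [] \<in> Op" by auto
    show "\<exists>y\<in>emb_fam C p P. \<exists>z\<in>emb_fam C p Q. x = y + z" if x: "x \<in> emb_fam C p (sup P Q)"
    proof -
      obtain x' where x': "x = emb 0 x'" "x' \<in> C p (sup (P []) (Q []))"
        using x by (elim emb_famE) auto
      then obtain y z where "y \<in> C p (P [])" "z \<in> C p (Q [])" "x' = y + z"
        using sup[OF PQ] by blast
      then show ?thesis
        by (intro bexI[of _ "emb 0 y"] bexI[of _ "emb 0 z"]) (simp_all add: x'(1) emb_add)
    qed
    show "x \<in> emb_fam C p (inf P Q)" if "x \<in> emb_fam C p P" "x \<in> emb_fam C p Q"
      using that inf[OF PQ] by (auto simp: emb_inj elim!: emb_famE)
  qed
qed

text \<open>All data are transported along \<open>emb\<close>, and the bounding chain is read off at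
  the empty list.\<close>

theorem cycles_bound:
  fixes Op :: "'x::{distrib_lattice,bounded_lattice} set"
    and C :: "int \<Rightarrow> 'x \<Rightarrow> 'v::ab_group_add set" and F :: "int \<Rightarrow> 'x \<Rightarrow> 'w::ab_group_add set"
  assumes sys: "comparison_system Op C d F e f (int k - 1)"
    and V: "V \<in> Op" and z: "z \<in> C (int k - 1) V" and dz: "d z \<in> C (int k - 2) bot"
  shows "\<exists>u\<in>F (int k) V. f z - e u \<in> F (int k - 1) bot"
proof -
  let ?Op = "emb bot ` Op :: (nat list list \<Rightarrow> 'x) set"
  have C: "flabby_family Op C d" and F: "subgrp_family Op F e" and f: "Modules.additive f"
    and dec: "decomposable Op C F e (int k - 1)"
    and f_in: "\<And>V p c. V \<in> Op \<Longrightarrow> c \<in> C p V \<Longrightarrow> f c \<in> F p V"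
    and f_bd: "\<And>V p c. V \<in> Op \<Longrightarrow> c \<in> C p V \<Longrightarrow> f (d c) - e (f c) \<in> F (p - 1) bot"
    using sys by (auto simp: comparison_system_def)
  interpret C: flabby_family Op C d by fact
  interpret F: subgrp_family Op F e by fact
  note pw = pointwise_emb[OF C.additive] pointwise_emb[OF F.additive] pointwise_emb[OF f]
  have small_emb: "small ?Op (emb_fam F) (pointwise e) N (emb bot T) (emb bot V)"
    if T: "small Op F e N T V" for N T V
    unfolding small_def
  proof (intro conjI allI impI ballI)
    show "emb bot T \<in> ?Op" "emb bot T \<le> (emb bot V :: nat list list \<Rightarrow> 'x)"
      using T by (auto simp: small_def emb_def le_fun_def)
    fix q g assume q: "q \<le> N" and g: "g \<in> emb_fam F q (emb bot T :: nat list list \<Rightarrow> 'x)"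
      and eg: "pointwise e g \<in> emb_fam F (q - 1) bot"
    obtain g' where g': "g = emb 0 g'" "g' \<in> F q T" using g by (auto elim: emb_famE)
    then have "e g' \<in> F (q - 1) bot" using eg by (simp add: pw)
    then obtain u where "u \<in> F (q + 1) V" "g' - e u \<in> F q bot"
      using T q g'(2) unfolding small_def by blast
    then show "\<exists>u\<in>emb_fam F (q + 1) (emb bot V). g - pointwise e u \<in> emb_fam F q bot"
      by (intro bexI[of _ "emb 0 u"]) (simp_all add: g'(1) pw emb_diff[symmetric])
  qed
  have "comparison_system ?Op (emb_fam C) (pointwise d) (emb_fam F) (pointwise e) (pointwise f) (int k - 1)"
    unfolding comparison_system_def decomposable_def
  proof (intro conjI flabby_family_emb[OF C] subgrp_family_emb[OF F] additive_pointwise[OF f] ballI allI)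
    fix P p c assume "P \<in> ?Op" and "c \<in> emb_fam C p P"
    then obtain V c' where P: "P = emb bot V" and V: "V \<in> Op" and c: "c = emb 0 c'" and c': "c' \<in> C p V"
      by (auto elim!: emb_famE)
    show "pointwise f c \<in> emb_fam F p P"
      using f_in[OF V c'] by (simp add: c pw P)
    show "pointwise f (pointwise d c) - pointwise e (pointwise f c) \<in> emb_fam F (p - 1) bot"
      using f_bd[OF V c'] by (simp add: c pw P emb_diff[symmetric])
    have "c' \<in> sums_of (\<Union>T\<in>{T. small Op F e (int k - 1) T V}. C p T)"
      using dec V c' by (simp add: decomposable_def)
    then show "c \<in> sums_of (\<Union>T\<in>{T. small ?Op (emb_fam F) (pointwise e) (int k - 1) T P}. emb_fam C p T)"
      unfolding c P
      by (rule sums_of_image[OF additive_emb, rotated]) (use small_emb in force)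
  qed
  moreover have "emb bot V \<in> ?Op" using V by simp
  moreover have "emb 0 z \<in> emb_fam C (int k - 1) (emb bot V :: nat list list \<Rightarrow> 'x)" using z by simp
  moreover have "pointwise d (emb 0 z) \<in> emb_fam C (int k - 2) (bot :: nat list list \<Rightarrow> 'x)"
    using dz by (simp add: pw)
  ultimately obtain u where u: "u \<in> emb_fam F (int k) (emb bot V :: nat list list \<Rightarrow> 'x)"
    and fu: "pointwise f (emb 0 z) - pointwise e u \<in> emb_fam F (int k - 1) bot"
    using cycles_bound_lists by blast
  obtain u' where "u = emb 0 u'" "u' \<in> F (int k) V" using u by (auto elim: emb_famE)
  then show ?thesis using fu by (auto simp: pw emb_diff[symmetric])
qed

subsection \<open>Abelian groups as quotients of subgroups of formal sums\<close>

text \<open>To apply the results on types of class \<^class>\<open>ab_group_add\<close>, a group \<open>G\<close> is replaced by the formal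
  sums of its elements and a subgroup \<open>S\<close> by its preimage \<open>lift G S\<close> under evaluation; the
  preimage of the trivial subgroup then plays the role of zero.\<close>

definition ev :: "'g monoid \<Rightarrow> ('g \<Rightarrow>\<^sub>0 int) \<Rightarrow> 'g" where
  "ev G = (SOME h. h \<in> hom (free_Abelian_group (carrier G)) G \<and> (\<forall>x\<in>carrier G. h (frag_of x) = x))"

lemma ev:
  assumes "comm_group G"
  shows "ev G \<in> hom (free_Abelian_group (carrier G)) G" "x \<in> carrier G \<Longrightarrow> ev G (frag_of x) = x"
proof -
  obtain h where "h \<in> hom (free_Abelian_group (carrier G)) G" "\<And>x. x \<in> carrier G \<Longrightarrow> h (frag_of x) = x"
    using comm_group.free_Abelian_group_universal[OF assms, of "\<lambda>x. x" "carrier G"] by auto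
  then have "\<exists>h. h \<in> hom (free_Abelian_group (carrier G)) G \<and> (\<forall>x\<in>carrier G. h (frag_of x) = x)"
    by blast
  then have "ev G \<in> hom (free_Abelian_group (carrier G)) G \<and> (\<forall>x\<in>carrier G. ev G (frag_of x) = x)"
    unfolding ev_def by (rule someI_ex)
  then show "ev G \<in> hom (free_Abelian_group (carrier G)) G" "x \<in> carrier G \<Longrightarrow> ev G (frag_of x) = x"
    by auto
qed

definition lift :: "'g monoid \<Rightarrow> 'g set \<Rightarrow> ('g \<Rightarrow>\<^sub>0 int) set" where
  "lift G S = {a. Poly_Mapping.keys a \<subseteq> carrier G \<and> ev G a \<in> S}"

definition push :: "('g \<Rightarrow> 'h) \<Rightarrow> ('g \<Rightarrow>\<^sub>0 int) \<Rightarrow> 'h \<Rightarrow>\<^sub>0 int" where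
  "push h = frag_extend (frag_of \<circ> h)"

text \<open>Additive on all formal sums for any function \<open>h\<close>; that \<open>h\<close> is
  a homomorphism matters only for compatibility with evaluation.\<close>

lemma additive_push: "Modules.additive (push h)"
  by unfold_locales (simp add: push_def frag_extend_add)

context
  fixes G :: "'g monoid"
  assumes G: "comm_group G"
begin

interpretation G: comm_group G by (rule G)

lemma ev_closed: "Poly_Mapping.keys a \<subseteq> carrier G \<Longrightarrow> ev G a \<in> carrier G"
  using hom_in_carrier[OF ev(1)[OF G]] by simp

lemma ev_diff:
  assumes "Poly_Mapping.keys a \<subseteq> carrier G" "Poly_Mapping.keys b \<subseteq> carrier G"
  shows "ev G (a - b) = ev G a \<otimes>\<^bsub>G\<^esub> inv\<^bsub>G\<^esub> ev G b"
proof -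
  interpret h: group_hom "free_Abelian_group (carrier G)" G "ev G"
    by (simp add: group_hom_def group_hom_axioms_def ev(1)[OF G] G.is_group)
  have "ev G (a + (- b)) = ev G a \<otimes>\<^bsub>G\<^esub> ev G (- b)"
    using h.hom_mult[of a "- b"] assms by simp
  also have "ev G (- b) = inv\<^bsub>G\<^esub> ev G b"
    using h.hom_inv[of b] assms by simp
  finally show ?thesis by simp
qed

lemma ev_0: "ev G 0 = \<one>\<^bsub>G\<^esub>"
  using hom_one[OF ev(1)[OF G]] by (simp add: G.is_group)

lemma subgrp_lift:
  assumes "subgroup S G"
  shows "subgrp (lift G S)"
proof -
  interpret S: subgroup S G by fact
  have "a - b \<in> lift G S" if "a \<in> lift G S" "b \<in> lift G S" for a b
    using that ev_diff[of a b] keys_diff[of a b] unfolding lift_def by auto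
  moreover have "0 \<in> lift G S" by (simp add: lift_def ev_0)
  ultimately show ?thesis by (simp add: subgrp_def)
qed

lemma frag_of_in_lift: "x \<in> S \<Longrightarrow> x \<in> carrier G \<Longrightarrow> frag_of x \<in> lift G S"
  by (simp add: lift_def ev(2)[OF G])

text \<open>The dictionary for identities modulo \<open>bot\<close>: they are equalities in
  \<open>G\<close> after evaluation.\<close>

lemma diff_in_lift_one_iff:
  assumes "Poly_Mapping.keys a \<subseteq> carrier G" "Poly_Mapping.keys b \<subseteq> carrier G"
  shows "a - b \<in> lift G {\<one>\<^bsub>G\<^esub>} \<longleftrightarrow> ev G a = ev G b"
proof -
  have "Poly_Mapping.keys (a - b) \<subseteq> carrier G" using assms keys_diff[of a b] by blast
  then show ?thesis
    using assms by (simp add: lift_def ev_diff ev_closed G.inv_solve_right' G.r_one)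
qed

end

lemma push_hom:
  assumes G: "comm_group G" and H: "comm_group H" and h: "h \<in> hom G H"
    and a: "Poly_Mapping.keys a \<subseteq> carrier G"
  shows "Poly_Mapping.keys (push h a) \<subseteq> carrier H" "ev H (push h a) = h (ev G a)"
proof -
  interpret h: group_hom G H h
    using G H h by (simp add: group_hom_def group_hom_axioms_def comm_group.axioms(2))
  have "Poly_Mapping.keys (push h a) \<subseteq> carrier H \<and> ev H (push h a) = h (ev G a)"
  proof (rule free_Abelian_group_induct[OF a])
    show "Poly_Mapping.keys (push h 0) \<subseteq> carrier H \<and> ev H (push h 0) = h (ev G 0)"
      by (simp add: push_def ev_0[OF G] ev_0[OF H])
  next
    fix x y
    assume xy: "Poly_Mapping.keys x \<subseteq> carrier G" "Poly_Mapping.keys y \<subseteq> carrier G"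
      "Poly_Mapping.keys (push h x) \<subseteq> carrier H \<and> ev H (push h x) = h (ev G x)"
      "Poly_Mapping.keys (push h y) \<subseteq> carrier H \<and> ev H (push h y) = h (ev G y)"
    have "Poly_Mapping.keys (push h x - push h y) \<subseteq> carrier H"
      using xy keys_diff[of "push h x" "push h y"] by blast
    then show "Poly_Mapping.keys (push h (x - y)) \<subseteq> carrier H \<and> ev H (push h (x - y)) = h (ev G (x - y))"
      using xy
      by (simp add: push_def frag_extend_diff ev_diff[OF G] ev_diff[OF H] ev_closed[OF G])
  next
    show "Poly_Mapping.keys (push h (frag_of x)) \<subseteq> carrier H \<and> ev H (push h (frag_of x)) = h (ev G (frag_of x))"
      if "x \<in> carrier G" for x
      using that by (simp add: push_def ev(2)[OF H] ev(2)[OF G])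
  qed
  then show "Poly_Mapping.keys (push h a) \<subseteq> carrier H" "ev H (push h a) = h (ev G a)" by auto
qed

lemma lift_mono: "S \<subseteq> T \<Longrightarrow> lift G S \<subseteq> lift G T"
  by (auto simp: lift_def)


subsection \<open>Flabby cosheaves as families of subgroups\<close>

lemma (in comm_monoid) finprod_pair:
  "a \<noteq> b \<Longrightarrow> f a \<in> carrier G \<Longrightarrow> f b \<in> carrier G \<Longrightarrow> finprod G f {a, b} = f a \<otimes> f b"
  by simp

text \<open>\<open>gfinprod\<close> is a product over the nontrivial factors, or the unit if these
  are infinitely many, so \<open>A\<close> may be infinite.\<close>

lemma (in comm_group) gfinprod_in_subgroup:
  assumes H: "subgroup H G" and f: "f \<in> A \<rightarrow> H"
  shows "gfinprod G f A \<in> H"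
proof -
  interpret H: subgroup H G by fact
  have "finite B \<Longrightarrow> B \<subseteq> A \<Longrightarrow> finprod G f B \<in> H" for B
  proof (induction B rule: finite_induct)
    case (insert x F)
    then have "f \<in> F \<rightarrow> carrier G" "f x \<in> H" "f x \<in> carrier G" using f H.subset by auto
    then show ?case using insert by simp
  qed simp
  then show ?thesis unfolding gfinprod_def by auto
qed

text \<open>Sections over \<open>V\<close> seen inside the global sections; for flabby
  \<open>A\<close> this is a faithful copy.\<close>

definition image_in :: "'a topology \<Rightarrow> ('a, 'g) precosh \<Rightarrow> 'a set \<Rightarrow> 'g set" where
  "image_in X A V = ext A (topspace X) V ` carrier (sec A V)"

locale flabby_cosheaf =
  fixes X :: "'a topology" and A :: "('a, 'g) precosh"
  assumes cosheaf: "cosheaf X A" and flabby: "flabby X A"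
begin

abbreviation "E \<equiv> topspace X"

lemma precosheaf: "precosheaf X A"
  using cosheaf by (simp add: cosheaf_def)

lemma comm_group: "openin X U \<Longrightarrow> comm_group (sec A U)"
  and ext_hom: "openin X U \<Longrightarrow> openin X V \<Longrightarrow> U \<subseteq> V \<Longrightarrow> ext A V U \<in> hom (sec A U) (sec A V)"
  and ext_ext: "openin X U \<Longrightarrow> openin X V \<Longrightarrow> openin X W \<Longrightarrow> U \<subseteq> V \<Longrightarrow> V \<subseteq> W \<Longrightarrow>
    x \<in> carrier (sec A U) \<Longrightarrow> ext A W V (ext A V U x) = ext A W U x"
  and empty: "trivial_group (sec A {})"
  using precosheaf by (simp_all add: precosheaf_def)

lemma sec_group: "openin X U \<Longrightarrow> group (sec A U)"
  by (rule comm_group.axioms(2)[OF comm_group])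

lemma ext_inj: "openin X U \<Longrightarrow> openin X V \<Longrightarrow> U \<subseteq> V \<Longrightarrow> inj_on (ext A V U) (carrier (sec A U))"
  using flabby by (simp add: flabby_def)

lemma ext_closed: "openin X U \<Longrightarrow> openin X V \<Longrightarrow> U \<subseteq> V \<Longrightarrow> x \<in> carrier (sec A U) \<Longrightarrow>
    ext A V U x \<in> carrier (sec A V)"
  using hom_in_carrier[OF ext_hom] .

lemma subgroup_image: "openin X U \<Longrightarrow> openin X V \<Longrightarrow> U \<subseteq> V \<Longrightarrow>
    subgroup (ext A V U ` carrier (sec A U)) (sec A V)"
  using group_hom.img_is_subgroup[of "sec A U" "sec A V" "ext A V U"] sec_group ext_hom
  by (simp add: group_hom_def group_hom_axioms_def)

lemma openE [simp]: "openin X E"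
  by simp

lemma subset_E: "openin X U \<Longrightarrow> U \<subseteq> E"
  by (rule openin_subset)

lemma subgroup_image_in: "openin X V \<Longrightarrow> subgroup (image_in X A V) (sec A E)"
  unfolding image_in_def by (rule subgroup_image) (auto simp: subset_E)

lemma image_in_mono:
  assumes "openin X U" "openin X V" "U \<subseteq> V"
  shows "image_in X A U \<subseteq> image_in X A V"
proof
  fix y assume "y \<in> image_in X A U"
  then obtain x where x: "x \<in> carrier (sec A U)" "y = ext A E U x" by (auto simp: image_in_def)
  then have "y = ext A E V (ext A V U x)"
    using ext_ext[OF assms(1,2) openE assms(3) subset_E[OF assms(2)]] by simp
  then show "y \<in> image_in X A V"
    using ext_closed[OF assms x(1)] by (auto simp: image_in_def)
qed

lemma image_in_empty: "image_in X A {} = {\<one>\<^bsub>sec A E\<^esub>}"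
proof -
  have "carrier (sec A {}) = {\<one>\<^bsub>sec A {}\<^esub>}" using empty by (simp add: trivial_group_def)
  then show ?thesis
    using hom_one[OF ext_hom[of "{}" E]] sec_group[of "{}"] sec_group[of E]
    by (simp add: image_in_def)
qed

text \<open>The open sets index themselves. A family \<open>{V, W}\<close> with \<open>V = W\<close>
  then collapses to one member, whence the case distinctions in \<open>image_in_Un\<close> and
  \<open>image_in_Int\<close>.\<close>

lemma exact:
  assumes "\<And>T. T \<in> I \<Longrightarrow> openin X T"
  shows "cosheaf_exact A I (\<lambda>T. T)"
proof -
  have "\<forall>(I :: 'a set set) (U :: 'a set \<Rightarrow> 'a set). (\<forall>\<alpha>\<in>I. openin X (U \<alpha>)) \<longrightarrow> cosheaf_exact A I U"
    using cosheaf by (simp add: cosheaf_def)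
  then show ?thesis using assms by (elim allE[of _ I] allE[of _ "\<lambda>T. T"]) simp
qed

lemma decompose:
  assumes T: "\<And>T. T \<in> \<T> \<Longrightarrow> openin X T" and y: "y \<in> carrier (sec A (\<Union>\<T>))"
  shows "\<exists>x. (\<forall>T\<in>\<T>. x T \<in> carrier (sec A T)) \<and> finite {T \<in> \<T>. x T \<noteq> \<one>\<^bsub>sec A T\<^esub>} \<and>
    y = gfinprod (sec A (\<Union>\<T>)) (\<lambda>T. ext A (\<Union>\<T>) T (x T)) \<T>"
proof -
  have ex: "cosheaf_exact A \<T> (\<lambda>T. T)"
    by (rule exact) (rule T)
  then have "y \<in> cosheaf_eps A \<T> (\<lambda>T. T) ` carrier (dsum A \<T> (\<lambda>T. T))"
    using y unfolding cosheaf_exact_def by simp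
  then obtain x where x: "x \<in> carrier (dsum A \<T> (\<lambda>T. T))" and yx: "y = cosheaf_eps A \<T> (\<lambda>T. T) x"
    by blast
  have "carrier (dsum A \<T> (\<lambda>T. T)) = {x \<in> \<Pi>\<^sub>E i\<in>\<T>. carrier (sec A i). finite {i \<in> \<T>. x i \<noteq> \<one>\<^bsub>sec A i\<^esub>}}"
    unfolding dsum_def by (rule carrier_sum_group) (rule sec_group[OF T])
  then show ?thesis using x yx by (intro exI[of _ x]) (auto simp: cosheaf_eps_def)
qed

text \<open>\<open>cosheaf_eps\<close> is onto, and elements of the direct sum have finite support;
  the members in the support are the wanted \<open>J\<close>.\<close>

lemma image_in_directed:
  assumes T: "\<And>T. T \<in> \<T> \<Longrightarrow> openin X T" and y: "y \<in> image_in X A (\<Union>\<T>)"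
  shows "\<exists>J\<subseteq>\<T>. finite J \<and> y \<in> image_in X A (\<Union>J)"
proof -
  let ?U = "\<Union>\<T>"
  have U: "openin X ?U" by (rule openin_Union) (rule T)
  obtain y' where y': "y' \<in> carrier (sec A ?U)" and yy': "y = ext A E ?U y'"
    using y by (auto simp: image_in_def)
  obtain x where x: "\<And>T. T \<in> \<T> \<Longrightarrow> x T \<in> carrier (sec A T)" and fin: "finite {T \<in> \<T>. x T \<noteq> \<one>\<^bsub>sec A T\<^esub>}"
    and y'x: "y' = gfinprod (sec A ?U) (\<lambda>T. ext A ?U T (x T)) \<T>"
    using decompose[OF T y'] by blast
  define J where "J = {T \<in> \<T>. x T \<noteq> \<one>\<^bsub>sec A T\<^esub>}"
  have J: "openin X (\<Union>J)" by (rule openin_Union) (use T in \<open>simp add: J_def\<close>)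
  interpret U: comm_group "sec A ?U" by (rule comm_group[OF U])
  have JU: "\<Union>J \<subseteq> ?U" by (auto simp: J_def)
  have sub: "subgroup (ext A ?U (\<Union>J) ` carrier (sec A (\<Union>J))) (sec A ?U)"
    by (rule subgroup_image[OF J U JU])
  have "ext A ?U T (x T) \<in> ext A ?U (\<Union>J) ` carrier (sec A (\<Union>J))" if t: "T \<in> \<T>" for T
  proof (cases "T \<in> J")
    case True
    then have "T \<subseteq> \<Union>J" by blast
    then show ?thesis
      using ext_ext[OF T[OF t] J U _ JU x[OF t]] ext_closed[OF T[OF t] J _ x[OF t]] by (metis imageI)
  next
    case False
    then have "x T = \<one>\<^bsub>sec A T\<^esub>" using t by (simp add: J_def)
    moreover have "ext A ?U T \<one>\<^bsub>sec A T\<^esub> = \<one>\<^bsub>sec A ?U\<^esub>"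
      using t by (intro hom_one[OF ext_hom] sec_group T U) auto
    ultimately show ?thesis using subgroup.one_closed[OF sub] by simp
  qed
  then have "y' \<in> ext A ?U (\<Union>J) ` carrier (sec A (\<Union>J))"
    unfolding y'x by (intro U.gfinprod_in_subgroup[OF sub]) auto
  then have "y \<in> image_in X A (\<Union>J)"
    using ext_ext[OF J U openE JU subset_E[OF U]] by (auto simp: yy' image_in_def)
  then show ?thesis using fin by (intro exI[of _ J]) (auto simp: J_def)
qed

lemma image_in_Un:
  assumes V: "openin X V" and W: "openin X W" and y: "y \<in> image_in X A (V \<union> W)"
  shows "\<exists>v\<in>image_in X A V. \<exists>w\<in>image_in X A W. y = v \<otimes>\<^bsub>sec A E\<^esub> w"
proof (cases "V = W")
  case True
  interpret E: comm_group "sec A E" by (rule comm_group) simp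
  show ?thesis
    using y True subgroup.one_closed[OF subgroup_image_in[OF W]] subgroup.mem_carrier[OF subgroup_image_in[OF V]]
    by (intro bexI[of _ y] bexI[of _ "\<one>\<^bsub>sec A E\<^esub>"]) auto
next
  case False
  let ?U = "\<Union>{V, W}"
  have U: "openin X ?U" using V W by auto
  interpret U: comm_group "sec A ?U" by (rule comm_group[OF U])
  obtain y' where y': "y' \<in> carrier (sec A ?U)" and yy': "y = ext A E ?U y'"
    using y by (auto simp: image_in_def)
  have T: "\<And>T. T \<in> {V, W} \<Longrightarrow> openin X T" using V W by auto
  obtain x where x: "\<And>T. T \<in> {V, W} \<Longrightarrow> x T \<in> carrier (sec A T)"
    and y'x: "y' = gfinprod (sec A ?U) (\<lambda>T. ext A ?U T (x T)) {V, W}"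
    using decompose[OF T y'] by blast
  have c: "ext A ?U V (x V) \<in> carrier (sec A ?U)" "ext A ?U W (x W) \<in> carrier (sec A ?U)"
    using x by (auto intro!: ext_closed V W U)
  have "y' = ext A ?U V (x V) \<otimes>\<^bsub>sec A ?U\<^esub> ext A ?U W (x W)"
  proof -
    have "y' = finprod (sec A ?U) (\<lambda>T. ext A ?U T (x T)) {V, W}"
      unfolding y'x using c by (intro U.gfinprod_eq_finprod) simp_all
    also have "\<dots> = ext A ?U V (x V) \<otimes>\<^bsub>sec A ?U\<^esub> ext A ?U W (x W)"
      by (rule U.finprod_pair[OF False c])
    finally show ?thesis .
  qed
  then have "y = ext A E ?U (ext A ?U V (x V)) \<otimes>\<^bsub>sec A E\<^esub> ext A E ?U (ext A ?U W (x W))"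
    unfolding yy' using hom_mult[OF ext_hom[OF U openE subset_E[OF U]] c] by simp
  also have "ext A E ?U (ext A ?U V (x V)) = ext A E V (x V)"
    using x by (intro ext_ext V U) (auto intro: subset_E[OF U, THEN subsetD])
  also have "ext A E ?U (ext A ?U W (x W)) = ext A E W (x W)"
    using x by (intro ext_ext W U) (auto intro: subset_E[OF U, THEN subsetD])
  finally show ?thesis using x by (auto simp: image_in_def)
qed

text \<open>By flabbiness the representatives \<open>a\<close> and \<open>b\<close> of
  \<open>y\<close> agree already over the union, so \<open>a\<close> paired with the inverse of
  \<open>b\<close> is in the kernel of \<open>cosheaf_eps\<close>, hence a value of
  \<open>cosheaf_Phi\<close>. Its \<open>V\<close> component comes from \<open>V \<inter> W\<close>:
  diagonal terms cancel, off-diagonal ones are extended from there.\<close>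

lemma image_in_Int:
  assumes V: "openin X V" and W: "openin X W" and y: "y \<in> image_in X A V" "y \<in> image_in X A W"
  shows "y \<in> image_in X A (V \<inter> W)"
proof (cases "V = W")
  case True
  then show ?thesis using y by simp
next
  case False
  define I where "I = {V, W}"
  let ?U = "\<Union>I" and ?id = "\<lambda>T :: 'a set. T" and ?S = "ext A V (V \<inter> W) ` carrier (sec A (V \<inter> W))"
  let ?D = "dsum A I ?id"
  have I: "openin X T" if "T \<in> I" for T using that V W by (auto simp: I_def)
  then have U: "openin X ?U" by (rule openin_Union)
  have VW: "openin X (V \<inter> W)" using V W by auto
  interpret U: comm_group "sec A ?U" by (rule comm_group[OF U])
  interpret W: comm_group "sec A W" by (rule comm_group[OF W])
  interpret V: comm_group "sec A V" by (rule comm_group[OF V])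
  have grp: "group (sec A T)" if "T \<in> I" for T
    by (rule sec_group[OF I[OF that]])
  have carD: "carrier ?D = {x \<in> \<Pi>\<^sub>E i\<in>I. carrier (sec A i). finite {i \<in> I. x i \<noteq> \<one>\<^bsub>sec A i\<^esub>}}"
    unfolding dsum_def using grp by (rule carrier_sum_group)
  have finI: "finite I" by (simp add: I_def)
  obtain a b where a: "a \<in> carrier (sec A V)" "y = ext A E V a" and b: "b \<in> carrier (sec A W)" "y = ext A E W b"
    using y by (auto simp: image_in_def)
  have VU: "V \<subseteq> ?U" and WU: "W \<subseteq> ?U" by (auto simp: I_def)
  have "ext A E ?U (ext A ?U V a) = ext A E ?U (ext A ?U W b)"
    using ext_ext[OF V U openE VU subset_E[OF U] a(1)] ext_ext[OF W U openE WU subset_E[OF U] b(1)] a b by simp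
  then have ab: "ext A ?U V a = ext A ?U W b"
    using ext_inj[OF U openE subset_E[OF U]] ext_closed[OF V U VU a(1)] ext_closed[OF W U WU b(1)]
    by (auto dest: inj_onD)
  define z where "z = (\<lambda>T\<in>I. if T = V then a else inv\<^bsub>sec A W\<^esub> b)"
  have zc: "z \<in> carrier ?D"
    unfolding carD using a b finI by (auto simp: z_def I_def)
  have extb: "ext A ?U W (inv\<^bsub>sec A W\<^esub> b) = inv\<^bsub>sec A ?U\<^esub> ext A ?U W b"
    using group_hom.hom_inv[of "sec A W" "sec A ?U" "ext A ?U W" b] ext_hom[OF W U WU] b(1)
    by (simp add: group_hom_def group_hom_axioms_def W.is_group U.is_group)
  have "cosheaf_eps A I ?id z = finprod (sec A ?U) (\<lambda>T. ext A ?U T (z T)) I"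
    unfolding cosheaf_eps_def image_ident using zc
    by (intro U.gfinprod_eq_finprod[OF finI]) (auto simp: carD intro!: ext_closed I U)
  also have "\<dots> = ext A ?U V a \<otimes>\<^bsub>sec A ?U\<^esub> ext A ?U W (inv\<^bsub>sec A W\<^esub> b)"
    using U.finprod_pair[OF False, of "\<lambda>T. ext A ?U T (z T)"] False
      ext_closed[OF V U VU a(1)] ext_closed[OF W U WU W.inv_closed[OF b(1)]]
    by (auto simp: I_def z_def)
  also have "\<dots> = \<one>\<^bsub>sec A ?U\<^esub>"
    unfolding extb ab using ext_closed[OF W U WU b(1)] by simp
  finally have "z \<in> kernel ?D (sec A ?U) (cosheaf_eps A I ?id)"
    using zc by (simp add: kernel_def)
  moreover have "cosheaf_exact A I ?id" by (rule exact) (rule I)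
  ultimately obtain w where w: "w \<in> carrier (dsum A (I \<times> I) (\<lambda>(\<alpha>, \<beta>). ?id \<alpha> \<inter> ?id \<beta>))"
    and zw: "z = cosheaf_Phi A I ?id w"
    unfolding cosheaf_exact_def image_ident by blast
  have "carrier (dsum A (I \<times> I) (\<lambda>(\<alpha>, \<beta>). ?id \<alpha> \<inter> ?id \<beta>)) = {x \<in> \<Pi>\<^sub>E i\<in>I \<times> I. carrier (sec A (case i of (\<alpha>, \<beta>) \<Rightarrow> \<alpha> \<inter> \<beta>)).
      finite {i \<in> I \<times> I. x i \<noteq> \<one>\<^bsub>sec A (case i of (\<alpha>, \<beta>) \<Rightarrow> \<alpha> \<inter> \<beta>)\<^esub>}}"
    unfolding dsum_def
    by (rule carrier_sum_group) (use I in \<open>auto intro!: sec_group\<close>)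
  then have wc: "w (S, T) \<in> carrier (sec A (S \<inter> T))" if "S \<in> I" "T \<in> I" for S T
    using w that by (auto simp: PiE_iff)
  have D: "comm_group ?D"
  proof (rule group.group_comm_groupI)
    show "group ?D" unfolding dsum_def using grp by (rule sum_group)
    fix x x' assume "x \<in> carrier ?D" "x' \<in> carrier ?D"
    then show "x \<otimes>\<^bsub>?D\<^esub> x' = x' \<otimes>\<^bsub>?D\<^esub> x"
      using comm_group[OF I] by (auto simp: dsum_def carD[unfolded dsum_def] PiE_iff fun_eq_iff
          intro!: comm_groupE(4))
  qed
  interpret D: comm_group ?D by (rule D)
  \<comment> \<open>As a subgroup condition, membership in \<open>H\<close> can be checked on the
    single factors of \<open>cosheaf_Phi\<close>.\<close>
  define H where "H = {x \<in> carrier ?D. x V \<in> ?S}"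
  have S: "subgroup ?S (sec A V)" by (rule subgroup_image[OF VW V]) auto
  interpret S: subgroup ?S "sec A V" by (rule S)
  have VI: "V \<in> I" by (simp add: I_def)
  have mult_at: "(x \<otimes>\<^bsub>?D\<^esub> x') T = x T \<otimes>\<^bsub>sec A T\<^esub> x' T" if "T \<in> I" for x x' T
    using that by (simp add: dsum_def)
  have inv_at: "(inv\<^bsub>?D\<^esub> x) T = inv\<^bsub>sec A T\<^esub> x T" if "x \<in> carrier ?D" "T \<in> I" for x T
    using that inv_sum_group[of I "\<lambda>T. sec A T" x] grp by (simp add: dsum_def)
  have one_at: "\<one>\<^bsub>?D\<^esub> T = \<one>\<^bsub>sec A T\<^esub>" if "T \<in> I" for T
    using that by (simp add: dsum_def)
  have H: "subgroup H ?D"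
  proof (rule D.subgroupI)
    show "H \<noteq> {}" using one_at[OF VI] S.one_closed D.one_closed unfolding H_def by force
  qed (use VI in \<open>auto simp: H_def mult_at inv_at\<close>)
  have incl: "dsum_incl A I ?id T g \<in> carrier ?D" if "T \<in> I" "g \<in> carrier (sec A T)" for T g
    unfolding carD using that finI grp by (auto simp: dsum_incl_def PiE_iff intro: group.is_monoid monoid.one_closed)
  have incl_at: "dsum_incl A I ?id T g V = (if V = T then g else \<one>\<^bsub>sec A V\<^esub>)" for T g
    using VI by (simp add: dsum_incl_def)
  have "z \<in> H"
    unfolding zw cosheaf_Phi_def
  proof (rule D.gfinprod_in_subgroup[OF H], clarify)
    fix S T assume ST: "S \<in> I" "T \<in> I"
    have open_ST: "openin X (S \<inter> T)" using I ST by auto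
    let ?g = "ext A S (S \<inter> T) (w (S, T))" and ?h = "ext A T (S \<inter> T) (w (S, T))"
    have g: "?g \<in> carrier (sec A S)" and h: "?h \<in> carrier (sec A T)"
      using wc[OF ST] by (auto intro!: ext_closed open_ST I ST)
    have "(if V = S then ?g else \<one>\<^bsub>sec A V\<^esub>) \<otimes>\<^bsub>sec A V\<^esub> inv\<^bsub>sec A V\<^esub> (if V = T then ?h else \<one>\<^bsub>sec A V\<^esub>) \<in> ?S"
    proof (cases "S = T")
      case True
      then have "(if V = S then ?g else \<one>\<^bsub>sec A V\<^esub>) \<otimes>\<^bsub>sec A V\<^esub> inv\<^bsub>sec A V\<^esub> (if V = T then ?h else \<one>\<^bsub>sec A V\<^esub>) = \<one>\<^bsub>sec A V\<^esub>"
        using group.r_inv[OF grp[OF ST(1)] g] by auto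
      then show ?thesis using S.one_closed by simp
    next
      case False
      then have "V \<inter> W = S \<inter> T" using ST by (auto simp: I_def)
      then have gh: "V = S \<Longrightarrow> ?g \<in> ?S" "V = T \<Longrightarrow> ?h \<in> ?S" using wc[OF ST] by simp_all
      have "(if V = S then ?g else \<one>\<^bsub>sec A V\<^esub>) \<in> ?S" using gh(1) S.one_closed by simp
      moreover have "(if V = T then ?h else \<one>\<^bsub>sec A V\<^esub>) \<in> ?S" using gh(2) S.one_closed by simp
      ultimately show ?thesis by (intro S.m_closed S.m_inv_closed)
    qed
    then show "dsum_incl A I ?id S ?g \<otimes>\<^bsub>?D\<^esub> inv\<^bsub>?D\<^esub> dsum_incl A I ?id T ?h \<in> H"
      using incl[OF ST(1) g] incl[OF ST(2) h] by (simp add: H_def mult_at[OF VI] inv_at[OF _ VI] incl_at)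
  qed
  moreover have "z V = a" by (simp add: z_def I_def)
  ultimately have "a \<in> ?S" by (simp add: H_def)
  then show ?thesis
    using ext_ext[OF VW V openE _ subset_E[OF V]] a(2) by (auto simp: image_in_def)
qed

end

subsection \<open>Families graded by natural numbers over the open sets of a space\<close>

locale open_family =
  fixes X :: "'a topology" and F :: "nat \<Rightarrow> 'a set \<Rightarrow> 'w::ab_group_add set" and e :: "nat \<Rightarrow> 'w \<Rightarrow> 'w"
  assumes subgrp: "openin X V \<Longrightarrow> subgrp (F p V)"
    and mono: "openin X U \<Longrightarrow> openin X V \<Longrightarrow> U \<subseteq> V \<Longrightarrow> F p U \<subseteq> F p V"
    and additive: "Modules.additive (e p)"
    and bd: "openin X V \<Longrightarrow> x \<in> F (Suc p) V \<Longrightarrow> e (Suc p) x \<in> F p V"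
    and bd_bd: "openin X V \<Longrightarrow> x \<in> F (Suc (Suc p)) V \<Longrightarrow> e (Suc p) (e (Suc (Suc p)) x) \<in> F p {}"

locale open_flabby_family = open_family X C d
  for X :: "'a topology" and C :: "nat \<Rightarrow> 'a set \<Rightarrow> 'v::ab_group_add set" and d +
  assumes Un: "openin X U \<Longrightarrow> openin X V \<Longrightarrow> x \<in> C p (U \<union> V) \<Longrightarrow> \<exists>y\<in>C p U. \<exists>z\<in>C p V. x = y + z"
    and Int: "openin X U \<Longrightarrow> openin X V \<Longrightarrow> x \<in> C p U \<Longrightarrow> x \<in> C p V \<Longrightarrow> x \<in> C p (U \<inter> V)"
    and directed: "(\<And>T. T \<in> \<T> \<Longrightarrow> openin X T) \<Longrightarrow> x \<in> C p (\<Union>\<T>) \<Longrightarrow>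
      \<exists>J\<subseteq>\<T>. finite J \<and> x \<in> C p (\<Union>J)"

definition gsingle :: "nat \<Rightarrow> 'v \<Rightarrow> nat \<Rightarrow> 'v::zero" where
  "gsingle p x k = (if k = p then x else 0)"

text \<open>Each degree has its own position in a sequence, so that one boundary map serves all
  degrees, as \<open>subgrp_family\<close> demands.\<close>

definition graded :: "(nat \<Rightarrow> 'l \<Rightarrow> 'v set) \<Rightarrow> int \<Rightarrow> 'l \<Rightarrow> (nat \<Rightarrow> 'v::ab_group_add) set" where
  "graded F p V = (if p < 0 then {0} else gsingle (nat p) ` F (nat p) V)"

definition graded_bd :: "(nat \<Rightarrow> 'v \<Rightarrow> 'v) \<Rightarrow> (nat \<Rightarrow> 'v) \<Rightarrow> nat \<Rightarrow> 'v" where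
  "graded_bd d v k = d (Suc k) (v (Suc k))"

definition graded_map :: "(nat \<Rightarrow> 'v \<Rightarrow> 'w) \<Rightarrow> (nat \<Rightarrow> 'v) \<Rightarrow> nat \<Rightarrow> 'w" where
  "graded_map f v k = f k (v k)"

lemma gsingle_0: "gsingle p 0 = (0 :: nat \<Rightarrow> 'v::ab_group_add)"
  by (simp add: gsingle_def fun_eq_iff)

lemma gsingle_diff: "gsingle p (x - y) = (gsingle p x - gsingle p y :: nat \<Rightarrow> 'v::ab_group_add)"
  by (simp add: gsingle_def fun_eq_iff)

lemma gsingle_add: "gsingle p (x + y) = (gsingle p x + gsingle p y :: nat \<Rightarrow> 'v::ab_group_add)"
  by (simp add: gsingle_def fun_eq_iff)

lemma additive_gsingle: "Modules.additive (gsingle p :: 'v::ab_group_add \<Rightarrow> _)"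
  by unfold_locales (rule gsingle_add)

lemma gsingle_inj: "gsingle p x = gsingle p y \<longleftrightarrow> x = y"
  by (metis gsingle_def)

lemma graded_of_nat: "graded F (int p) V = gsingle p ` F p V"
  by (simp add: graded_def)

lemma gsingle_in_graded [simp]: "gsingle p x \<in> graded F (int p) V \<longleftrightarrow> x \<in> F p V"
  by (auto simp: graded_of_nat gsingle_inj)

lemma graded_bd_gsingle:
  assumes "\<And>p. Modules.additive (d p)"
  shows "graded_bd d (gsingle (Suc p) x) = gsingle p (d (Suc p) x)" "graded_bd d (gsingle 0 x) = 0"
  by (auto simp: graded_bd_def gsingle_def fun_eq_iff additive.zero[OF assms])

lemma graded_map_gsingle:
  assumes "\<And>p. Modules.additive (f p)"
  shows "graded_map f (gsingle p x) = gsingle p (f p x)"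
  by (auto simp: graded_map_def gsingle_def fun_eq_iff additive.zero[OF assms])

lemma additive_graded_bd:
  assumes "\<And>p. Modules.additive (d p)"
  shows "Modules.additive (graded_bd d)"
  by unfold_locales (simp add: graded_bd_def fun_eq_iff additive.add[OF assms])

lemma additive_graded_map:
  assumes "\<And>p. Modules.additive (f p)"
  shows "Modules.additive (graded_map f)"
  by unfold_locales (simp add: graded_map_def fun_eq_iff additive.add[OF assms])

lemma graded_cases:
  assumes "x \<in> graded F p V"
  obtains "p < 0" "x = 0" | q y where "p = int q" "x = gsingle q y" "y \<in> F q V"
  using assms by (cases p rule: int_cases) (auto simp: graded_def)

lemma zero_in_graded:
  assumes "\<And>p. subgrp (F p V)"
  shows "0 \<in> graded F p V"
  using subgrp_0[OF assms] gsingle_0 by (force simp: graded_def image_iff)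

context open_family
begin

lemma zero_graded: "openin X V \<Longrightarrow> 0 \<in> graded F p V"
  by (rule zero_in_graded) (rule subgrp)

lemma subgrp_family_graded: "subgrp_family {V. openin X V} (graded F) (graded_bd e)"
proof (rule subgrp_family.intro)
  fix V p assume "V \<in> {V. openin X V}"
  then have V: "openin X V" by simp
  have "x - y \<in> graded F p V" if x: "x \<in> graded F p V" and y: "y \<in> graded F p V" for x y
  proof (cases "p < 0")
    case False
    then obtain q where p: "p = int q" by (meson nonneg_int_cases not_less)
    show ?thesis
      using x y unfolding p graded_of_nat
      by (auto simp: gsingle_diff[symmetric] intro!: imageI subgrp_diff[OF subgrp[OF V]])
  qed (use x y in \<open>auto simp: graded_def\<close>)
  then show "subgrp (graded F p V)"
    unfolding subgrp_def using zero_graded[OF V] by blast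
  show "graded F p V = {0}" if "p < 0" using that by (simp add: graded_def)
  fix x assume x: "x \<in> graded F p V"
  note e = graded_bd_gsingle[OF additive]
  from x show "graded_bd e x \<in> graded F (p - 1) V"
  proof (cases rule: graded_cases)
    case 1
    have "graded_bd e x = 0" unfolding 1 by (rule additive.zero[OF additive_graded_bd[OF additive]])
    then show ?thesis using zero_graded[OF V] by simp
  next
    case (2 q y)
    show ?thesis
    proof (cases q)
      case 0
      show ?thesis unfolding 2(2) 0 e(2) by (rule zero_graded[OF V])
    next
      case (Suc r)
      have "p - 1 = int r" using 2(1) Suc by simp
      then show ?thesis using bd[OF V] 2 Suc by (simp add: e)
    qed
  qed
  from x show "graded_bd e (graded_bd e x) \<in> graded F (p - 2) bot"
  proof (cases rule: graded_cases)
    case 1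
    have "graded_bd e 0 = 0" by (rule additive.zero[OF additive_graded_bd[OF additive]])
    then show ?thesis using zero_graded[of "{}"] 1 by simp
  next
    case (2 q y)
    show ?thesis
    proof (cases "q < 2")
      case True
      then have "q = 0 \<or> q = Suc 0" by linarith
      moreover have "graded_bd e 0 = 0" by (rule additive.zero[OF additive_graded_bd[OF additive]])
      ultimately have "graded_bd e (graded_bd e x) = 0" using 2(2) e by auto
      then show ?thesis using zero_graded[of "{}"] by simp
    next
      case False
      then obtain r where r: "q = Suc (Suc r)" by (metis add_2_eq_Suc le_Suc_ex not_less)
      have "p - 2 = int r" using 2(1) r by simp
      then show ?thesis using bd_bd[OF V] 2 r by (simp add: e)
    qed
  qed
next
  fix U V p assume "U \<in> {V. openin X V}" "V \<in> {V. openin X V}" "U \<le> V"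
  then show "graded F p U \<subseteq> graded F p V"
    using mono[of U V "nat p"] by (auto simp: graded_def)
qed (auto intro: additive_graded_bd[OF additive])

end

lemma (in open_flabby_family) flabby_family_graded:
  "flabby_family {V. openin X V} (graded C) (graded_bd d)"
proof -
  interpret G: subgrp_family "{V. openin X V}" "graded C" "graded_bd d"
    by (rule subgrp_family_graded)
  show ?thesis
  proof
    fix U V x p assume "U \<in> {V. openin X V}" "V \<in> {V. openin X V}"
    then have UV: "openin X U" "openin X V" by auto
    show "\<exists>y\<in>graded C p U. \<exists>z\<in>graded C p V. x = y + z" if "x \<in> graded C p (sup U V)"
      using that
    proof (cases rule: graded_cases)
      case 1
      then show ?thesis by (intro bexI[of _ 0]) (auto simp: graded_def)
    next
      case (2 q x')
      then obtain y z where "y \<in> C q U" "z \<in> C q V" "x' = y + z" using Un[OF UV 2(3)] by blast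
      then show ?thesis
        using 2 by (intro bexI[of _ "gsingle q y"] bexI[of _ "gsingle q z"]) (simp_all add: gsingle_add)
    qed
    show "x \<in> graded C p (inf U V)" if "x \<in> graded C p U" "x \<in> graded C p V"
      using that(1)
    proof (cases rule: graded_cases)
      case 1
      then show ?thesis by (simp add: graded_def)
    next
      case (2 q x')
      then show ?thesis using that(2) Int[OF UV, of x' q] by simp
    qed
  qed
qed

text \<open>Points enter through \<open>loc\<close> alone: small sets cover \<open>V\<close>, and
  \<open>directed\<close> with \<open>Un\<close> writes a chain over \<open>V\<close> as a finite
  sum of chains over small sets.\<close>

theorem cycles_bound_open:
  assumes "open_flabby_family X C d" and "open_family X F e"
    and f_add: "\<And>p. Modules.additive (f p)"
    and f_in: "\<And>V p c. openin X V \<Longrightarrow> c \<in> C p V \<Longrightarrow> f p c \<in> F p V"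
    and f_bd: "\<And>V p c. openin X V \<Longrightarrow> c \<in> C (Suc p) V \<Longrightarrow>
      f p (d (Suc p) c) - e (Suc p) (f (Suc p) c) \<in> F p {}"
    and loc: "\<And>x V. openin X V \<Longrightarrow> x \<in> V \<Longrightarrow> \<exists>T. openin X T \<and> x \<in> T \<and> T \<subseteq> V \<and>
      (\<forall>q\<le>n. \<forall>g\<in>F q T. (0 < q \<longrightarrow> e q g \<in> F (q - 1) {}) \<longrightarrow>
        (\<exists>u\<in>F (Suc q) V. g - e (Suc q) u \<in> F q {}))"
    and V: "openin X V" and z: "z \<in> C n V" and dz: "0 < n \<longrightarrow> d n z \<in> C (n - 1) {}"
  shows "\<exists>u\<in>F (Suc n) V. f n z - e (Suc n) u \<in> F n {}"
proof -
  interpret C: open_flabby_family X C d by fact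
  interpret F: open_family X F e by fact
  let ?Op = "{V. openin X V}"
  interpret GC: flabby_family ?Op "graded C" "graded_bd d" by (rule C.flabby_family_graded)
  interpret GF: subgrp_family ?Op "graded F" "graded_bd e" by (rule F.subgrp_family_graded)
  note ed = graded_bd_gsingle[OF F.additive] graded_bd_gsingle[OF C.additive] graded_map_gsingle[OF f_add]
  have small: "small ?Op (graded F) (graded_bd e) (int n) T V"
    if T: "openin X T" "T \<subseteq> V" and V: "openin X V"
      and die: "\<And>q g. q \<le> n \<Longrightarrow> g \<in> F q T \<Longrightarrow> 0 < q \<longrightarrow> e q g \<in> F (q - 1) {} \<Longrightarrow>
        \<exists>u\<in>F (Suc q) V. g - e (Suc q) u \<in> F q {}" for T V
    unfolding small_def
  proof (intro conjI allI impI ballI)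
    fix q g assume q: "q \<le> int n" and g: "g \<in> graded F q T" and eg: "graded_bd e g \<in> graded F (q - 1) bot"
    from g show "\<exists>u\<in>graded F (q + 1) V. g - graded_bd e u \<in> graded F q bot"
    proof (cases rule: graded_cases)
      case 1
      have "graded_bd e 0 = 0" by (rule additive.zero[OF additive_graded_bd[OF F.additive]])
      then have "g - graded_bd e 0 \<in> graded F q bot"
        unfolding 1(2) using F.zero_graded[of "{}"] by simp
      then show ?thesis by (rule bexI[OF _ F.zero_graded[OF V]])
    next
      case (2 p h)
      have "e p h \<in> F (p - 1) {}" if "0 < p"
      proof -
        from that obtain r where r: "p = Suc r" by (cases p) simp_all
        then have "q - 1 = int r" using 2 by simp
        then show ?thesis using eg 2(2) r by (simp add: ed)
      qed
      then obtain u where u: "u \<in> F (Suc p) V" "h - e (Suc p) u \<in> F p {}"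
        using die[of p h] 2 q by auto
      have "q + 1 = int (Suc p)" using 2 by simp
      then show ?thesis
        using u 2 by (intro bexI[of _ "gsingle (Suc p) u"])
          (simp_all only: ed gsingle_diff[symmetric] gsingle_in_graded bot_set_def[symmetric] empty_def[symmetric])
    qed
  qed (use T in auto)
  \<comment> \<open>The empty subfamily contributes chains over \<open>{}\<close> to the
    decomposition; these vanish modulo \<open>F q {}\<close>, so \<open>0\<close> bounds
    them.\<close>
  have small_empty: "small ?Op (graded F) (graded_bd e) (int n) {} V" if V: "openin X V" for V
  proof (rule small[OF _ _ V])
    show "\<exists>u\<in>F (Suc q) V. g - e (Suc q) u \<in> F q {}" if "g \<in> F q {}" for q g
      using that subgrp_0[OF F.subgrp[OF V]] additive.zero[OF F.additive] by (intro bexI[of _ 0]) simp_all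
  qed auto
  have "decomposable ?Op (graded C) (graded F) (graded_bd e) (int n)"
    unfolding decomposable_def
  proof (intro ballI allI)
    fix V p c assume "V \<in> ?Op" and c: "c \<in> graded C p V"
    then have V: "openin X V" by simp
    define \<T> where "\<T> = {T. openin X T \<and> T \<subseteq> V \<and> small ?Op (graded F) (graded_bd e) (int n) T V}"
    have "V \<subseteq> \<Union>\<T>"
    proof
      fix x assume "x \<in> V"
      from loc[OF V this] show "x \<in> \<Union>\<T>"
      proof (elim exE conjE)
        fix T assume T: "openin X T" "x \<in> T" "T \<subseteq> V"
          and die: "\<forall>q\<le>n. \<forall>g\<in>F q T. (0 < q \<longrightarrow> e q g \<in> F (q - 1) {}) \<longrightarrow>
            (\<exists>u\<in>F (Suc q) V. g - e (Suc q) u \<in> F q {})"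
        have "small ?Op (graded F) (graded_bd e) (int n) T V"
          by (rule small[OF T(1,3) V], rule die[rule_format]) blast+
        then show ?thesis using T by (auto simp: \<T>_def)
      qed
    qed
    then have VT: "V = \<Union>\<T>" by (auto simp: \<T>_def)
    from c show "c \<in> sums_of (\<Union>T\<in>{T. small ?Op (graded F) (graded_bd e) (int n) T V}. graded C p T)"
    proof (cases rule: graded_cases)
      case 1
      show ?thesis unfolding 1(2) by (rule sums_of_0)
    next
      case (2 q c')
      have "\<And>T. T \<in> \<T> \<Longrightarrow> openin X T" by (simp add: \<T>_def)
      then obtain J where J: "J \<subseteq> \<T>" "finite J" "c' \<in> C q (\<Union>J)"
        using C.directed[of \<T> c' q] 2(3) unfolding VT[symmetric] by blast
      have "finite J \<Longrightarrow> J \<subseteq> \<T> \<Longrightarrow> x \<in> C q (\<Union>J) \<Longrightarrow> x \<in> sums_of (\<Union>T\<in>insert {} \<T>. C q T)" for J x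
      proof (induction J arbitrary: x rule: finite_induct)
        case empty
        then show ?case by (intro sums_of_base) auto
      next
        case (insert T J)
        have "openin X T" "openin X (\<Union>J)" using insert.prems by (auto simp: \<T>_def)
        then obtain y z where "y \<in> C q T" "z \<in> C q (\<Union>J)" "x = y + z"
          using C.Un[of T "\<Union>J" x q] insert.prems(2) by auto
        then show ?case using insert.IH[of z] insert.prems by (auto intro: sums_of_Cons)
      qed
      then have "c' \<in> sums_of (\<Union>T\<in>insert {} \<T>. C q T)" using J by blast
      then show ?thesis
        unfolding 2(2)
      proof (rule sums_of_image[OF additive_gsingle, rotated])
        fix x assume "x \<in> (\<Union>T\<in>insert {} \<T>. C q T)"
        then obtain T where T: "T = {} \<or> T \<in> \<T>" "x \<in> C q T" by blast
        then have "small ?Op (graded F) (graded_bd e) (int n) T V"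
          using small_empty[OF V] by (auto simp: \<T>_def)
        then show "gsingle q x \<in> (\<Union>T\<in>{T. small ?Op (graded F) (graded_bd e) (int n) T V}. graded C p T)"
          using T(2) 2(1) by auto
      qed
    qed
  qed
  then have dec: "decomposable ?Op (graded C) (graded F) (graded_bd e) (int (Suc n) - 1)" by simp
  have sys: "comparison_system ?Op (graded C) (graded_bd d) (graded F) (graded_bd e) (graded_map f) (int (Suc n) - 1)"
    unfolding comparison_system_def
  proof (intro conjI ballI allI GC.flabby_family_axioms GF.subgrp_family_axioms additive_graded_map f_add dec)
    fix V p c assume "V \<in> ?Op" and c: "c \<in> graded C p V"
    then have V: "openin X V" by simp
    have f0: "graded_map f 0 = 0" and e0: "graded_bd e 0 = 0" and d0: "graded_bd d 0 = 0"
      by (rule additive.zero[OF additive_graded_map[OF f_add]]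
          additive.zero[OF additive_graded_bd[OF F.additive]] additive.zero[OF additive_graded_bd[OF C.additive]])+
    from c show "graded_map f c \<in> graded F p V"
    proof (cases rule: graded_cases)
      case 1
      show ?thesis unfolding 1(2) f0 by (rule F.zero_graded[OF V])
    next
      case (2 q y)
      then show ?thesis using f_in[OF V] by (simp add: ed)
    qed
    from c show "graded_map f (graded_bd d c) - graded_bd e (graded_map f c) \<in> graded F (p - 1) bot"
    proof (cases rule: graded_cases)
      case 1
      show ?thesis unfolding 1(2) d0 f0 e0 using F.zero_graded[of "{}"] by simp
    next
      case (2 q y)
      show ?thesis
      proof (cases q)
        case 0
        have "graded_map f (graded_bd d c) - graded_bd e (graded_map f c) = 0"
          unfolding 2(2) 0 by (simp only: ed f0 diff_0_right)
        then show ?thesis using F.zero_graded[of "{}"] by simp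
      next
        case (Suc r)
        have p: "p - 1 = int r" using 2 Suc by simp
        have "graded_map f (graded_bd d c) - graded_bd e (graded_map f c)
          = gsingle r (f r (d (Suc r) y) - e (Suc r) (f (Suc r) y))"
          unfolding 2(2) Suc by (simp only: ed gsingle_diff)
        then show ?thesis unfolding p using f_bd[OF V] 2 Suc by simp
      qed
    qed
  qed
  have "graded_bd d (gsingle n z) \<in> graded C (int (Suc n) - 2) bot"
  proof (cases n)
    case 0
    show ?thesis unfolding 0 ed using C.zero_graded[of "{}"] by simp
  next
    case (Suc r)
    have "int (Suc n) - 2 = int r" using Suc by simp
    then show ?thesis using dz Suc by (simp add: ed)
  qed
  with sys V z obtain u where u: "u \<in> graded F (int (Suc n)) V"
    and fu: "graded_map f (gsingle n z) - graded_bd e u \<in> graded F (int (Suc n) - 1) bot"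
    using cycles_bound[of ?Op "graded C" "graded_bd d" "graded F" "graded_bd e" "graded_map f" "Suc n" V "gsingle n z"]
    by auto
  obtain u' where u': "u = gsingle (Suc n) u'" "u' \<in> F (Suc n) V"
    using u by (auto simp: graded_of_nat simp del: of_nat_Suc)
  have "gsingle n (f n z - e (Suc n) u') \<in> graded F (int n) {}"
    using fu unfolding u'(1) by (simp add: ed gsingle_diff)
  then show ?thesis using u'(2) by auto
qed

subsection \<open>Homology classes\<close>

lemma (in group) coset_eq_iff:
  assumes "subgroup H G" "x \<in> carrier G" "y \<in> carrier G"
  shows "H #> x = H #> y \<longleftrightarrow> x \<otimes> inv y \<in> H"
  using assms coset_mult_inv1[of H x y] coset_mult_inv2[of H x y] coset_join1[of H "x \<otimes> inv y"]
    coset_join2[of "x \<otimes> inv y" H] subgroup.subset[of H G]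
  by (metis inv_closed m_closed)

lemma r_coset_subgroup_generated: "r_coset (subgroup_generated G Z) = r_coset G"
  by (simp add: r_coset_def fun_eq_iff)

locale complex =
  fixes C :: "'g cplx"
  assumes chain_cplx: "chain_cplx C"
begin

lemma comm_group: "comm_group (grp C p)"
  and bd_hom: "bd C (Suc p) \<in> hom (grp C (Suc p)) (grp C p)"
  and bd_bd: "x \<in> carrier (grp C (Suc (Suc p))) \<Longrightarrow> bd C (Suc p) (bd C (Suc (Suc p)) x) = \<one>\<^bsub>grp C p\<^esub>"
  using chain_cplx by (simp_all add: chain_cplx_def)

lemma group: "group (grp C p)"
  by (rule comm_group.axioms(2)[OF comm_group])

lemma group_hom_bd: "group_hom (grp C (Suc p)) (grp C p) (bd C (Suc p))"
  by (simp add: group_hom_def group_hom_axioms_def group bd_hom)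

lemma subgroup_boundaries: "subgroup (boundaries C p) (grp C p)"
  unfolding boundaries_def by (rule group_hom.img_is_subgroup[OF group_hom_bd])

lemma subgroup_cycles: "subgroup (cycles C p) (grp C p)"
proof (cases p)
  case 0
  then show ?thesis using group.subgroup_self[OF group] by (simp add: cycles_def)
next
  case (Suc q)
  then show ?thesis using group_hom.subgroup_kernel[OF group_hom_bd[of q]] by (simp add: cycles_def)
qed

lemma carrier_homology: "carrier (homology C p) = (\<lambda>z. boundaries C p #>\<^bsub>grp C p\<^esub> z) ` cycles C p"
  by (simp add: homology_def carrier_FactGroup r_coset_subgroup_generated
      subgroup.carrier_subgroup_generated_subgroup[OF subgroup_cycles])

lemma coset_in_reduced_homology:
  assumes "z \<in> reduced_cycles C B \<xi> p" "z \<in> carrier (grp C p)"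
  shows "boundaries C p #>\<^bsub>grp C p\<^esub> z \<in> carrier (reduced_homology C B \<xi> p)"
  using assms by (auto simp: reduced_homology_def carrier_FactGroup r_coset_subgroup_generated
      carrier_subgroup_generated intro!: imageI generate.incl)

end

locale complex_map = C: complex C + D: complex D
  for C :: "'g cplx" and D :: "'h cplx" +
  fixes f :: "nat \<Rightarrow> 'g \<Rightarrow> 'h"
  assumes chain_map: "chain_map_betw C D f"
begin

lemma f_hom: "f p \<in> hom (grp C p) (grp D p)"
  and f_bd: "x \<in> carrier (grp C (Suc p)) \<Longrightarrow> f p (bd C (Suc p) x) = bd D (Suc p) (f (Suc p) x)"
  using chain_map by (simp_all add: chain_map_betw_def)

lemma f_closed: "x \<in> carrier (grp C p) \<Longrightarrow> f p x \<in> carrier (grp D p)"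
  by (rule hom_in_carrier[OF f_hom])

lemma group_hom_f: "group_hom (grp C p) (grp D p) (f p)"
  by (simp add: group_hom_def group_hom_axioms_def C.group D.group f_hom)

lemma f_one: "f p \<one>\<^bsub>grp C p\<^esub> = \<one>\<^bsub>grp D p\<^esub>"
  by (rule group_hom.hom_one[OF group_hom_f])

lemma f_cycles: "z \<in> cycles C p \<Longrightarrow> f p z \<in> cycles D p"
  by (cases p) (auto simp: cycles_def kernel_def f_closed f_bd[symmetric] f_one)

lemma map_coset: "z \<in> carrier (grp C p) \<Longrightarrow>
    homology_map D f p (boundaries C p #>\<^bsub>grp C p\<^esub> z) = boundaries D p #>\<^bsub>grp D p\<^esub> f p z"
  by (rule homology_map_coset[OF C.chain_cplx D.chain_cplx chain_map])

lemma cycles_carrier: "z \<in> cycles C p \<Longrightarrow> z \<in> carrier (grp C p)"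
  using subgroup.mem_carrier[OF C.subgroup_cycles] .

text \<open>The quotient of two representatives reduces the claim to a single cycle whose image
  bounds.\<close>

lemma inj_on_homology_map:
  assumes "\<And>z. z \<in> cycles C p \<Longrightarrow> f p z \<in> boundaries D p \<Longrightarrow> z \<in> boundaries C p"
  shows "inj_on (homology_map D f p) (carrier (homology C p))"
proof (rule inj_onI)
  interpret G: group "grp C p" by (rule C.group)
  interpret H: group "grp D p" by (rule D.group)
  interpret f: group_hom "grp C p" "grp D p" "f p" by (rule group_hom_f)
  fix h k assume "h \<in> carrier (homology C p)" "k \<in> carrier (homology C p)"
    and eq: "homology_map D f p h = homology_map D f p k"
  then obtain x y where x: "x \<in> cycles C p" and y: "y \<in> cycles C p"
    and h: "h = boundaries C p #>\<^bsub>grp C p\<^esub> x" and k: "k = boundaries C p #>\<^bsub>grp C p\<^esub> y"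
    by (auto simp: C.carrier_homology)
  note xy = cycles_carrier[OF x] cycles_carrier[OF y]
  have "f p x \<otimes>\<^bsub>grp D p\<^esub> inv\<^bsub>grp D p\<^esub> f p y \<in> boundaries D p"
    using eq xy by (simp add: h k map_coset H.coset_eq_iff[OF D.subgroup_boundaries] f_closed)
  then have "f p (x \<otimes>\<^bsub>grp C p\<^esub> inv\<^bsub>grp C p\<^esub> y) \<in> boundaries D p" using xy by simp
  then have "x \<otimes>\<^bsub>grp C p\<^esub> inv\<^bsub>grp C p\<^esub> y \<in> boundaries C p"
    by (intro assms subgroup.m_closed[OF C.subgroup_cycles] subgroup.m_inv_closed[OF C.subgroup_cycles] x y)
  then show "h = k"
    using xy by (simp add: h k G.coset_eq_iff[OF C.subgroup_boundaries])
qed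

lemma surj_homology_map:
  assumes "\<And>y. y \<in> cycles D p \<Longrightarrow>
    \<exists>z\<in>cycles C p. y \<otimes>\<^bsub>grp D p\<^esub> inv\<^bsub>grp D p\<^esub> f p z \<in> boundaries D p"
  shows "homology_map D f p ` carrier (homology C p) = carrier (homology D p)"
proof (intro equalityI subsetI)
  fix h assume "h \<in> homology_map D f p ` carrier (homology C p)"
  then obtain x where x: "x \<in> cycles C p" "h = homology_map D f p (boundaries C p #>\<^bsub>grp C p\<^esub> x)"
    by (auto simp: C.carrier_homology)
  then show "h \<in> carrier (homology D p)"
    using f_cycles by (simp add: map_coset[OF cycles_carrier] D.carrier_homology)
next
  interpret H: group "grp D p" by (rule D.group)
  fix h assume "h \<in> carrier (homology D p)"
  then obtain y where y: "y \<in> cycles D p" and h: "h = boundaries D p #>\<^bsub>grp D p\<^esub> y"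
    by (auto simp: D.carrier_homology)
  obtain z where z: "z \<in> cycles C p" "y \<otimes>\<^bsub>grp D p\<^esub> inv\<^bsub>grp D p\<^esub> f p z \<in> boundaries D p"
    using assms[OF y] by blast
  then have "h = homology_map D f p (boundaries C p #>\<^bsub>grp C p\<^esub> z)"
    using subgroup.mem_carrier[OF D.subgroup_cycles y] cycles_carrier[OF z(1)]
    by (simp add: h map_coset H.coset_eq_iff[OF D.subgroup_boundaries] f_closed)
  then show "h \<in> homology_map D f p ` carrier (homology C p)"
    using z(1) by (auto simp: C.carrier_homology)
qed

text \<open>For every augmentation of the target the unit of its reduced homology is
  \<open>boundaries D p\<close>, so a trivial image class means that the image bounds.\<close>

lemma reduced_homology_map_trivial:
  assumes "\<forall>h\<in>carrier (reduced_homology C B \<xi> p). homology_map D f p h = \<one>\<^bsub>reduced_homology D B' \<xi>' p\<^esub>"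
    and "z \<in> reduced_cycles C B \<xi> p" "z \<in> carrier (grp C p)"
  shows "f p z \<in> boundaries D p"
proof -
  have "boundaries D p #>\<^bsub>grp D p\<^esub> f p z = boundaries D p"
    using assms(1) C.coset_in_reduced_homology[OF assms(2,3)] map_coset[OF assms(3)]
    by (simp add: reduced_homology_def)
  then show ?thesis
    by (rule group.coset_join1[OF D.group _ f_closed[OF assms(3)] D.subgroup_boundaries])
qed

end


subsection \<open>Complexes of flabby cosheaves\<close>

locale flabby_complex =
  fixes X :: "'a topology" and A :: "('a, 'g) cprecosh"
  assumes ccosheaf: "ccosheaf X A" and cflabby: "cflabby X A"
begin

abbreviation "E \<equiv> topspace X"
abbreviation "G \<equiv> grp (csec A E)"

sublocale F: flabby_cosheaf X "cdeg A p" for p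
  using ccosheaf cflabby by unfold_locales (simp_all add: ccosheaf_def cflabby_def)

lemma sec_cdeg [simp]: "sec (cdeg A p) V = grp (csec A V) p" and ext_cdeg [simp]: "ext (cdeg A p) U V = cext A U V p"
  by (simp_all add: cdeg_def)

lemma complex: "openin X V \<Longrightarrow> complex (csec A V)"
  using ccosheaf by (simp add: ccosheaf_def cprecosheaf_def complex_def)

lemma complex_map:
  "openin X U \<Longrightarrow> openin X V \<Longrightarrow> U \<subseteq> V \<Longrightarrow> complex_map (csec A U) (csec A V) (cext A V U)"
  using ccosheaf complex by (simp add: ccosheaf_def cprecosheaf_def complex_map_def complex_map_axioms_def)

lemma G_comm: "comm_group (G p)"
  using complex.comm_group[OF complex[of E]] by simp

lemma ext_closed: "openin X U \<Longrightarrow> openin X V \<Longrightarrow> U \<subseteq> V \<Longrightarrow> x \<in> carrier (grp (csec A U) p) \<Longrightarrow>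
    cext A V U p x \<in> carrier (grp (csec A V) p)"
  using F.ext_closed[of U V x p] by simp

lemma toE_closed: "openin X U \<Longrightarrow> x \<in> carrier (grp (csec A U) p) \<Longrightarrow> cext A E U p x \<in> carrier (G p)"
  by (rule ext_closed) (auto simp: openin_subset)

lemma toE_ext: "openin X U \<Longrightarrow> openin X V \<Longrightarrow> U \<subseteq> V \<Longrightarrow> x \<in> carrier (grp (csec A U) p) \<Longrightarrow>
    cext A E V p (cext A V U p x) = cext A E U p x"
  using F.ext_ext[of U V E x p] openin_subset[of X V] by simp

lemma toE_inj: "openin X U \<Longrightarrow> x \<in> carrier (grp (csec A U) p) \<Longrightarrow> y \<in> carrier (grp (csec A U) p) \<Longrightarrow>
    cext A E U p x = cext A E U p y \<Longrightarrow> x = y"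
  using F.ext_inj[of U E p] openin_subset[of X U] by (auto dest: inj_onD)

lemma toE_one: "openin X U \<Longrightarrow> cext A E U p \<one>\<^bsub>grp (csec A U) p\<^esub> = \<one>\<^bsub>G p\<^esub>"
  using complex_map.f_one[OF complex_map[of U E]] openin_subset[of X U] by simp

lemma toE_bd: "openin X U \<Longrightarrow> x \<in> carrier (grp (csec A U) (Suc p)) \<Longrightarrow>
    cext A E U p (bd (csec A U) (Suc p) x) = bd (csec A E) (Suc p) (cext A E U (Suc p) x)"
  using complex_map.f_bd[OF complex_map[of U E]] openin_subset[of X U] by simp

lemma bd_closed: "openin X U \<Longrightarrow> x \<in> carrier (grp (csec A U) (Suc p)) \<Longrightarrow>
    bd (csec A U) (Suc p) x \<in> carrier (grp (csec A U) p)"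
  by (rule hom_in_carrier[OF complex.bd_hom[OF complex]])

text \<open>The value at \<open>{}\<close> consists of the formal sums that evaluate to the unit,
  and so takes the role of zero.\<close>

definition hat :: "nat \<Rightarrow> 'a set \<Rightarrow> ('g \<Rightarrow>\<^sub>0 int) set" where
  "hat p V = lift (G p) (image_in X (cdeg A p) V)"

definition d :: "nat \<Rightarrow> ('g \<Rightarrow>\<^sub>0 int) \<Rightarrow> 'g \<Rightarrow>\<^sub>0 int" where
  "d p = push (bd (csec A E) p)"

lemma additive_d: "Modules.additive (d p)"
  unfolding d_def by (rule additive_push)

lemma in_hat_iff: "a \<in> hat p V \<longleftrightarrow> Poly_Mapping.keys a \<subseteq> carrier (G p) \<and>
    (\<exists>x\<in>carrier (grp (csec A V) p). ev (G p) a = cext A E V p x)"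
  by (auto simp: hat_def lift_def image_in_def)

lemma hat_keys: "a \<in> hat p V \<Longrightarrow> Poly_Mapping.keys a \<subseteq> carrier (G p)"
  by (simp add: in_hat_iff)

lemma frag_of_in_hat: "openin X V \<Longrightarrow> x \<in> carrier (grp (csec A V) p) \<Longrightarrow> frag_of (cext A E V p x) \<in> hat p V"
  using toE_closed[of V x p] by (auto simp: in_hat_iff ev(2)[OF G_comm])

lemma ev_frag_of: "openin X V \<Longrightarrow> x \<in> carrier (grp (csec A V) p) \<Longrightarrow>
    ev (G p) (frag_of (cext A E V p x)) = cext A E V p x"
  by (rule ev(2)[OF G_comm toE_closed])

lemma hat_empty: "hat p {} = lift (G p) {\<one>\<^bsub>G p\<^esub>}"
  using F.image_in_empty[of p] by (simp add: hat_def)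

lemma diff_in_hat_empty_iff:
  "Poly_Mapping.keys a \<subseteq> carrier (G p) \<Longrightarrow> Poly_Mapping.keys b \<subseteq> carrier (G p) \<Longrightarrow>
    a - b \<in> hat p {} \<longleftrightarrow> ev (G p) a = ev (G p) b"
  unfolding hat_empty by (rule diff_in_lift_one_iff[OF G_comm])

lemma in_hat_empty_iff: "a \<in> hat p {} \<longleftrightarrow> Poly_Mapping.keys a \<subseteq> carrier (G p) \<and> ev (G p) a = \<one>\<^bsub>G p\<^esub>"
  by (simp add: hat_empty lift_def)

lemma keys_d: "Poly_Mapping.keys a \<subseteq> carrier (G (Suc p)) \<Longrightarrow> Poly_Mapping.keys (d (Suc p) a) \<subseteq> carrier (G p)"
  and ev_d: "Poly_Mapping.keys a \<subseteq> carrier (G (Suc p)) \<Longrightarrow>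
    ev (G p) (d (Suc p) a) = bd (csec A E) (Suc p) (ev (G (Suc p)) a)"
  unfolding d_def using push_hom[OF G_comm G_comm complex.bd_hom[OF complex[of E]]] by simp_all

lemma d_hat:
  assumes V: "openin X V" and a: "a \<in> hat (Suc p) V"
  shows "d (Suc p) a \<in> hat p V"
proof -
  obtain x where x: "x \<in> carrier (grp (csec A V) (Suc p))" "ev (G (Suc p)) a = cext A E V (Suc p) x"
    using a by (auto simp: in_hat_iff)
  then have "ev (G p) (d (Suc p) a) = cext A E V p (bd (csec A V) (Suc p) x)"
    using ev_d[OF hat_keys[OF a]] by (simp add: toE_bd[OF V])
  then show ?thesis
    using keys_d[OF hat_keys[OF a]] bd_closed[OF V x(1)] by (auto simp: in_hat_iff)
qed

sublocale hat: open_flabby_family X hat d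
proof
  show "subgrp (hat p V)" if "openin X V" for p V
    unfolding hat_def using F.subgroup_image_in[OF that, of p] by (intro subgrp_lift[OF G_comm]) simp
  show "hat p U \<subseteq> hat p V" if "openin X U" "openin X V" "U \<subseteq> V" for p U V
    unfolding hat_def by (rule lift_mono) (rule F.image_in_mono[OF that])
  show "d p (x + y) = d p x + d p y" for p x y
    by (rule additive.add[OF additive_d])
  show "d (Suc p) x \<in> hat p V" if "openin X V" "x \<in> hat (Suc p) V" for p x V
    by (rule d_hat[OF that])
  show "d (Suc p) (d (Suc (Suc p)) x) \<in> hat p {}" if "openin X V" "x \<in> hat (Suc (Suc p)) V" for p x V
    using hat_keys[OF that(2)] complex.bd_bd[OF complex[of E], of "ev (G (Suc (Suc p))) x" p] ev_closed[OF G_comm]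
    by (simp add: in_hat_empty_iff keys_d ev_d)
next
  fix U V a p assume UV: "openin X U" "openin X V"
  interpret G: comm_group "G p" by (rule G_comm)
  show "\<exists>y\<in>hat p U. \<exists>z\<in>hat p V. a = y + z" if a: "a \<in> hat p (U \<union> V)"
  proof -
    obtain v w where v: "v \<in> image_in X (cdeg A p) U" and w: "w \<in> image_in X (cdeg A p) V"
      and vw: "ev (G p) a = v \<otimes>\<^bsub>G p\<^esub> w"
      using F.image_in_Un[OF UV, of "ev (G p) a" p] a by (auto simp: hat_def lift_def)
    have vc: "v \<in> carrier (G p)" and wc: "w \<in> carrier (G p)"
      using subgroup.mem_carrier[OF F.subgroup_image_in[OF UV(1)] v]
        subgroup.mem_carrier[OF F.subgroup_image_in[OF UV(2)] w] by simp_all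
    have "frag_of v \<in> hat p U" unfolding hat_def by (rule frag_of_in_lift[OF G_comm v vc])
    moreover have "a - frag_of v \<in> hat p V"
    proof -
      have "ev (G p) (a - frag_of v) = (v \<otimes>\<^bsub>G p\<^esub> w) \<otimes>\<^bsub>G p\<^esub> inv\<^bsub>G p\<^esub> v"
        using ev_diff[OF G_comm hat_keys[OF a], of "frag_of v"] vc by (simp add: vw ev(2)[OF G_comm])
      also have "\<dots> = w" using vc wc by (simp add: G.m_comm[of v w] G.m_assoc)
      finally show ?thesis
        using w hat_keys[OF a] vc keys_diff[of a "frag_of v"] by (auto simp: hat_def lift_def)
    qed
    ultimately show ?thesis by force
  qed
  show "a \<in> hat p (U \<inter> V)" if "a \<in> hat p U" "a \<in> hat p V"
    using that F.image_in_Int[OF UV] by (auto simp: hat_def lift_def)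
next
  fix \<T> a p assume "\<And>T. T \<in> \<T> \<Longrightarrow> openin X T" "a \<in> hat p (\<Union>\<T>)"
  then show "\<exists>J\<subseteq>\<T>. finite J \<and> a \<in> hat p (\<Union>J)"
    using F.image_in_directed[of \<T> "ev (G p) a" p] by (auto simp: hat_def lift_def)
qed

lemma cycle_iff:
  assumes U: "openin X U" and x: "x \<in> carrier (grp (csec A U) (Suc p))"
    and a: "Poly_Mapping.keys a \<subseteq> carrier (G (Suc p))" "ev (G (Suc p)) a = cext A E U (Suc p) x"
  shows "d (Suc p) a \<in> hat p {} \<longleftrightarrow> x \<in> cycles (csec A U) (Suc p)"
proof -
  have "d (Suc p) a \<in> hat p {} \<longleftrightarrow> cext A E U p (bd (csec A U) (Suc p) x) = cext A E U p \<one>\<^bsub>grp (csec A U) p\<^esub>"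
    using a x by (simp add: in_hat_empty_iff keys_d ev_d toE_bd[OF U] toE_one[OF U])
  also have "\<dots> \<longleftrightarrow> bd (csec A U) (Suc p) x = \<one>\<^bsub>grp (csec A U) p\<^esub>"
    using toE_inj[OF U bd_closed[OF U x] monoid.one_closed[OF group.is_monoid[OF complex.group[OF complex[OF U]]]]]
    by auto
  finally show ?thesis using x by (simp add: cycles_def kernel_def)
qed

text \<open>Extension to the whole space is injective, so a bounding relation found among global
  sections holds already over \<open>U\<close>.\<close>

lemma boundary_iff:
  assumes U: "openin X U" and x: "x \<in> carrier (grp (csec A U) p)"
    and a: "Poly_Mapping.keys a \<subseteq> carrier (G p)" "ev (G p) a = cext A E U p x"
  shows "x \<in> boundaries (csec A U) p \<longleftrightarrow> (\<exists>y\<in>hat (Suc p) U. a - d (Suc p) y \<in> hat p {})"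
proof
  assume "x \<in> boundaries (csec A U) p"
  then obtain u where u: "u \<in> carrier (grp (csec A U) (Suc p))" "x = bd (csec A U) (Suc p) u"
    by (auto simp: boundaries_def)
  let ?y = "frag_of (cext A E U (Suc p) u)"
  have y: "?y \<in> hat (Suc p) U" by (rule frag_of_in_hat[OF U u(1)])
  have "ev (G p) a = ev (G p) (d (Suc p) ?y)"
    using u by (simp add: a ev_d[OF hat_keys[OF y]] ev_frag_of[OF U u(1)] toE_bd[OF U])
  then show "\<exists>y\<in>hat (Suc p) U. a - d (Suc p) y \<in> hat p {}"
    using y diff_in_hat_empty_iff[OF a(1) keys_d[OF hat_keys[OF y]]] by blast
next
  assume "\<exists>y\<in>hat (Suc p) U. a - d (Suc p) y \<in> hat p {}"
  then obtain y where y: "y \<in> hat (Suc p) U" "a - d (Suc p) y \<in> hat p {}" by blast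
  then obtain u where u: "u \<in> carrier (grp (csec A U) (Suc p))" "ev (G (Suc p)) y = cext A E U (Suc p) u"
    by (auto simp: in_hat_iff)
  have "cext A E U p x = cext A E U p (bd (csec A U) (Suc p) u)"
    using y diff_in_hat_empty_iff[OF a(1) keys_d[OF hat_keys[OF y(1)]]] u
    by (simp add: a ev_d[OF hat_keys[OF y(1)]] toE_bd[OF U])
  then have "x = bd (csec A U) (Suc p) u"
    by (rule toE_inj[OF U x bd_closed[OF U u(1)]])
  then show "x \<in> boundaries (csec A U) p" using u(1) by (auto simp: boundaries_def)
qed

text \<open>The condition on \<open>\<xi>\<close> is tested over \<open>V\<close> itself:
  \<open>B\<close> need not be flabby, so extension to the whole space could make a nontrivial value
  trivial.\<close>

definition red :: "('a set \<Rightarrow> 'g \<Rightarrow> 'b) \<Rightarrow> ('a, 'b) precosh \<Rightarrow> 'a set \<Rightarrow> ('g \<Rightarrow>\<^sub>0 int) set" where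
  "red \<xi> B V = {a. Poly_Mapping.keys a \<subseteq> carrier (G 0) \<and>
     (\<exists>x\<in>carrier (grp (csec A V) 0). ev (G 0) a = cext A E V 0 x \<and> \<xi> V x = \<one>\<^bsub>sec B V\<^esub>)}"

lemma locally_trivialD:
  assumes lt: "locally_trivial X (reduced_homology_precosh A B \<xi> p)" and U: "openin X U" "t \<in> U"
  shows "\<exists>V. openin X V \<and> t \<in> V \<and> V \<subseteq> U \<and>
    (\<forall>a\<in>hat p V. (if p = 0 then a \<in> red \<xi> B V else d p a \<in> hat (p - 1) {}) \<longrightarrow>
      (\<exists>y\<in>hat (Suc p) U. a - d (Suc p) y \<in> hat p {}))"
proof -
  have "\<exists>V. openin X V \<and> t \<in> V \<and> V \<subseteq> U \<and>
      (\<forall>h\<in>carrier (reduced_homology (csec A V) (sec B V) (\<xi> V) p).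
        homology_map (csec A U) (cext A U V) p h = \<one>\<^bsub>reduced_homology (csec A U) (sec B U) (\<xi> U) p\<^esub>)"
    using lt[unfolded locally_trivial_def, rule_format, of U t] U
    by (simp add: reduced_homology_precosh_def)
  then obtain V where V: "openin X V" "t \<in> V" "V \<subseteq> U"
    and triv: "\<forall>h\<in>carrier (reduced_homology (csec A V) (sec B V) (\<xi> V) p).
      homology_map (csec A U) (cext A U V) p h = \<one>\<^bsub>reduced_homology (csec A U) (sec B U) (\<xi> U) p\<^esub>"
    by (elim exE conjE)
  interpret VU: complex_map "csec A V" "csec A U" "cext A U V"
    by (rule complex_map[OF V(1) U(1) V(3)])
  have "\<exists>y\<in>hat (Suc p) U. a - d (Suc p) y \<in> hat p {}"
    if a: "a \<in> hat p V" and cyc: "if p = 0 then a \<in> red \<xi> B V else d p a \<in> hat (p - 1) {}" for a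
  proof -
    obtain x where x: "x \<in> carrier (grp (csec A V) p)" "ev (G p) a = cext A E V p x"
      using a by (auto simp: in_hat_iff)
    have "x \<in> reduced_cycles (csec A V) (sec B V) (\<xi> V) p"
    proof (cases p)
      case 0
      then have "a \<in> red \<xi> B V" using cyc by simp
      then obtain x' where x': "x' \<in> carrier (grp (csec A V) 0)" "ev (G 0) a = cext A E V 0 x'"
        "\<xi> V x' = \<one>\<^bsub>sec B V\<^esub>" by (auto simp: red_def)
      have "x = x'" using toE_inj[OF V(1), of x 0 x'] x x' 0 by simp
      then show ?thesis using x' 0 by (simp add: reduced_cycles_def kernel_def)
    next
      case (Suc q)
      then have "x \<in> cycles (csec A V) p"
        using cycle_iff[OF V(1), of x q a] x cyc hat_keys[OF a] by simp
      then show ?thesis using Suc by (simp add: reduced_cycles_def)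
    qed
    then have "cext A U V p x \<in> boundaries (csec A U) p"
      by (rule VU.reduced_homology_map_trivial[OF triv _ x(1)])
    then show ?thesis
      using boundary_iff[OF U(1) VU.f_closed[OF x(1)] hat_keys[OF a]] x
      by (simp add: toE_ext[OF V(1) U(1) V(3)])
  qed
  then show ?thesis using V by blast
qed

end

text \<open>Each degree comes with its own neighbourhood; finitely many of them are
  intersected.\<close>

lemma common_nbhd:
  assumes "\<And>q. q \<le> n \<Longrightarrow> \<exists>T. openin X T \<and> x \<in> T \<and> T \<subseteq> V \<and> P q T"
    and mono: "\<And>q S T. P q T \<Longrightarrow> openin X S \<Longrightarrow> openin X T \<Longrightarrow> S \<subseteq> T \<Longrightarrow> P q S"
  shows "\<exists>T. openin X T \<and> x \<in> T \<and> T \<subseteq> V \<and> (\<forall>q\<le>(n::nat). P q T)"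
  using assms(1)
proof (induct n)
  case 0
  from 0[of 0] show ?case by auto
next
  case (Suc n)
  obtain S where S: "openin X S" "x \<in> S" "S \<subseteq> V" "\<forall>q\<le>n. P q S"
    using Suc by (metis le_SucI)
  obtain T where T: "openin X T" "x \<in> T" "T \<subseteq> V" "P (Suc n) T"
    using Suc(2)[of "Suc n"] by auto
  have ST: "openin X (S \<inter> T)" using S T by auto
  have "P q (S \<inter> T)" if "q \<le> Suc n" for q
    using that mono[OF _ ST S(1), of q] mono[OF _ ST T(1), of q] S(4) T(4)
    by (auto simp: le_Suc_eq)
  then show ?case using ST S T by (intro exI[of _ "S \<inter> T"]) auto
qed

lemma reduced_homology_precosh_pos:
  "0 < p \<Longrightarrow> reduced_homology_precosh A B \<xi> p = homology_precosh A p"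
  by (simp add: reduced_homology_precosh_def homology_precosh_def reduced_homology_def homology_def
      reduced_cycles_def)

section \<open>The comparison map and its mapping cone\<close>

locale comparison = A: flabby_complex X A + A': flabby_complex X A'
  for X :: "'a topology" and A :: "('a, 'g) cprecosh" and A' :: "('a, 'h) cprecosh" +
  fixes B :: "('a, 'b) precosh" and B' :: "('a, 'c) precosh"
    and \<eta> :: "'a set \<Rightarrow> nat \<Rightarrow> 'g \<Rightarrow> 'h" and \<zeta> :: "'a set \<Rightarrow> 'b \<Rightarrow> 'c"
    and \<xi> :: "'a set \<Rightarrow> 'g \<Rightarrow> 'b" and \<xi>' :: "'a set \<Rightarrow> 'h \<Rightarrow> 'c"
  assumes \<eta>: "cnat_transf X A A' \<eta>"
    and B: "precosheaf X B" and B': "precosheaf X B'"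
    and \<zeta>: "nat_transf X B B' \<zeta>" and \<xi>: "nat_transf X (cdeg A 0) B \<xi>"
    and square: "openin X U \<Longrightarrow> x \<in> carrier (grp (csec A U) 0) \<Longrightarrow> \<xi>' U (\<eta> U 0 x) = \<zeta> U (\<xi> U x)"
    and aug: "caugmentation X A B \<xi>" and aug': "caugmentation X A' B' \<xi>'"
    and surj: "openin X U \<Longrightarrow> \<eta> U 0 ` carrier (grp (csec A U) 0) = carrier (grp (csec A' U) 0)"
    and inj: "openin X U \<Longrightarrow> inj_on (\<zeta> U) (carrier (sec B U))"
begin

lemma complex_map: "openin X U \<Longrightarrow> complex_map (csec A U) (csec A' U) (\<eta> U)"
  using \<eta> A.complex[of U] A'.complex[of U]
  by (simp add: cnat_transf_def complex_map_def complex_map_axioms_def)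

lemma \<eta>_nat: "openin X U \<Longrightarrow> x \<in> carrier (grp (csec A U) p) \<Longrightarrow>
    \<eta> (topspace X) p (cext A (topspace X) U p x) = cext A' (topspace X) U p (\<eta> U p x)"
  using \<eta> openin_subset[of X U] by (simp add: cnat_transf_def nat_transf_def cdeg_def)

definition h :: "nat \<Rightarrow> ('g \<Rightarrow>\<^sub>0 int) \<Rightarrow> 'h \<Rightarrow>\<^sub>0 int" where
  "h p = push (\<eta> (topspace X) p)"

lemma additive_h: "Modules.additive (h p)"
  unfolding h_def by (rule additive_push)

lemma keys_h: "Poly_Mapping.keys a \<subseteq> carrier (A.G p) \<Longrightarrow> Poly_Mapping.keys (h p a) \<subseteq> carrier (A'.G p)"
  and ev_h: "Poly_Mapping.keys a \<subseteq> carrier (A.G p) \<Longrightarrow>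
    ev (A'.G p) (h p a) = \<eta> (topspace X) p (ev (A.G p) a)"
  unfolding h_def
  using push_hom[OF A.G_comm A'.G_comm complex_map.f_hom[OF complex_map[of "topspace X"]]] by simp_all

lemma h_hat:
  assumes V: "openin X V" and a: "a \<in> A.hat p V"
  shows "h p a \<in> A'.hat p V"
proof -
  obtain x where x: "x \<in> carrier (grp (csec A V) p)" "ev (A.G p) a = cext A (topspace X) V p x"
    using a by (auto simp: A.in_hat_iff)
  have "\<eta> V p x \<in> carrier (grp (csec A' V) p)"
    by (rule complex_map.f_closed[OF complex_map[OF V] x(1)])
  moreover have "ev (A'.G p) (h p a) = cext A' (topspace X) V p (\<eta> V p x)"
    by (simp add: ev_h[OF A.hat_keys[OF a]] x(2) \<eta>_nat[OF V x(1)])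
  ultimately show ?thesis
    using keys_h[OF A.hat_keys[OF a]] by (auto simp: A'.in_hat_iff)
qed

lemma h_d:
  assumes "Poly_Mapping.keys a \<subseteq> carrier (A.G (Suc p))"
  shows "h p (A.d (Suc p) a) - A'.d (Suc p) (h (Suc p) a) \<in> A'.hat p {}"
  by (subst A'.diff_in_hat_empty_iff)
    (simp_all add: assms keys_h A.keys_d A'.keys_d ev_h A.ev_d A'.ev_d
      complex_map.f_bd[OF complex_map] ev_closed[OF A.G_comm])

lemma h_surj:
  assumes V: "openin X V" and b: "b \<in> A'.hat 0 V"
  shows "\<exists>a\<in>A.hat 0 V. b - h 0 a \<in> A'.hat 0 {}"
proof -
  obtain y where y: "y \<in> carrier (grp (csec A' V) 0)" "ev (A'.G 0) b = cext A' (topspace X) V 0 y"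
    using b by (auto simp: A'.in_hat_iff)
  obtain x where x: "x \<in> carrier (grp (csec A V) 0)" "y = \<eta> V 0 x"
    using y(1) surj[OF V] by blast
  let ?a = "frag_of (cext A (topspace X) V 0 x)"
  have a: "?a \<in> A.hat 0 V" by (rule A.frag_of_in_hat[OF V x(1)])
  have "ev (A'.G 0) b = ev (A'.G 0) (h 0 ?a)"
    by (simp add: ev_h[OF A.hat_keys[OF a]] A.ev_frag_of[OF V x(1)] y(2) x \<eta>_nat[OF V x(1)])
  then show ?thesis
    using a A'.diff_in_hat_empty_iff[OF A'.hat_keys[OF b] keys_h[OF A.hat_keys[OF a]]] by blast
qed

lemma sub': "subgrp (A'.hat p {})" and sub: "subgrp (A.hat p {})"
  by (rule A'.hat.subgrp A.hat.subgrp; simp)+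

abbreviation R :: "'a set \<Rightarrow> ('g \<Rightarrow>\<^sub>0 int) set" where
  "R \<equiv> A.red \<xi> B"

lemma R_subset: "R V \<subseteq> A.hat 0 V"
  by (auto simp: A.red_def A.in_hat_iff)

lemma in_R_iff:
  assumes "openin X V" "x \<in> carrier (grp (csec A V) 0)" "ev (A.G 0) a = cext A (topspace X) V 0 x"
    "Poly_Mapping.keys a \<subseteq> carrier (A.G 0)"
  shows "a \<in> R V \<longleftrightarrow> \<xi> V x = \<one>\<^bsub>sec B V\<^esub>"
  using assms A.toE_inj[OF assms(1,2)] by (auto simp: A.red_def)

lemma \<xi>_hom: "openin X V \<Longrightarrow> \<xi> V \<in> hom (grp (csec A V) 0) (sec B V)"
  using \<xi> by (simp add: nat_transf_def cdeg_def)

lemma group_hom_\<xi>: "openin X V \<Longrightarrow> group_hom (grp (csec A V) 0) (sec B V) (\<xi> V)"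
  using \<xi>_hom[of V] complex.group[OF A.complex[of V], of 0] B
  by (simp add: group_hom_def group_hom_axioms_def precosheaf_def comm_group.axioms(2))

lemma hat_empty_subset_R:
  assumes V: "openin X V"
  shows "A.hat 0 {} \<subseteq> R V"
proof
  fix a assume a: "a \<in> A.hat 0 {}"
  interpret group_hom "grp (csec A V) 0" "sec B V" "\<xi> V" by (rule group_hom_\<xi>[OF V])
  show "a \<in> R V"
    using a in_R_iff[OF V G.one_closed, of a] by (simp add: A.in_hat_empty_iff A.toE_one[OF V])
qed

lemma R_mono:
  assumes VW: "openin X V" "openin X W" "V \<subseteq> W"
  shows "R V \<subseteq> R W"
proof
  fix a assume a: "a \<in> R V"
  then obtain x where x: "x \<in> carrier (grp (csec A V) 0)" "ev (A.G 0) a = cext A (topspace X) V 0 x"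
    "\<xi> V x = \<one>\<^bsub>sec B V\<^esub>" by (auto simp: A.red_def)
  have "\<xi> W (cext A W V 0 x) = ext B W V \<one>\<^bsub>sec B V\<^esub>"
    using \<xi> VW x by (simp add: nat_transf_def cdeg_def)
  also have "\<dots> = \<one>\<^bsub>sec B W\<^esub>"
    using B VW by (intro hom_one) (auto simp: precosheaf_def comm_group.axioms(2))
  finally show "a \<in> R W"
    using in_R_iff[OF VW(2) A.ext_closed[OF VW x(1)], of a] x a A.toE_ext[OF VW x(1)]
    by (simp add: A.red_def)
qed

lemma subgrp_R:
  assumes V: "openin X V"
  shows "subgrp (R V)"
proof -
  interpret \<xi>: group_hom "grp (csec A V) 0" "sec B V" "\<xi> V" by (rule group_hom_\<xi>[OF V])
  interpret e: group_hom "grp (csec A V) 0" "A.G 0" "cext A (topspace X) V 0"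
    using complex_map.group_hom_f[OF A.complex_map[OF V _ openin_subset[OF V]]] by simp
  have "a - b \<in> R V" if "a \<in> R V" "b \<in> R V" for a b
  proof -
    obtain x where x: "x \<in> carrier (grp (csec A V) 0)" "ev (A.G 0) a = cext A (topspace X) V 0 x"
      "\<xi> V x = \<one>\<^bsub>sec B V\<^esub>" using \<open>a \<in> R V\<close> by (auto simp: A.red_def)
    obtain y where y: "y \<in> carrier (grp (csec A V) 0)" "ev (A.G 0) b = cext A (topspace X) V 0 y"
      "\<xi> V y = \<one>\<^bsub>sec B V\<^esub>" using \<open>b \<in> R V\<close> by (auto simp: A.red_def)
    have k: "Poly_Mapping.keys a \<subseteq> carrier (A.G 0)" "Poly_Mapping.keys b \<subseteq> carrier (A.G 0)"
      using that by (auto simp: A.red_def)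
    then have "Poly_Mapping.keys (a - b) \<subseteq> carrier (A.G 0)" using keys_diff[of a b] by blast
    moreover have "ev (A.G 0) (a - b) = cext A (topspace X) V 0 (x \<otimes>\<^bsub>grp (csec A V) 0\<^esub> inv\<^bsub>grp (csec A V) 0\<^esub> y)"
      using x y k by (simp add: ev_diff[OF A.G_comm])
    moreover have "\<xi> V (x \<otimes>\<^bsub>grp (csec A V) 0\<^esub> inv\<^bsub>grp (csec A V) 0\<^esub> y) = \<one>\<^bsub>sec B V\<^esub>"
      using x y by simp
    ultimately show ?thesis
      using in_R_iff[OF V, of "x \<otimes>\<^bsub>grp (csec A V) 0\<^esub> inv\<^bsub>grp (csec A V) 0\<^esub> y" "a - b"] x y by simp
  qed
  moreover have "0 \<in> R V" using subgrp_0[OF sub] hat_empty_subset_R[OF V] by blast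
  ultimately show ?thesis by (simp add: subgrp_def)
qed

lemma d_in_R:
  assumes V: "openin X V" and a: "a \<in> A.hat (Suc 0) V"
  shows "A.d (Suc 0) a \<in> R V"
proof -
  obtain x where x: "x \<in> carrier (grp (csec A V) (Suc 0))" "ev (A.G (Suc 0)) a = cext A (topspace X) V (Suc 0) x"
    using a by (auto simp: A.in_hat_iff)
  have "\<xi> V (bd (csec A V) (Suc 0) x) = \<one>\<^bsub>sec B V\<^esub>"
    using aug V x(1) by (simp add: caugmentation_def augmentation_of_def)
  then show ?thesis
    using in_R_iff[OF V A.bd_closed[OF V x(1)], of "A.d (Suc 0) a"] A.hat_keys[OF a] x
    by (simp add: A.keys_d A.ev_d A.toE_bd[OF V])
qed

text \<open>This is where injectivity of \<open>\<zeta>\<close> enters.\<close>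

lemma in_R_if_bounds:
  assumes V: "openin X V" and a: "a \<in> A.hat 0 V" and b: "b \<in> A'.hat (Suc 0) V"
    and ab: "h 0 a - A'.d (Suc 0) b \<in> A'.hat 0 {}"
  shows "a \<in> R V"
proof -
  interpret \<xi>: group_hom "grp (csec A V) 0" "sec B V" "\<xi> V" by (rule group_hom_\<xi>[OF V])
  obtain x where x: "x \<in> carrier (grp (csec A V) 0)" "ev (A.G 0) a = cext A (topspace X) V 0 x"
    using a by (auto simp: A.in_hat_iff)
  obtain y where y: "y \<in> carrier (grp (csec A' V) (Suc 0))" "ev (A'.G (Suc 0)) b = cext A' (topspace X) V (Suc 0) y"
    using b by (auto simp: A'.in_hat_iff)
  have "cext A' (topspace X) V 0 (\<eta> V 0 x) = cext A' (topspace X) V 0 (bd (csec A' V) (Suc 0) y)"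
    using ab A'.diff_in_hat_empty_iff[OF keys_h[OF A.hat_keys[OF a]] A'.keys_d[OF A'.hat_keys[OF b]]]
    by (simp add: ev_h[OF A.hat_keys[OF a]] A'.ev_d[OF A'.hat_keys[OF b]] x y \<eta>_nat[OF V x(1)] A'.toE_bd[OF V y(1)])
  then have "\<eta> V 0 x = bd (csec A' V) (Suc 0) y"
    by (rule A'.toE_inj[OF V complex_map.f_closed[OF complex_map[OF V] x(1)] A'.bd_closed[OF V y(1)]])
  then have "\<zeta> V (\<xi> V x) = \<one>\<^bsub>sec B' V\<^esub>"
    using aug' V y(1) square[OF V x(1)] by (simp add: caugmentation_def augmentation_of_def)
  moreover have "\<zeta> V \<one>\<^bsub>sec B V\<^esub> = \<one>\<^bsub>sec B' V\<^esub>"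
    using \<zeta> B B' V by (intro hom_one) (auto simp: nat_transf_def precosheaf_def comm_group.axioms(2))
  ultimately have "\<xi> V x = \<one>\<^bsub>sec B V\<^esub>"
    using inj_onD[OF inj[OF V], of "\<xi> V x" "\<one>\<^bsub>sec B V\<^esub>"] \<xi>.hom_closed[OF x(1)] by simp
  then show ?thesis using in_R_iff[OF V x A.hat_keys[OF a]] by simp
qed

text \<open>The condition for \<open>p = 0\<close> says that the first component of
  \<open>dD\<close> vanishes. Every chain of degree 0 thus counts as a cycle, which is how the
  comparison principle treats degree 0.\<close>

definition D :: "nat \<Rightarrow> 'a set \<Rightarrow> (('h \<Rightarrow>\<^sub>0 int) \<times> ('g \<Rightarrow>\<^sub>0 int)) set" where
  "D p V = {(y, z). y \<in> A'.hat (Suc p) V \<and> z \<in> A.hat p V \<and>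
     (p = 0 \<longrightarrow> h 0 z - A'.d (Suc 0) y \<in> A'.hat 0 {})}"

definition dD :: "nat \<Rightarrow> ('h \<Rightarrow>\<^sub>0 int) \<times> ('g \<Rightarrow>\<^sub>0 int) \<Rightarrow> ('h \<Rightarrow>\<^sub>0 int) \<times> ('g \<Rightarrow>\<^sub>0 int)" where
  "dD p c = (h p (snd c) - A'.d (Suc p) (fst c), A.d p (snd c))"

lemma empty_subset': "openin X V \<Longrightarrow> b \<in> A'.hat p {} \<Longrightarrow> b \<in> A'.hat p V"
  using A'.hat.mono[of "{}" V p] by auto

text \<open>The first component of the square of \<open>dD\<close>: the mixed terms cancel as
  \<open>h\<close> is a chain map. It is also the degree 0 condition for the boundary of a chain of
  degree 1.\<close>

lemma h_dd:
  assumes V: "openin X V" and y: "y \<in> A'.hat (Suc (Suc p)) V" and z: "z \<in> A.hat (Suc p) V"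
  shows "h p (A.d (Suc p) z) - A'.d (Suc p) (h (Suc p) z - A'.d (Suc (Suc p)) y) \<in> A'.hat p {}"
proof -
  have "(h p (A.d (Suc p) z) - A'.d (Suc p) (h (Suc p) z)) + A'.d (Suc p) (A'.d (Suc (Suc p)) y) \<in> A'.hat p {}"
    by (intro subgrp_add[OF sub'] h_d A.hat_keys[OF z] A'.hat.bd_bd[OF V y])
  then show ?thesis by (simp add: additive.diff[OF A'.additive_d] algebra_simps)
qed

text \<open>Everything is componentwise except splitting over a union in degree 0. There the halves
  violate the kernel condition by opposite errors, which hence lie over \<open>U \<inter> V\<close>.
  Surjectivity of \<open>\<eta>\<close> lifts the error to some \<open>t\<close> over
  \<open>U \<inter> V\<close>, and moving \<open>t\<close> from one half to the other repairs
  both.\<close>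

lemma open_flabby_family_D: "open_flabby_family X D dD"
proof
  show "subgrp (D p V)" if V: "openin X V" for p V
    unfolding subgrp_def
  proof (intro conjI ballI)
    show "0 \<in> D p V"
      by (simp add: D_def zero_prod_def additive.zero[OF additive_h] additive.zero[OF A'.additive_d]
          subgrp_0[OF A'.hat.subgrp[OF V]] subgrp_0[OF A.hat.subgrp[OF V]] subgrp_0[OF sub'])
    fix c c' assume "c \<in> D p V" "c' \<in> D p V"
    then obtain y z y' z' where c: "c = (y, z)" "c' = (y', z')"
      and yz: "y \<in> A'.hat (Suc p) V" "z \<in> A.hat p V" "p = 0 \<Longrightarrow> h 0 z - A'.d (Suc 0) y \<in> A'.hat 0 {}"
      and yz': "y' \<in> A'.hat (Suc p) V" "z' \<in> A.hat p V" "p = 0 \<Longrightarrow> h 0 z' - A'.d (Suc 0) y' \<in> A'.hat 0 {}"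
      by (auto simp: D_def)
    have "h 0 (z - z') - A'.d (Suc 0) (y - y') \<in> A'.hat 0 {}" if "p = 0"
      using subgrp_diff[OF sub' yz(3)[OF that] yz'(3)[OF that]]
      by (simp add: additive.diff[OF additive_h] additive.diff[OF A'.additive_d] algebra_simps)
    then show "c - c' \<in> D p V"
      using yz yz' by (simp add: c D_def subgrp_diff[OF A'.hat.subgrp[OF V]] subgrp_diff[OF A.hat.subgrp[OF V]])
  qed
  show "D p U \<subseteq> D p V" if "openin X U" "openin X V" "U \<subseteq> V" for p U V
    using A.hat.mono[OF that] A'.hat.mono[OF that] by (auto simp: D_def)
  show "dD p (c + c') = dD p c + dD p c'" for p c c'
    by (simp add: dD_def additive.add[OF additive_h] additive.add[OF A'.additive_d] additive.add[OF A.additive_d])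
  show "dD (Suc p) c \<in> D p V" if V: "openin X V" and c: "c \<in> D (Suc p) V" for p c V
  proof -
    obtain y z where yz: "c = (y, z)" "y \<in> A'.hat (Suc (Suc p)) V" "z \<in> A.hat (Suc p) V"
      using c by (auto simp: D_def)
    show ?thesis
      using h_dd[OF V, of y p z] yz
      by (auto simp: D_def dD_def intro!: subgrp_diff[OF A'.hat.subgrp[OF V]] h_hat[OF V] A'.d_hat[OF V] A.d_hat[OF V])
  qed
  show "dD (Suc p) (dD (Suc (Suc p)) c) \<in> D p {}" if V: "openin X V" and c: "c \<in> D (Suc (Suc p)) V" for p c V
  proof -
    obtain y z where yz: "c = (y, z)" "y \<in> A'.hat (Suc (Suc (Suc p))) V" "z \<in> A.hat (Suc (Suc p)) V"
      using c by (auto simp: D_def)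
    have 1: "h (Suc p) (A.d (Suc (Suc p)) z) - A'.d (Suc (Suc p)) (h (Suc (Suc p)) z - A'.d (Suc (Suc (Suc p))) y)
        \<in> A'.hat (Suc p) {}" by (rule h_dd[OF V yz(2,3)])
    have 2: "A.d (Suc p) (A.d (Suc (Suc p)) z) \<in> A.hat p {}" by (rule A.hat.bd_bd[OF V yz(3)])
    have "h p (A.d (Suc p) (A.d (Suc (Suc p)) z)) - A'.d (Suc p)
        (h (Suc p) (A.d (Suc (Suc p)) z) - A'.d (Suc (Suc p)) (h (Suc (Suc p)) z - A'.d (Suc (Suc (Suc p))) y))
        \<in> A'.hat p {}"
      by (intro subgrp_diff[OF sub'] h_hat A'.d_hat 1 2) simp_all
    then show ?thesis using 1 2 by (auto simp: yz(1) D_def dD_def)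
  qed
next
  fix U V c p assume U: "openin X U" and V: "openin X V"
  show "\<exists>a\<in>D p U. \<exists>b\<in>D p V. c = a + b" if "c \<in> D p (U \<union> V)"
  proof -
    obtain y z where c: "c = (y, z)" and y: "y \<in> A'.hat (Suc p) (U \<union> V)" and z: "z \<in> A.hat p (U \<union> V)"
      and yz: "p = 0 \<Longrightarrow> h 0 z - A'.d (Suc 0) y \<in> A'.hat 0 {}"
      using \<open>c \<in> D p (U \<union> V)\<close> by (auto simp: D_def)
    obtain y1 y2 where y12: "y1 \<in> A'.hat (Suc p) U" "y2 \<in> A'.hat (Suc p) V" "y = y1 + y2"
      using A'.hat.Un[OF U V y] by blast
    obtain z1 z2 where z12: "z1 \<in> A.hat p U" "z2 \<in> A.hat p V" "z = z1 + z2"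
      using A.hat.Un[OF U V z] by blast
    show ?thesis
    proof (cases "p = 0")
      case False
      then have "(y1, z1) \<in> D p U" "(y2, z2) \<in> D p V" "c = (y1, z1) + (y2, z2)"
        using y12 z12 by (auto simp: D_def c)
      then show ?thesis by blast
    next
      case True
      let ?e1 = "h 0 z1 - A'.d (Suc 0) y1" and ?e2 = "h 0 z2 - A'.d (Suc 0) y2"
      have UV: "openin X (U \<inter> V)" using U V by auto
      have e1: "?e1 \<in> A'.hat 0 U"
        using y12 z12 True by (auto intro!: subgrp_diff[OF A'.hat.subgrp[OF U]] h_hat[OF U] A'.d_hat[OF U])
      have e2: "?e2 \<in> A'.hat 0 V"
        using y12 z12 True by (auto intro!: subgrp_diff[OF A'.hat.subgrp[OF V]] h_hat[OF V] A'.d_hat[OF V])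
      have e12: "?e1 + ?e2 \<in> A'.hat 0 {}"
        using yz[OF True]
        by (simp add: y12 z12 additive.add[OF additive_h] additive.add[OF A'.additive_d] algebra_simps)
      have "(?e1 + ?e2) - ?e2 \<in> A'.hat 0 V"
        by (rule subgrp_diff[OF A'.hat.subgrp[OF V] empty_subset'[OF V e12] e2])
      then have "?e1 \<in> A'.hat 0 (U \<inter> V)"
        by (intro A'.hat.Int[OF U V e1]) simp
      then obtain t where t: "t \<in> A.hat 0 (U \<inter> V)" "?e1 - h 0 t \<in> A'.hat 0 {}"
        using h_surj[OF UV] by blast
      have tU: "t \<in> A.hat 0 U" and tV: "t \<in> A.hat 0 V"
        using t(1) A.hat.mono[OF UV U] A.hat.mono[OF UV V] by auto
      have 1: "h 0 (z1 - t) - A'.d (Suc 0) y1 \<in> A'.hat 0 {}"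
        using t(2) by (simp add: additive.diff[OF additive_h] algebra_simps)
      have 2: "h 0 (z2 + t) - A'.d (Suc 0) y2 \<in> A'.hat 0 {}"
        using subgrp_diff[OF sub' e12 t(2)] by (simp add: additive.add[OF additive_h] algebra_simps)
      have "(y1, z1 - t) \<in> D p U" "(y2, z2 + t) \<in> D p V" "c = (y1, z1 - t) + (y2, z2 + t)"
        using y12 z12 tU tV 1 2 True
        by (auto simp: D_def c intro: subgrp_diff[OF A.hat.subgrp[OF U]] subgrp_add[OF A.hat.subgrp[OF V]])
      then show ?thesis by blast
    qed
  qed
  show "c \<in> D p (U \<inter> V)" if "c \<in> D p U" "c \<in> D p V"
    using that A.hat.Int[OF U V] A'.hat.Int[OF U V] by (auto simp: D_def)
next
  fix \<T> c p assume T: "\<And>T. T \<in> \<T> \<Longrightarrow> openin X T" and "c \<in> D p (\<Union>\<T>)"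
  then obtain y z where c: "c = (y, z)" and y: "y \<in> A'.hat (Suc p) (\<Union>\<T>)" and z: "z \<in> A.hat p (\<Union>\<T>)"
    and yz: "p = 0 \<Longrightarrow> h 0 z - A'.d (Suc 0) y \<in> A'.hat 0 {}"
    by (auto simp: D_def)
  obtain J where J: "J \<subseteq> \<T>" "finite J" "y \<in> A'.hat (Suc p) (\<Union>J)" using A'.hat.directed[OF T y] by blast
  obtain K where K: "K \<subseteq> \<T>" "finite K" "z \<in> A.hat p (\<Union>K)" using A.hat.directed[OF T z] by blast
  have "openin X (\<Union>J)" "openin X (\<Union>K)" "openin X (\<Union>(J \<union> K))"
    using J(1) K(1) T by (auto intro!: openin_Union)
  then have "y \<in> A'.hat (Suc p) (\<Union>(J \<union> K))" "z \<in> A.hat p (\<Union>(J \<union> K))"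
    using A'.hat.mono[of "\<Union>J" "\<Union>(J \<union> K)" "Suc p"] A.hat.mono[of "\<Union>K" "\<Union>(J \<union> K)" p] J K by auto
  then have "c \<in> D p (\<Union>(J \<union> K))" using yz by (auto simp: D_def c)
  then show "\<exists>J\<subseteq>\<T>. finite J \<and> c \<in> D p (\<Union>J)"
    using J K by (intro exI[of _ "J \<union> K"]) auto
qed

text \<open>If \<open>b\<close> bounds the image of a cycle represented by \<open>a\<close>, then
  \<open>(b, a)\<close> is a cycle of \<open>D\<close>, and the principle says that its projection
  \<open>a\<close> bounds.\<close>

lemma injective_part:
  assumes lt: "\<And>p. p \<le> m \<Longrightarrow> locally_trivial X (reduced_homology_precosh A B \<xi> p)"
    and U: "openin X U"
  shows "inj_on (homology_map (csec A' U) (\<eta> U) m) (carrier (homology (csec A U) m))"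
proof (rule complex_map.inj_on_homology_map[OF complex_map[OF U]])
  interpret U: complex_map "csec A U" "csec A' U" "\<eta> U" by (rule complex_map[OF U])
  fix z assume z: "z \<in> cycles (csec A U) m" and \<eta>z: "\<eta> U m z \<in> boundaries (csec A' U) m"
  have zc: "z \<in> carrier (grp (csec A U) m)" by (rule U.cycles_carrier[OF z])
  define a where "a = frag_of (cext A (topspace X) U m z)"
  have a: "a \<in> A.hat m U" unfolding a_def by (rule A.frag_of_in_hat[OF U zc])
  have ev_a: "ev (A.G m) a = cext A (topspace X) U m z" unfolding a_def by (rule A.ev_frag_of[OF U zc])
  obtain b where b: "b \<in> A'.hat (Suc m) U" "h m a - A'.d (Suc m) b \<in> A'.hat m {}"
    using A'.boundary_iff[OF U U.f_closed[OF zc] keys_h[OF A.hat_keys[OF a]]] \<eta>z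
    by (auto simp: ev_h[OF A.hat_keys[OF a]] ev_a \<eta>_nat[OF U zc])
  have da: "A.d m a \<in> A.hat (m - 1) {}" if "0 < m"
  proof -
    from that obtain q where q: "m = Suc q" by (cases m) auto
    show ?thesis
      using A.cycle_iff[OF U, of z q a] zc z A.hat_keys[OF a] ev_a unfolding q by simp
  qed
  \<comment> \<open>In degree 0 the local hypothesis concerns only chains killed by
    \<open>\<xi>\<close>. Restricting to these lets every chain of degree 0 be bounded
    locally.\<close>
  define F where "F p V = (if p = 0 then R V else A.hat p V)" for p V
  have F_sub: "F p V \<subseteq> A.hat p V" for p V using R_subset by (auto simp: F_def)
  have F_empty: "A.hat p {} \<subseteq> F p V" if "openin X V" for p V
    using hat_empty_subset_R[OF that] A.hat.mono[of "{}" V p] that by (auto simp: F_def)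
  have F_eq: "F p {} = A.hat p {}" for p by (intro equalityI F_sub F_empty) simp
  have "open_family X F A.d"
  proof
    show "subgrp (F p V)" if V: "openin X V" for p V
    proof (cases "p = 0")
      case True
      then show ?thesis by (simp add: F_def subgrp_R[OF V])
    qed (simp add: F_def A.hat.subgrp[OF V])
    show "F p V \<subseteq> F p W" if "openin X V" "openin X W" "V \<subseteq> W" for p V W
    proof -
      show ?thesis using A.hat.mono[OF that] R_mono[OF that] by (auto simp: F_def)
    qed
    show "A.d p (x + y) = A.d p x + A.d p y" for p x y by (rule additive.add[OF A.additive_d])
    show "A.d (Suc p) x \<in> F p V" if "openin X V" "x \<in> F (Suc p) V" for p x V
      using that d_in_R[of V x] A.d_hat[of V x p] by (auto simp: F_def)
    show "A.d (Suc p) (A.d (Suc (Suc p)) x) \<in> F p {}" if "openin X V" "x \<in> F (Suc (Suc p)) V" for p x V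
      using that A.hat.bd_bd[of V x p] unfolding F_eq by (simp add: F_def)
  qed
  note fam = this
  have "\<exists>u\<in>F (Suc m) U. snd (b, a) - A.d (Suc m) u \<in> F m {}"
  proof (rule cycles_bound_open[OF open_flabby_family_D fam, where f = "\<lambda>p. snd" and n = m])
    show "Modules.additive (snd :: ('h \<Rightarrow>\<^sub>0 int) \<times> ('g \<Rightarrow>\<^sub>0 int) \<Rightarrow> _)" by unfold_locales simp
    show "snd c \<in> F p V" if "openin X V" "c \<in> D p V" for V p c
      using that in_R_if_bounds[OF that(1), of "snd c" "fst c"] by (auto simp: D_def F_def)
    show "snd (dD (Suc p) c) - A.d (Suc p) (snd c) \<in> F p {}" for p c
      using subgrp_0[OF sub] by (simp add: dD_def F_eq)
    show "openin X U" by (rule U)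
    show "(b, a) \<in> D m U" using a b by (auto simp: D_def)
    show "0 < m \<longrightarrow> dD m (b, a) \<in> D (m - 1) {}"
    proof
      assume "0 < m"
      then obtain q where q: "m = Suc q" by (cases m) auto
      have "A.d (Suc q) a \<in> A.hat q {}" using da q by simp
      moreover have "h (Suc q) a - A'.d (Suc (Suc q)) b \<in> A'.hat (Suc q) {}" using b(2) q by simp
      moreover have "h q (A.d (Suc q) a) - A'.d (Suc q) (h (Suc q) a - A'.d (Suc (Suc q)) b) \<in> A'.hat q {}"
        using h_dd[OF U, of b q a] a b(1) q by simp
      ultimately show "dD m (b, a) \<in> D (m - 1) {}" by (auto simp: q D_def dD_def)
    qed
    fix x V assume V: "openin X V" "x \<in> V"
    have "\<exists>T. openin X T \<and> x \<in> T \<and> T \<subseteq> V \<and> (\<forall>q\<le>m. \<forall>g\<in>F q T. (0 < q \<longrightarrow> A.d q g \<in> F (q - 1) {}) \<longrightarrow>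
        (\<exists>u\<in>F (Suc q) V. g - A.d (Suc q) u \<in> F q {}))"
    proof (rule common_nbhd)
      fix q assume "q \<le> m"
      from A.locally_trivialD[OF lt[OF this] V]
      obtain T where T: "openin X T" "x \<in> T" "T \<subseteq> V"
        and die: "\<forall>a\<in>A.hat q T. (if q = 0 then a \<in> R T else A.d q a \<in> A.hat (q - 1) {}) \<longrightarrow>
          (\<exists>y\<in>A.hat (Suc q) V. a - A.d (Suc q) y \<in> A.hat q {})"
        by (elim exE conjE)
      have "\<exists>u\<in>F (Suc q) V. g - A.d (Suc q) u \<in> F q {}"
        if "g \<in> F q T" "0 < q \<longrightarrow> A.d q g \<in> F (q - 1) {}" for g
        using die that F_sub[of q T] unfolding F_eq by (auto simp: F_def split: if_splits)
      then show "\<exists>T. openin X T \<and> x \<in> T \<and> T \<subseteq> V \<and> (\<forall>g\<in>F q T. (0 < q \<longrightarrow> A.d q g \<in> F (q - 1) {}) \<longrightarrow>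
          (\<exists>u\<in>F (Suc q) V. g - A.d (Suc q) u \<in> F q {}))"
        using T by blast
    next
      fix q S T assume P: "\<forall>g\<in>F q T. (0 < q \<longrightarrow> A.d q g \<in> F (q - 1) {}) \<longrightarrow>
          (\<exists>u\<in>F (Suc q) V. g - A.d (Suc q) u \<in> F q {})" and ST: "openin X S" "openin X T" "S \<subseteq> T"
      show "\<forall>g\<in>F q S. (0 < q \<longrightarrow> A.d q g \<in> F (q - 1) {}) \<longrightarrow>
          (\<exists>u\<in>F (Suc q) V. g - A.d (Suc q) u \<in> F q {})"
        using P open_family.mono[OF fam ST, of q] by blast
    qed
    then show "\<exists>T. openin X T \<and> x \<in> T \<and> T \<subseteq> V \<and> (\<forall>q\<le>m. \<forall>g\<in>F q T. (0 < q \<longrightarrow> A.d q g \<in> F (q - 1) {}) \<longrightarrow>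
        (\<exists>u\<in>F (Suc q) V. g - A.d (Suc q) u \<in> F q {}))" .
  qed
  then show "z \<in> boundaries (csec A U) m"
    using A.boundary_iff[OF U zc A.hat_keys[OF a] ev_a] by (simp add: F_eq) (simp add: F_def)
qed

text \<open>A cycle represented by \<open>b\<close> gives the cycle \<open>(b, 0)\<close> of
  \<open>D\<close>. If it is the boundary of \<open>(t, u)\<close>, then \<open>u\<close> is a cycle
  and \<open>b\<close> differs from its image by a boundary. The local acyclicity of
  \<open>D\<close> is assembled from that of the two complexes.\<close>

lemma surjective_part:
  assumes lt: "\<And>p. p < m \<Longrightarrow> locally_trivial X (reduced_homology_precosh A B \<xi> p)"
    and lt': "\<And>q. 1 \<le> q \<Longrightarrow> q \<le> m \<Longrightarrow> locally_trivial X (homology_precosh A' q)"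
    and U: "openin X U"
  shows "homology_map (csec A' U) (\<eta> U) m ` carrier (homology (csec A U) m) = carrier (homology (csec A' U) m)"
proof (rule complex_map.surj_homology_map[OF complex_map[OF U]])
  interpret U: complex_map "csec A U" "csec A' U" "\<eta> U" by (rule complex_map[OF U])
  fix y assume y: "y \<in> cycles (csec A' U) m"
  have yc: "y \<in> carrier (grp (csec A' U) m)" using subgroup.mem_carrier[OF U.D.subgroup_cycles y] .
  show "\<exists>z\<in>cycles (csec A U) m. y \<otimes>\<^bsub>grp (csec A' U) m\<^esub> inv\<^bsub>grp (csec A' U) m\<^esub> \<eta> U m z \<in> boundaries (csec A' U) m"
  \<comment> \<open>The first component of \<open>D\<close> starts in degree 1, so degree 0 is
    settled directly by surjectivity of \<open>\<eta>\<close>.\<close>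
  proof (cases m)
    case 0
    then obtain z where "z \<in> carrier (grp (csec A U) 0)" "y = \<eta> U 0 z" using surj[OF U] yc by blast
    then show ?thesis
      using yc subgroup.one_closed[OF U.D.subgroup_boundaries[of 0]] group.r_inv[OF U.D.group[of 0], of y]
      by (intro bexI[of _ z]) (auto simp: 0 cycles_def)
  next
    case (Suc n)
    define b where "b = frag_of (cext A' (topspace X) U m y)"
    have b: "b \<in> A'.hat m U" unfolding b_def by (rule A'.frag_of_in_hat[OF U yc])
    have ev_b: "ev (A'.G m) b = cext A' (topspace X) U m y" unfolding b_def by (rule A'.ev_frag_of[OF U yc])
    have db: "A'.d (Suc n) b \<in> A'.hat n {}"
      using A'.cycle_iff[OF U, of y n b] y yc ev_b A'.hat_keys[OF b] by (simp add: Suc)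
    interpret D: open_flabby_family X D dD by (rule open_flabby_family_D)
    have h0: "h p 0 = 0" and d0: "A.d p 0 = 0" for p
      by (rule additive.zero[OF additive_h] additive.zero[OF A.additive_d])+
    have "\<exists>u\<in>D (Suc n) U. id (b, 0) - dD (Suc n) u \<in> D n {}"
    proof (rule cycles_bound_open[OF open_flabby_family_D D.open_family_axioms, where f = "\<lambda>p. id" and n = n])
      show "Modules.additive (id :: ('h \<Rightarrow>\<^sub>0 int) \<times> ('g \<Rightarrow>\<^sub>0 int) \<Rightarrow> _)" by unfold_locales simp
      show "id c \<in> D p V" if "c \<in> D p V" for V p c using that by simp
      show "id (dD (Suc p) c) - dD (Suc p) (id c) \<in> D p {}" for p c
        using subgrp_0[OF D.subgrp[of "{}" p]] by simp
      show "openin X U" by (rule U)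
      show "(b, 0) \<in> D n U"
        using b db subgrp_0[OF A.hat.subgrp[OF U]] subgrp_minus[OF sub' db] by (auto simp: D_def Suc h0)
      show "0 < n \<longrightarrow> dD n (b, 0) \<in> D (n - 1) {}"
      proof
        assume "0 < n"
        then obtain q where q: "n = Suc q" by (cases n) auto
        have "A'.d (Suc 0) (A'.d (Suc (Suc 0)) b) \<in> A'.hat 0 {}" if "q = 0"
          using A'.hat.bd_bd[OF U, of b 0] b that by (simp add: Suc q)
        then show "dD n (b, 0) \<in> D (n - 1) {}"
          using subgrp_minus[OF sub' db] subgrp_0[OF sub]
          by (auto simp: q D_def dD_def h0 d0 additive.minus[OF A'.additive_d])
      qed
      fix x V assume V: "openin X V" "x \<in> V"
      \<comment> \<open>Two shrinkings are needed: from \<open>T\<close> to \<open>W\<close> the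
        second component of a cycle is bounded by some \<open>u\<close>. The first component can be
        corrected by \<open>u\<close> only over \<open>W\<close>, and is then bounded over
        \<open>V\<close>.\<close>
      have "\<exists>W. openin X W \<and> x \<in> W \<and> W \<subseteq> V \<and> (\<forall>q\<le>n. \<forall>a\<in>A'.hat (Suc q) W. A'.d (Suc q) a \<in> A'.hat q {} \<longrightarrow>
          (\<exists>y\<in>A'.hat (Suc (Suc q)) V. a - A'.d (Suc (Suc q)) y \<in> A'.hat (Suc q) {}))"
      proof (rule common_nbhd)
        fix q assume "q \<le> n"
        then have "locally_trivial X (reduced_homology_precosh A' B' \<xi>' (Suc q))"
          using lt'[of "Suc q"] by (simp add: Suc reduced_homology_precosh_pos)
        from A'.locally_trivialD[OF this V]
        show "\<exists>W. openin X W \<and> x \<in> W \<and> W \<subseteq> V \<and> (\<forall>a\<in>A'.hat (Suc q) W. A'.d (Suc q) a \<in> A'.hat q {} \<longrightarrow>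
          (\<exists>y\<in>A'.hat (Suc (Suc q)) V. a - A'.d (Suc (Suc q)) y \<in> A'.hat (Suc q) {}))"
          by simp
      next
        fix q S T assume "\<forall>a\<in>A'.hat (Suc q) T. A'.d (Suc q) a \<in> A'.hat q {} \<longrightarrow>
          (\<exists>y\<in>A'.hat (Suc (Suc q)) V. a - A'.d (Suc (Suc q)) y \<in> A'.hat (Suc q) {})"
          and ST: "openin X S" "openin X T" "S \<subseteq> T"
        then show "\<forall>a\<in>A'.hat (Suc q) S. A'.d (Suc q) a \<in> A'.hat q {} \<longrightarrow>
          (\<exists>y\<in>A'.hat (Suc (Suc q)) V. a - A'.d (Suc (Suc q)) y \<in> A'.hat (Suc q) {})"
          using A'.hat.mono[OF ST, of "Suc q"] by blast
      qed
      then obtain W where W: "openin X W" "x \<in> W" "W \<subseteq> V"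
        and die': "\<forall>q\<le>n. \<forall>a\<in>A'.hat (Suc q) W. A'.d (Suc q) a \<in> A'.hat q {} \<longrightarrow>
          (\<exists>y\<in>A'.hat (Suc (Suc q)) V. a - A'.d (Suc (Suc q)) y \<in> A'.hat (Suc q) {})"
        by (elim exE conjE)
      have "\<exists>T. openin X T \<and> x \<in> T \<and> T \<subseteq> W \<and> (\<forall>q\<le>n. \<forall>a\<in>A.hat q T.
          (if q = 0 then a \<in> R T else A.d q a \<in> A.hat (q - 1) {}) \<longrightarrow>
          (\<exists>u\<in>A.hat (Suc q) W. a - A.d (Suc q) u \<in> A.hat q {}))"
      proof (rule common_nbhd)
        show "\<exists>T. openin X T \<and> x \<in> T \<and> T \<subseteq> W \<and> (\<forall>a\<in>A.hat q T.
            (if q = 0 then a \<in> R T else A.d q a \<in> A.hat (q - 1) {}) \<longrightarrow>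
            (\<exists>u\<in>A.hat (Suc q) W. a - A.d (Suc q) u \<in> A.hat q {}))" if "q \<le> n" for q
          by (rule A.locally_trivialD[OF lt W(1,2)]) (use that in \<open>simp add: Suc\<close>)
      next
        fix q S T assume "\<forall>a\<in>A.hat q T. (if q = 0 then a \<in> R T else A.d q a \<in> A.hat (q - 1) {}) \<longrightarrow>
            (\<exists>u\<in>A.hat (Suc q) W. a - A.d (Suc q) u \<in> A.hat q {})"
          and ST: "openin X S" "openin X T" "S \<subseteq> T"
        then show "\<forall>a\<in>A.hat q S. (if q = 0 then a \<in> R S else A.d q a \<in> A.hat (q - 1) {}) \<longrightarrow>
            (\<exists>u\<in>A.hat (Suc q) W. a - A.d (Suc q) u \<in> A.hat q {})"
          using A.hat.mono[OF ST, of q] R_mono[OF ST] by (auto split: if_splits)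
      qed
      then obtain T where T: "openin X T" "x \<in> T" "T \<subseteq> W"
        and die: "\<forall>q\<le>n. \<forall>a\<in>A.hat q T. (if q = 0 then a \<in> R T else A.d q a \<in> A.hat (q - 1) {}) \<longrightarrow>
          (\<exists>u\<in>A.hat (Suc q) W. a - A.d (Suc q) u \<in> A.hat q {})"
        by (elim exE conjE)
      have "\<exists>u\<in>D (Suc q) V. g - dD (Suc q) u \<in> D q {}"
        if q: "q \<le> n" and g: "g \<in> D q T" and cyc: "0 < q \<longrightarrow> dD q g \<in> D (q - 1) {}" for q g
      proof -
        obtain v w where vw: "g = (v, w)" "v \<in> A'.hat (Suc q) T" "w \<in> A.hat q T"
          and vw0: "q = 0 \<Longrightarrow> h 0 w - A'.d (Suc 0) v \<in> A'.hat 0 {}"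
          using g by (auto simp: D_def)
        \<comment> \<open>In positive degree this is the cycle condition; in degree 0 it is built
          into \<open>D\<close>.\<close>
        have hw: "h q w - A'.d (Suc q) v \<in> A'.hat q {}"
          using vw0 cyc vw(1) by (cases q) (auto simp: D_def dD_def)
        have "if q = 0 then w \<in> R T else A.d q w \<in> A.hat (q - 1) {}"
          using cyc vw in_R_if_bounds[OF T(1), of w v] hw by (auto simp: D_def dD_def)
        then obtain u where u: "u \<in> A.hat (Suc q) W" "w - A.d (Suc q) u \<in> A.hat q {}"
          using die q vw(3) by blast
        \<comment> \<open>The boundaries of \<open>v\<close> and of \<open>h (Suc q) u\<close> both
          agree with \<open>h q w\<close> modulo zero, so the difference is a cycle.\<close>
        let ?v = "v - h (Suc q) u"
        have v: "?v \<in> A'.hat (Suc q) W"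
          using vw(2) A'.hat.mono[OF T(1) W(1) T(3), of "Suc q"] h_hat[OF W(1) u(1)]
          by (intro subgrp_diff[OF A'.hat.subgrp[OF W(1)]]) auto
        have "h q (w - A.d (Suc q) u) - (h q w - A'.d (Suc q) v)
            + (h q (A.d (Suc q) u) - A'.d (Suc q) (h (Suc q) u)) \<in> A'.hat q {}"
          by (intro subgrp_add[OF sub'] subgrp_diff[OF sub'] hw h_hat[OF _ u(2)] h_d A.hat_keys[OF u(1)]) simp
        then have "A'.d (Suc q) ?v \<in> A'.hat q {}"
          by (simp add: additive.diff[OF additive_h] additive.diff[OF A'.additive_d])
        then obtain t where t: "t \<in> A'.hat (Suc (Suc q)) V" "?v - A'.d (Suc (Suc q)) t \<in> A'.hat (Suc q) {}"
          using die' q v by blast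
        have uV: "u \<in> A.hat (Suc q) V" using u(1) A.hat.mono[OF W(1) V(1) W(3), of "Suc q"] by blast
        \<comment> \<open>The sign of \<open>- t\<close> compensates the minus in the first
          component of \<open>dD\<close>.\<close>
        have "(- t, u) \<in> D (Suc q) V"
          using uV subgrp_minus[OF A'.hat.subgrp[OF V(1)] t(1)] by (simp add: D_def)
        moreover have "(v, w) - dD (Suc q) (- t, u) \<in> D q {}"
        proof -
          have "h 0 (w - A.d (Suc q) u) - A'.d (Suc 0) (?v - A'.d (Suc (Suc q)) t) \<in> A'.hat 0 {}" if "q = 0"
            using subgrp_diff[OF sub' h_hat[OF _ u(2)] A'.d_hat[OF _ t(2)]] that by simp
          then show ?thesis
            using u(2) t(2) by (auto simp: D_def dD_def additive.minus[OF A'.additive_d] algebra_simps)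
        qed
        ultimately show ?thesis unfolding vw(1) by blast
      qed
      then show "\<exists>T. openin X T \<and> x \<in> T \<and> T \<subseteq> V \<and> (\<forall>q\<le>n. \<forall>g\<in>D q T. (0 < q \<longrightarrow> dD q g \<in> D (q - 1) {}) \<longrightarrow>
          (\<exists>u\<in>D (Suc q) V. g - dD (Suc q) u \<in> D q {}))"
        using T W(3) by (intro exI[of _ T]) auto
    qed
    then obtain t u where t: "t \<in> A'.hat (Suc m) U" and u: "u \<in> A.hat m U"
      and bu: "(b, 0) - dD (Suc n) (t, u) \<in> D n {}"
      by (auto simp: D_def Suc)
    \<comment> \<open>The two components of \<open>bu\<close>: the first compares \<open>b\<close>
      with the image of \<open>u\<close>, the second makes \<open>u\<close> a cycle.\<close>
    have 1: "b - (h m u - A'.d (Suc m) t) \<in> A'.hat m {}" and 2: "- A.d m u \<in> A.hat n {}"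
      using bu by (auto simp: D_def dD_def Suc)
    obtain z where z: "z \<in> carrier (grp (csec A U) m)" "ev (A.G m) u = cext A (topspace X) U m z"
      using u by (auto simp: A.in_hat_iff)
    have "A.d (Suc n) u \<in> A.hat n {}" using subgrp_minus[OF sub 2] by (simp add: Suc)
    then have zcyc: "z \<in> cycles (csec A U) m"
      using A.cycle_iff[OF U, of z n u] z A.hat_keys[OF u] by (simp add: Suc)
    let ?w = "y \<otimes>\<^bsub>grp (csec A' U) m\<^esub> inv\<^bsub>grp (csec A' U) m\<^esub> \<eta> U m z"
    interpret G: group "grp (csec A' U) m" by (rule U.D.group)
    have wc: "?w \<in> carrier (grp (csec A' U) m)" using yc U.f_closed[OF z(1)] by simp
    have hu: "Poly_Mapping.keys (h m u) \<subseteq> carrier (A'.G m)" by (rule keys_h[OF A.hat_keys[OF u]])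
    have k: "Poly_Mapping.keys (b - h m u) \<subseteq> carrier (A'.G m)"
      using keys_diff[of b "h m u"] A'.hat_keys[OF b] hu by blast
    interpret e: group_hom "grp (csec A' U) m" "A'.G m" "cext A' (topspace X) U m"
      using complex_map.group_hom_f[OF A'.complex_map[OF U _ openin_subset[OF U]]] by simp
    have "ev (A'.G m) (b - h m u) = cext A' (topspace X) U m ?w"
      using U.f_closed[OF z(1)] yc
      by (simp add: ev_diff[OF A'.G_comm A'.hat_keys[OF b] hu] ev_b ev_h[OF A.hat_keys[OF u]] z(2) \<eta>_nat[OF U z(1)])
    moreover have "(b - h m u) - A'.d (Suc m) (- t) \<in> A'.hat m {}"
      using 1 by (simp add: additive.minus[OF A'.additive_d] algebra_simps)
    ultimately have "?w \<in> boundaries (csec A' U) m"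
      using A'.boundary_iff[OF U wc k] subgrp_minus[OF A'.hat.subgrp[OF U] t] by blast
    then show ?thesis using zcyc by blast
  qed
qed

end

theorem theorem4p9:
  fixes X :: "'a topology"
    and \<AA> :: "('a, 'g) cprecosh" and \<AA>' :: "('a, 'h) cprecosh"
    and A :: "('a, 'b) precosh" and A' :: "('a, 'c) precosh"
    and \<eta> :: "'a set \<Rightarrow> nat \<Rightarrow> 'g \<Rightarrow> 'h"
    and \<zeta> :: "'a set \<Rightarrow> 'b \<Rightarrow> 'c"
    and \<xi> :: "'a set \<Rightarrow> 'g \<Rightarrow> 'b" and \<xi>' :: "'a set \<Rightarrow> 'h \<Rightarrow> 'c"
    and m :: nat
  assumes "paracompact_space X"
    and "ccosheaf X \<AA>" and "cflabby X \<AA>"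
    and "ccosheaf X \<AA>'" and "cflabby X \<AA>'"
    and "cnat_transf X \<AA> \<AA>' \<eta>"
    and "precosheaf X A" and "precosheaf X A'"
    and "nat_transf X A A' \<zeta>"
    and "nat_transf X (cdeg \<AA> 0) A \<xi>"
    and "nat_transf X (cdeg \<AA>' 0) A' \<xi>'"
    and "\<And>U x. openin X U \<Longrightarrow> x \<in> carrier (grp (csec \<AA> U) 0) \<Longrightarrow> \<xi>' U (\<eta> U 0 x) = \<zeta> U (\<xi> U x)"
    and "caugmentation X \<AA> A \<xi>" and "caugmentation X \<AA>' A' \<xi>'"
    and "\<And>U. openin X U \<Longrightarrow>
           \<eta> U 0 ` carrier (grp (csec \<AA> U) 0) = carrier (grp (csec \<AA>' U) 0)"
    and "\<And>U. openin X U \<Longrightarrow> inj_on (\<zeta> U) (carrier (sec A U))"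
  shows "((\<forall>p\<le>m. locally_trivial X (reduced_homology_precosh \<AA> A \<xi> p)) \<longrightarrow>
            (\<forall>U. openin X U \<longrightarrow>
               inj_on (homology_map (csec \<AA>' U) (\<eta> U) m) (carrier (homology (csec \<AA> U) m)))) \<and>
         ((\<forall>p<m. locally_trivial X (reduced_homology_precosh \<AA> A \<xi> p)) \<and>
          (\<forall>q\<in>{1..m}. locally_trivial X (homology_precosh \<AA>' q)) \<longrightarrow>
            (\<forall>U. openin X U \<longrightarrow>
               homology_map (csec \<AA>' U) (\<eta> U) m ` carrier (homology (csec \<AA> U) m)
                 = carrier (homology (csec \<AA>' U) m)))"
proof -
  interpret comparison X \<AA> \<AA>' A A' \<eta> \<zeta> \<xi> \<xi>'
    by unfold_locales (use assms in auto)
  show ?thesis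
    using injective_part[of m] surjective_part[of m] by auto
qed

end
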